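(* Let $L\ge1$ and for each positive integer $\nu$ let $\mathcal M^L_\nu=\{\vec m\in\mathcal C_L:\ |m_j|\le\nu,\ \forall\,1\le j\le L\}$. Then, as $\nu\to\infty$, $$\mu(\mathcal M_\nu^L)\sim\Big(\frac{\pi}{6}\Big)^{L/2}\,\big\langle|\det X|\big\rangle_{\overline C_\infty}\,\dim V(\mathcal M_\nu^L),$$ where $\langle|\det X|\rangle_{\overline C_\infty}$ is the expectation of $|\det X|$ with respect to the centered Gaussian probability measure on the space $\mathrm{Sym}_L$ of real symmetric $L\times L$ matrices whose covariance matrix has the block form $$\overline C_\infty=G_L\big(\tfrac95,1\big)\oplus\mathbf 1_{\binom L2}$$ with respect to the decomposition $\mathrm{Sym}_L=\mathcal D_L\oplus\mathcal D_L^\perp$.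
   Context: $\mathbb T^L=\mathbb R^L/(2\pi\mathbb Z)^L$ with the flat metric and angular coordinates $\theta_j$. $\mathcal C_L$ is the set of $\vec m\in\mathbb Z^L\setminus\{0\}$ whose first nonzero coordinate is positive. For finite $\mathcal M\subset\mathcal C_L$, $V(\mathcal M)\subset C^\infty(\mathbb T^L)$ is the span of $\cos(\sum_jm_j\theta_j)$ and $\sin(\sum_jm_j\theta_j)$, $\vec m\in\mathcal M$, with the $L^2(\mathbb T^L)$ inner product, and $\mu(\mathcal M)=\frac1{\mathrm{area}(S)}\int_S\mu(v)\,|dS(v)|$, where $S$ is the unit sphere of $V(\mathcal M)$ and $\mu(v)$ is the number of critical points of $v$. $H_{ij}$ ($i\le j$) is the symmetric $L\times L$ matrix whose only nonzero entries are in positions $(i,j)$ and $(j,i)$ and are equal to $1$. $\mathrm{Sym}_L$ is given the inner product making $(H_{ij})_{i\le j}$ orthonormal; $\mathcal D_L=\mathrm{span}\{H_{ii}\}$ is the space of diagonal matrices, $\mathcal D_L^\perp=\mathrm{span}\{H_{ij}:i<j\}$. $G_L(a,b)$ is the $L\times L$ matrix with diagonal entries $a$ and off-diagonal entries $b$. Concretely, for $X$ distributed according to $\overline C_\infty$, the entries $x_{ij}$, $i\le j$, are jointly centered Gaussian, each $x_{ii}$ has variance $9/5$, $\mathrm{cov}(x_{ii},x_{jj})=1$ for $i\ne j$, the $x_{ij}$ with $i<j$ have variance $1$, and all other covariances vanish. $a_\nu\sim b_\nu$ means $a_\nu/b_\nu\to1$. *)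

theory Defs
  imports "HOL-Analysis.Analysis" "HOL-Library.Function_Algebras"
begin

text \<open>The real vector space of functions, so that \<^const>\<open>span\<close> and \<^const>\<open>dim\<close> apply.\<close>

instantiation "fun" :: (type, real_vector) real_vector
begin

definition scaleR_fun :: "real \<Rightarrow> ('a \<Rightarrow> 'b) \<Rightarrow> 'a \<Rightarrow> 'b"
  where "scaleR_fun c f = (\<lambda>x. c *\<^sub>R f x)"

instance
  by standard (simp_all add: scaleR_fun_def fun_eq_iff algebra_simps)

end

text \<open>
  The dimension \<open>L\<close> is \<open>CARD('n)\<close>, where \<open>'n\<close> is a finite index type whose linear order is the order
  of the coordinates. Smooth functions on the torus are represented by their \<open>2\<pi>\<close>-periodic lifts
  to \<open>\<real>\<^sup>L\<close>.
\<close>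

definition torus_rel :: "((real^'n) \<times> (real^'n)) set"
  where "torus_rel = {(x, y). \<forall>j. \<exists>k::int. y $ j - x $ j = 2 * pi * of_int k}"

text \<open>For a periodic \<open>v\<close> the condition does not depend on the representative \<open>\<theta>\<close> of the point \<open>p\<close>.\<close>

definition critical_points :: "(real^'n \<Rightarrow> real) \<Rightarrow> (real^'n) set set"
  where "critical_points v = {p \<in> UNIV // torus_rel. \<exists>\<theta>\<in>p. (v has_derivative (\<lambda>_. 0)) (at \<theta>)}"

text \<open>The cardinality, which is \<open>\<infinity>\<close> if there are infinitely many critical points.\<close>

definition num_critical :: "(real^'n \<Rightarrow> real) \<Rightarrow> ennreal"
  where "num_critical v = emeasure (count_space UNIV) (critical_points v)"

definition l2_inner :: "(real^'n \<Rightarrow> real) \<Rightarrow> (real^'n \<Rightarrow> real) \<Rightarrow> real"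
  where "l2_inner f g = (LINT \<theta> : cbox 0 (\<chi> j. 2 * pi) | lborel. f \<theta> * g \<theta>)"

definition l2_norm :: "(real^'n \<Rightarrow> real) \<Rightarrow> real"
  where "l2_norm f = sqrt (l2_inner f f)"

definition freq_cone :: "(int^'n::{finite,linorder}) set"
  where "freq_cone = {m. \<exists>j. m $ j > 0 \<and> (\<forall>i<j. m $ i = 0)}"

definition phase :: "int^'n \<Rightarrow> real^'n \<Rightarrow> real"
  where "phase m \<theta> = (\<Sum>j\<in>UNIV. of_int (m $ j) * \<theta> $ j)"

definition trig_space :: "(int^'n) set \<Rightarrow> (real^'n \<Rightarrow> real) set"
  where "trig_space M =
    span ((\<lambda>m \<theta>. cos (phase m \<theta>)) ` M \<union> (\<lambda>m \<theta>. sin (phase m \<theta>)) ` M)"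

definition l2_orthonormal_basis ::
    "(real^'n \<Rightarrow> real) set \<Rightarrow> (real^'n \<Rightarrow> real) set \<Rightarrow> bool"
  where "l2_orthonormal_basis V B \<longleftrightarrow> finite B \<and> B \<subseteq> V \<and> span B = V \<and>
    (\<forall>f\<in>B. \<forall>g\<in>B. l2_inner f g = (if f = g then 1 else 0))"

text \<open>
  Lebesgue measure of a finite-dimensional space \<open>V\<close> of smooth functions with the \<open>L\<^sup>2\<close> inner product,
  on the Borel sets of \<open>V\<close>: Lebesgue measure of \<open>\<real>\<^sup>B\<close>, transported by the isometry
  \<open>c \<mapsto> \<Sum>b\<in>B. c\<^sub>b b\<close> that an orthonormal basis \<open>B\<close> of \<open>V\<close> defines. The choice of \<open>B\<close> does not matter,
  because Lebesgue measure is invariant under orthogonal maps.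
\<close>

definition l2_lebesgue :: "(real^'n \<Rightarrow> real) set \<Rightarrow> (real^'n \<Rightarrow> real) measure"
  where "l2_lebesgue V =
    (let B = (SOME B. l2_orthonormal_basis V B) in
      distr (\<Pi>\<^sub>M b\<in>B. lborel)
        (vimage_algebra V (\<lambda>v. \<lambda>b\<in>B. l2_inner v b) (\<Pi>\<^sub>M b\<in>B. borel))
        (\<lambda>c. \<Sum>b\<in>B. c b *\<^sub>R b))"

definition l2_sphere :: "(real^'n \<Rightarrow> real) set \<Rightarrow> (real^'n \<Rightarrow> real) set"
  where "l2_sphere V = {v \<in> V. l2_norm v = 1}"

text \<open>
  The surface measure of the unit sphere: the area of \<open>A\<close> is \<open>dim V\<close> times the volume of the cone
  \<open>{tv | 0 < t \<le> 1, v \<in> A}\<close>, which is the preimage of \<open>A\<close> under the radial projection of the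
  punctured unit ball.
\<close>

definition sphere_area :: "(real^'n \<Rightarrow> real) set \<Rightarrow> (real^'n \<Rightarrow> real) measure"
  where "sphere_area V = scale_measure (of_nat (dim V))
    (distr (restrict_space (l2_lebesgue V) {v \<in> V. 0 < l2_norm v \<and> l2_norm v \<le> 1})
      (restrict_space (l2_lebesgue V) (l2_sphere V))
      (\<lambda>v. (1 / l2_norm v) *\<^sub>R v))"

definition mean_critical :: "(int^'n) set \<Rightarrow> ennreal"
  where "mean_critical M =
    (let V = trig_space M in
      1 / emeasure (sphere_area V) (l2_sphere V) * (\<integral>\<^sup>+ v. num_critical v \<partial>sphere_area V))"

definition freq_box :: "nat \<Rightarrow> (int^'n::{finite,linorder}) set"
  where "freq_box \<nu> = {m \<in> freq_cone. \<forall>j. \<bar>m $ j\<bar> \<le> int \<nu>}"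

definition sym_matrices :: "(real^'n^'n) set"
  where "sym_matrices = {X. transpose X = X}"

definition sym_unit :: "'n \<Rightarrow> 'n \<Rightarrow> real^'n^'n"
  where "sym_unit i j = (\<chi> k l. if (k, l) = (i, j) \<or> (k, l) = (j, i) then 1 else 0)"

text \<open>The pairs \<open>i \<le> j\<close>, which index the orthonormal basis \<open>H\<^sub>i\<^sub>j\<close> of the symmetric matrices.\<close>

typedef (overloaded) 'n sym_index = "{(i, j). i \<le> (j::'n::linorder)}"
  by auto

instance sym_index :: ("{finite,linorder}") finite
proof
  have "finite (range (Rep_sym_index :: 'a sym_index \<Rightarrow> _))"
    by (rule finite_subset[OF subset_UNIV]) simp
  moreover have "inj (Rep_sym_index :: 'a sym_index \<Rightarrow> _)"
    by (simp add: inj_on_def Rep_sym_index_inject)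
  ultimately show "finite (UNIV :: 'a sym_index set)"
    by (rule finite_imageD)
qed

definition idx_row :: "'n::linorder sym_index \<Rightarrow> 'n"
  where "idx_row p = fst (Rep_sym_index p)"

definition idx_col :: "'n::linorder sym_index \<Rightarrow> 'n"
  where "idx_col p = snd (Rep_sym_index p)"

definition sym_of_coords :: "real^('n::{finite,linorder} sym_index) \<Rightarrow> real^('n::{finite,linorder})^('n::{finite,linorder})"
  where "sym_of_coords x = (\<Sum>p\<in>UNIV. (x $ p) *\<^sub>R sym_unit (idx_row p) (idx_col p))"

definition G_matrix :: "real \<Rightarrow> real \<Rightarrow> real^'n^'n"
  where "G_matrix a b = (\<chi> i j. if i = j then a else b)"

text \<open>The block sum of \<open>A\<close> on the diagonal matrices and the identity on their orthogonal complement.\<close>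

definition diag_block_sum ::
    "real^('n::{finite,linorder})^('n::{finite,linorder}) \<Rightarrow> real^('n::{finite,linorder} sym_index)^('n::{finite,linorder} sym_index)"
  where "diag_block_sum A = (\<chi> p q.
    if idx_row p = idx_col p \<and> idx_row q = idx_col q then A $ idx_row p $ idx_row q
    else if p = q then 1 else 0)"

text \<open>The centered Gaussian measure with (positive definite) covariance matrix \<open>C\<close>, by its density.\<close>

definition centered_gaussian :: "real^'m^'m \<Rightarrow> (real^'m) measure"
  where "centered_gaussian C = density lborel (\<lambda>x.
    ennreal (exp (- (x \<bullet> (matrix_inv C *v x)) / 2) / sqrt ((2 * pi) ^ CARD('m) * det C)))"

definition sym_gaussian ::
    "real^('n::{finite,linorder} sym_index)^('n::{finite,linorder} sym_index) \<Rightarrow> (real^('n::{finite,linorder})^('n::{finite,linorder})) measure"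
  where "sym_gaussian C =
    distr (centered_gaussian C) (restrict_space borel sym_matrices) sym_of_coords"

definition C_infty :: "real^('n::{finite,linorder} sym_index)^('n sym_index)"
  where "C_infty = diag_block_sum (G_matrix (9 / 5) 1)"

end

theory Submission
  imports Defs "HOL-Probability.Distributions"
begin

text \<open>
  Let \<open>L\<close> be the dimension. For every \<open>\<nu> \<ge> 1\<close> the mean number of critical points can be computed exactly
  (\<open>mean_critical_freq_box\<close>): it is \<open>(2\<pi> \<nu>(\<nu>+1)/3)\<close> to the power \<open>L/2\<close>, times the expectation of \<open>|det X|\<close>,
  where \<open>X\<close> is a centered Gaussian symmetric matrix with covariance \<open>G(r, 1) \<oplus> 1\<close> and
  \<open>r = 9/5 - 3/(5\<nu>(\<nu>+1))\<close>. As \<open>dim V = (2\<nu>+1)\<^sup>L - 1\<close>, the factor is asymptotic to \<open>(\<pi>/6)\<close> to the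
  power \<open>L/2\<close> times \<open>dim V\<close>. As \<open>r\<close> tends to \<open>9/5\<close>, the claim follows, because the expectation of \<open>|det X|\<close>
  depends continuously on \<open>r\<close> (\<open>mean_abs_det_tendsto\<close>) and is positive (\<open>mean_abs_det_pos\<close>).

  \<^emph>\<open>From the sphere to Gaussian coefficients.\<close> Rescaling a function does not move its critical points.
  The mean over the sphere is therefore the mean over \<open>v = \<Sum>b\<in>B. c\<^sub>b b\<close> with independent standard Gaussian
  coefficients, for an orthonormal basis \<open>B\<close> (\<open>sphere_mean_eq_gauss_mean\<close>). It does not matter which basis is
  taken: only covariances enter, and Parseval's identity (\<open>parseval\<close>) evaluates them in the trigonometric one.

  \<^emph>\<open>The Kac-Rice formula.\<close> Let the gradient of \<open>v\<close> have covariance \<open>S\<close> times the identity at every point, and be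
  uncorrelated with the Hessian at that point. The expected number of zeros of the gradient in a set is then the integral
  of \<open>(2\<pi>S)\<close> to the power \<open>-L/2\<close> times the expectation of \<open>|det Hess v|\<close>. The proof turns
  the conditioning on the gradient into an average over translates. Fix a base point \<open>\<tau>\<close>; there are directions in the space of coefficients along which
  the gradient at \<open>\<tau>\<close> is translated by any \<open>z \<in> \<real>\<^sup>L\<close>. Integrating over coefficients is the same as averaging over
  such translates of \<open>c\<close> first (\<open>nn_integral_leb_average_translates\<close>). For fixed \<open>c\<close> and for \<open>\<theta>\<close> near \<open>\<tau>\<close>, the
  translate by \<open>z\<close> has a critical point at \<open>\<theta>\<close> exactly if \<open>z = g(\<theta>)\<close> for a certain smooth map \<open>g\<close> into \<open>\<real>\<^sup>L\<close>. The
  integral over \<open>z\<close> of the number of critical points is thus an integral of the number of preimages under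
  \<open>g\<close>, which the area formula (\<open>area_formula\<close>) turns into an integral over \<open>\<theta>\<close> (\<open>expected_zeros_local\<close>). The density
  found in this way depends on \<open>\<tau>\<close>, but it equals the one of Kac and Rice at \<open>\<theta> = \<tau>\<close> (\<open>dens_diag\<close>) and is continuous
  there (\<open>crit_dens_tendsto\<close>). Cutting the period cell into small pieces, each with a base point of its own,
  yields \<open>expected_zeros_period_cell\<close>.

  \<^emph>\<open>Covariances.\<close> The sums of \<open>m\<^sub>i m\<^sub>j\<close> and of \<open>m\<^sub>i m\<^sub>j m\<^sub>k m\<^sub>l\<close> over the box of frequencies factor over the
  coordinates (\<open>sum_pairs_freq_box\<close>, \<open>sum_quadruples_freq_box\<close>). They show that the gradient has a multiple of the
  identity as its covariance, and that the one of the Hessian is a multiple of \<open>G(r, 1) \<oplus> 1\<close>. A linear image of a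
  Gaussian vector depends on its covariance alone (\<open>gauss_coords_linear_image\<close>); with an explicit square
  root of the covariance (\<open>cov_root_sq\<close>) this identifies the expectation of \<open>|det Hess v|\<close> (\<open>hess_law\<close>).
\<close>

section \<open>Independent standard Gaussian coordinates\<close>

definition leb_coords :: "'b set \<Rightarrow> ('b \<Rightarrow> real) measure"
  where "leb_coords B = (\<Pi>\<^sub>M b\<in>B. lborel)"

interpretation leb: product_sigma_finite "\<lambda>_::'b. lborel :: real measure"
  by standard

lemma sets_leb_coords: "sets (leb_coords B) = sets (\<Pi>\<^sub>M b\<in>B. borel)"
  unfolding leb_coords_def by (rule sets_PiM_cong) auto

lemma space_leb_coords: "space (leb_coords B) = extensional B"
  by (simp add: leb_coords_def space_PiM PiE_def)

lemma sigma_finite_leb_coords: "finite B \<Longrightarrow> sigma_finite_measure (leb_coords B)"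
  unfolding leb_coords_def by (rule leb.sigma_finite)

lemma measurable_coord [measurable (raw)]:
  "b \<in> B \<Longrightarrow> (\<lambda>c. c b) \<in> borel_measurable (leb_coords B)"
  unfolding leb_coords_def using measurable_component_singleton[of b B "\<lambda>_. lborel :: real measure"]
  by simp

lemma measurable_into_leb_coords:
  assumes "\<And>b. b \<in> B \<Longrightarrow> f b \<in> borel_measurable N"
  shows "(\<lambda>x. \<lambda>b\<in>B. f b x) \<in> N \<rightarrow>\<^sub>M leb_coords B"
  unfolding leb_coords_def by (rule measurable_restrict) (use assms in simp)

lemma nn_integral_leb_insert:
  assumes "finite B" "i \<notin> B" and [measurable]: "F \<in> borel_measurable (leb_coords (insert i B))"
  shows "(\<integral>\<^sup>+ c. F c \<partial>leb_coords (insert i B)) = (\<integral>\<^sup>+ c. (\<integral>\<^sup>+ y. F (c(i := y)) \<partial>lborel) \<partial>leb_coords B)"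
  using leb.product_nn_integral_insert[OF assms(1,2)] assms(3) unfolding leb_coords_def by simp

lemma measurable_upd_leb [measurable]:
  "(\<lambda>(c, y). c(i := y)) \<in> leb_coords B \<Otimes>\<^sub>M borel \<rightarrow>\<^sub>M leb_coords (insert i B)"
proof -
  have "(\<lambda>(c, y). c(i := y)) \<in> leb_coords B \<Otimes>\<^sub>M lborel \<rightarrow>\<^sub>M leb_coords (insert i B)"
    unfolding leb_coords_def by (rule measurable_add_dim)
  then show ?thesis by (simp cong: measurable_cong_sets)
qed

lemma nn_integral_leb_affine:
  assumes "finite B" "s > 0" and "F \<in> borel_measurable (leb_coords B)"
  shows "(\<integral>\<^sup>+ c. F c \<partial>leb_coords B) =
    ennreal (s ^ card B) * (\<integral>\<^sup>+ c. F (\<lambda>b\<in>B. s * c b + d b) \<partial>leb_coords B)"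
  using assms(1,3)
proof (induction B arbitrary: F rule: finite_induct)
  case empty
  have "(\<lambda>b\<in>{}. s * c b + d b) = (\<lambda>_. undefined)" for c :: "'a \<Rightarrow> real" by auto
  then show ?case by (simp add: leb_coords_def PiM_empty nn_integral_count_space_finite)
next
  case (insert i B)
  note [measurable] = insert.prems
  have [measurable]: "(\<lambda>c. \<lambda>b\<in>B. s * c b + d b) \<in> leb_coords B \<rightarrow>\<^sub>M leb_coords B" for B
    by (rule measurable_into_leb_coords) measurable
  have eq: "(\<lambda>b\<in>insert i B. s * (c(i := y)) b + d b) = (\<lambda>b\<in>B. s * c b + d b)(i := s * y + d i)" for c y
    using insert.hyps by (auto simp: fun_eq_iff)
  have [measurable]: "(\<lambda>(c, y). F (c(i := y))) \<in> borel_measurable (leb_coords B \<Otimes>\<^sub>M borel)"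
    using measurable_compose[OF measurable_upd_leb insert.prems] by (simp add: split_beta)
  have mF: "(\<lambda>c. \<integral>\<^sup>+ y. F (c(i := y)) \<partial>lborel) \<in> borel_measurable (leb_coords B)"
    by measurable
  have my: "(\<lambda>y. F (c(i := y))) \<in> borel_measurable borel" if "c \<in> space (leb_coords B)" for c
    using measurable_compose[OF measurable_Pair1'[OF that, of borel] measurable_compose[OF measurable_upd_leb insert.prems]]
    by (simp add: fun_upd_def)
  have mem: "(\<lambda>b\<in>B. s * c b + d b) \<in> space (leb_coords B)" for c
    by (simp add: space_leb_coords)
  have step: "(\<integral>\<^sup>+ y. F ((\<lambda>b\<in>B. s * c b + d b)(i := y)) \<partial>lborel) =
      ennreal s * (\<integral>\<^sup>+ y. F (\<lambda>b\<in>insert i B. s * (c(i := y)) b + d b) \<partial>lborel)" for c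
    using nn_integral_real_affine[OF my[OF mem[of c]], of s "d i"] \<open>s > 0\<close>
    unfolding eq by (simp only: add.commute[of "d i"]) simp
  have "(\<integral>\<^sup>+ c. F c \<partial>leb_coords (insert i B)) = (\<integral>\<^sup>+ c. (\<integral>\<^sup>+ y. F (c(i := y)) \<partial>lborel) \<partial>leb_coords B)"
    by (rule nn_integral_leb_insert) (use insert in auto)
  also have "\<dots> = ennreal (s ^ card B) * (\<integral>\<^sup>+ c. (\<integral>\<^sup>+ y. F ((\<lambda>b\<in>B. s * c b + d b)(i := y)) \<partial>lborel) \<partial>leb_coords B)"
    by (rule insert.IH[OF mF])
  also have "(\<integral>\<^sup>+ c. (\<integral>\<^sup>+ y. F ((\<lambda>b\<in>B. s * c b + d b)(i := y)) \<partial>lborel) \<partial>leb_coords B) =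
      (\<integral>\<^sup>+ c. ennreal s * (\<integral>\<^sup>+ y. F (\<lambda>b\<in>insert i B. s * (c(i := y)) b + d b) \<partial>lborel) \<partial>leb_coords B)"
    by (simp only: step)
  also have "(\<integral>\<^sup>+ c. ennreal s * (\<integral>\<^sup>+ y. F (\<lambda>b\<in>insert i B. s * (c(i := y)) b + d b) \<partial>lborel) \<partial>leb_coords B) =
      ennreal s * (\<integral>\<^sup>+ c. (\<integral>\<^sup>+ y. F (\<lambda>b\<in>insert i B. s * (c(i := y)) b + d b) \<partial>lborel) \<partial>leb_coords B)"
  proof (rule nn_integral_cmult)
    have "(\<lambda>x. F (\<lambda>b\<in>insert i B. s * (x b) + d b)) \<in> borel_measurable (leb_coords (insert i B))" by measurable
    from measurable_compose[OF measurable_upd_leb this]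
    have "(\<lambda>(c, y). F (\<lambda>b\<in>insert i B. s * (c(i := y)) b + d b)) \<in> borel_measurable (leb_coords B \<Otimes>\<^sub>M borel)"
      by (simp add: split_beta)
    then show "(\<lambda>c. \<integral>\<^sup>+ y. F (\<lambda>b\<in>insert i B. s * (c(i := y)) b + d b) \<partial>lborel) \<in> borel_measurable (leb_coords B)"
      by measurable
  qed
  also have "(\<integral>\<^sup>+ c. (\<integral>\<^sup>+ y. F (\<lambda>b\<in>insert i B. s * (c(i := y)) b + d b) \<partial>lborel) \<partial>leb_coords B) =
      (\<integral>\<^sup>+ c. F (\<lambda>b\<in>insert i B. s * c b + d b) \<partial>leb_coords (insert i B))"
    by (rule nn_integral_leb_insert[symmetric]) (use insert.hyps in measurable)
  finally show ?case
    using insert.hyps \<open>s > 0\<close> by (simp add: ennreal_mult' mult_ac del: restrict_apply insert_iff)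
qed

definition gauss_coords :: "'b set \<Rightarrow> ('b \<Rightarrow> real) \<Rightarrow> real"
  where "gauss_coords B c = (\<Prod>b\<in>B. std_normal_density (c b))"

lemma gauss_coords_nonneg [simp]: "0 \<le> gauss_coords B c"
  by (simp add: gauss_coords_def prod_nonneg)

lemma measurable_gauss_coords [measurable]: "gauss_coords B \<in> borel_measurable (leb_coords B)"
  unfolding gauss_coords_def by measurable

lemma gauss_coords_eq:
  "gauss_coords B c = (1 / sqrt (2 * pi)) ^ card B * exp (- (\<Sum>b\<in>B. (c b)\<^sup>2) / 2)"
  by (cases "finite B")
     (auto simp: gauss_coords_def std_normal_density_def prod.distrib prod_dividef exp_sum[symmetric]
       sum_divide_distrib sum_negf power_one_over)

lemma nn_integral_leb_prod:
  assumes "finite B" "\<And>b. b \<in> B \<Longrightarrow> f b \<in> borel_measurable borel"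
  shows "(\<integral>\<^sup>+ c. (\<Prod>b\<in>B. f b (c b)) \<partial>leb_coords B) = (\<Prod>b\<in>B. \<integral>\<^sup>+ x. f b x \<partial>lborel)"
  unfolding leb_coords_def by (rule leb.product_nn_integral_prod) (use assms in auto)

lemma nn_integral_std_normal_exp:
  "(\<integral>\<^sup>+ x. ennreal (std_normal_density x * exp (t * x)) \<partial>lborel) = ennreal (exp (t\<^sup>2 / 2))"
proof -
  have "std_normal_density x * exp (t * x) = exp (t\<^sup>2 / 2) * normal_density t 1 x" for x
    by (simp add: normal_density_def exp_add[symmetric] power2_eq_square field_simps)
  then have "(\<integral>\<^sup>+ x. ennreal (std_normal_density x * exp (t * x)) \<partial>lborel) =
      (\<integral>\<^sup>+ x. ennreal (exp (t\<^sup>2 / 2)) * ennreal (normal_density t 1 x) \<partial>lborel)"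
    by (simp add: ennreal_mult)
  also have "\<dots> = ennreal (exp (t\<^sup>2 / 2)) * (\<integral>\<^sup>+ x. ennreal (normal_density t 1 x) \<partial>lborel)"
    by (rule nn_integral_cmult) auto
  also have "(\<integral>\<^sup>+ x. ennreal (normal_density t 1 x) \<partial>lborel) = 1"
    by (subst nn_integral_eq_integral) auto
  finally show ?thesis by simp
qed

text \<open>
  The integral over the coefficients that remains at the end of the proof of
  \<open>gauss_coords_linear_image\<close>.
\<close>

lemma gauss_coords_mgf:
  assumes "finite B"
  shows "(\<integral>\<^sup>+ c. ennreal (gauss_coords B c * exp (\<Sum>b\<in>B. t b * c b)) \<partial>leb_coords B) =
    ennreal (exp ((\<Sum>b\<in>B. (t b)\<^sup>2) / 2))"
proof -
  have "ennreal (gauss_coords B c * exp (\<Sum>b\<in>B. t b * c b)) =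
      (\<Prod>b\<in>B. ennreal (std_normal_density (c b) * exp (t b * c b)))" for c
    using assms by (simp add: gauss_coords_def exp_sum prod_ennreal prod.distrib)
  then have "(\<integral>\<^sup>+ c. ennreal (gauss_coords B c * exp (\<Sum>b\<in>B. t b * c b)) \<partial>leb_coords B) =
      (\<Prod>b\<in>B. \<integral>\<^sup>+ x. ennreal (std_normal_density x * exp (t b * x)) \<partial>lborel)"
    using nn_integral_leb_prod[OF assms, of "\<lambda>b x. ennreal (std_normal_density x * exp (t b * x))"] by simp
  also have "\<dots> = ennreal (exp ((\<Sum>b\<in>B. (t b)\<^sup>2) / 2))"
    using assms by (simp add: nn_integral_std_normal_exp prod_ennreal exp_sum sum_divide_distrib)
  finally show ?thesis .
qed

lemma gauss_coords_total:
  assumes "finite B" shows "(\<integral>\<^sup>+ c. ennreal (gauss_coords B c) \<partial>leb_coords B) = 1"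
  using gauss_coords_mgf[OF assms, of "\<lambda>_. 0"] by simp

text \<open>
  The dominating functions for the limits below: a determinant of a matrix that is linear in \<open>c\<close>
  is bounded by the first exponential (\<open>abs_det_comb_le\<close>), and a Gaussian weight by the second
  (\<open>shifted_density_le\<close>).
\<close>

lemma integrable_exp_abs_quarter:
  assumes "finite B"
  shows "integrable (leb_coords B) (\<lambda>c. exp (M * (\<Sum>b\<in>B. \<bar>c b\<bar>) - (\<Sum>b\<in>B. (c b)\<^sup>2) / 4))"
proof (rule integrableI_nonneg)
  let ?h = "\<lambda>x. exp (M * \<bar>x\<bar> - x\<^sup>2 / 4)"
  \<comment> \<open>Completing the square, with half of the quadratic decay left over for a normal density.\<close>
  have bd: "?h x \<le> exp (2 * M\<^sup>2) * sqrt (8 * pi) * normal_density 0 2 x" for x :: real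
  proof -
    have "0 \<le> (4 * M - \<bar>x\<bar>)\<^sup>2" by simp
    then have "M * \<bar>x\<bar> - x\<^sup>2 / 4 \<le> 2 * M\<^sup>2 - x\<^sup>2 / 8"
      by (simp add: power2_eq_square algebra_simps)
    then have "?h x \<le> exp (2 * M\<^sup>2) * exp (- (x\<^sup>2 / 8))"
      by (simp add: exp_add[symmetric] mult_exp_exp)
    also have "exp (- (x\<^sup>2 / 8)) = sqrt (8 * pi) * normal_density 0 2 x"
      by (simp add: normal_density_def)
    finally show ?thesis by (simp add: mult_ac)
  qed
  have fin: "(\<integral>\<^sup>+ x. ennreal (?h x) \<partial>lborel) < \<infinity>"
  proof -
    have "(\<integral>\<^sup>+ x. ennreal (?h x) \<partial>lborel) \<le> (\<integral>\<^sup>+ x. ennreal (exp (2 * M\<^sup>2) * sqrt (8 * pi) * normal_density 0 2 x) \<partial>lborel)"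
      by (intro nn_integral_mono ennreal_leI bd)
    also have "\<dots> < \<infinity>"
      by (subst nn_integral_eq_integral) (auto intro!: AE_I2)
    finally show ?thesis .
  qed
  have "ennreal (exp (M * (\<Sum>b\<in>B. \<bar>c b\<bar>) - (\<Sum>b\<in>B. (c b)\<^sup>2) / 4)) = (\<Prod>b\<in>B. ennreal (?h (c b)))" for c
    using assms by (simp add: prod_ennreal exp_sum[symmetric] sum_distrib_left sum_subtractf sum_divide_distrib)
  then have "(\<integral>\<^sup>+ c. ennreal (exp (M * (\<Sum>b\<in>B. \<bar>c b\<bar>) - (\<Sum>b\<in>B. (c b)\<^sup>2) / 4)) \<partial>leb_coords B) =
      (\<Prod>b\<in>B. \<integral>\<^sup>+ x. ennreal (?h x) \<partial>lborel)"
    using nn_integral_leb_prod[OF assms, of "\<lambda>b x. ennreal (?h x)"] by simp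
  also have "\<dots> < \<infinity>"
    using fin by (auto simp: less_top[symmetric] power_eq_top_ennreal)
  finally show "(\<integral>\<^sup>+ c. ennreal (exp (M * (\<Sum>b\<in>B. \<bar>c b\<bar>) - (\<Sum>b\<in>B. (c b)\<^sup>2) / 4)) \<partial>leb_coords B) < \<infinity>" .
qed auto

section \<open>The area formula\<close>

text \<open>
  The change of variables for an injective map, as an identity in \<open>[0, \<infinity>]\<close>, so that the
  image need not have finite measure.
\<close>

lemma emeasure_differentiable_image:
  fixes f :: "real^'n::{finite,wellorder} \<Rightarrow> real^'n::_"
  assumes P: "P \<in> sets borel"
    and der: "\<And>x. x \<in> P \<Longrightarrow> (f has_derivative f' x) (at x)"
    and inj: "inj_on f P"
    and cont: "continuous_on P (\<lambda>x. det (matrix (f' x)))"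
  shows "f ` P \<in> sets lebesgue"
    and "emeasure lebesgue (f ` P) = (\<integral>\<^sup>+ x. ennreal (indicator P x * \<bar>det (matrix (f' x))\<bar>) \<partial>lborel)"
proof -
  let ?D = "\<lambda>x. indicator P x * \<bar>det (matrix (f' x))\<bar>"
  have der': "(f has_derivative f' x) (at x within P)" if "x \<in> P" for x
    using der[OF that] by (rule has_derivative_at_withinI)
  have Pl: "P \<in> sets lebesgue" using P by simp
  have [measurable]: "?D \<in> borel_measurable borel"
    using borel_measurable_continuous_on_indicator[OF P continuous_on_rabs[OF cont]] by simp
  have D_eq: "?D = (\<lambda>x. if x \<in> P then \<bar>det (matrix (f' x))\<bar> else 0)"
    by (auto simp: indicator_def)
  show im: "f ` P \<in> sets lebesgue"
    by (rule differentiable_image_in_sets_lebesgue[OF Pl])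
       (use der' in \<open>auto simp: differentiable_on_def differentiable_def\<close>)
  note iff = has_measure_differentiable_image[OF Pl der' inj]
  show "emeasure lebesgue (f ` P) = (\<integral>\<^sup>+ x. ennreal (?D x) \<partial>lborel)"
  proof (cases "f ` P \<in> lmeasurable")
    case True
    then have "((\<lambda>x. \<bar>det (matrix (f' x))\<bar>) has_integral measure lebesgue (f ` P)) P"
      using iff by blast
    then have "(?D has_integral measure lebesgue (f ` P)) UNIV"
      unfolding D_eq by (simp add: has_integral_restrict_UNIV)
    then have "(\<integral>\<^sup>+ x. ennreal (?D x) \<partial>lborel) = ennreal (measure lebesgue (f ` P))"
      by (intro nn_integral_has_integral_lborel) auto
    then show ?thesis by (simp only: emeasure_eq_measure2[OF True])
  next
    case False
    then have inf: "emeasure lebesgue (f ` P) = \<infinity>"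
      using im fmeasurableI[of "f ` P" lebesgue] by (metis infinity_ennreal_def less_top)
    have "(\<integral>\<^sup>+ x. ennreal (?D x) \<partial>lborel) = \<infinity>"
    proof (rule ccontr)
      assume "(\<integral>\<^sup>+ x. ennreal (?D x) \<partial>lborel) \<noteq> \<infinity>"
      then have "?D integrable_on UNIV"
        by (intro nn_integral_integrable_on) (auto simp: less_top)
      then have "(\<lambda>x. \<bar>det (matrix (f' x))\<bar>) integrable_on P"
        unfolding D_eq by (simp add: integrable_restrict_UNIV)
      then show False using iff False by (auto simp: integrable_on_def)
    qed
    with inf show ?thesis by simp
  qed
qed

lemma onorm_le_sum_axis:
  fixes h :: "real^'n \<Rightarrow> 'a::real_normed_vector"
  assumes "linear h"
  shows "onorm h \<le> (\<Sum>j\<in>UNIV. norm (h (axis j 1)))"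
proof (rule onorm_le)
  fix v :: "real^'n"
  have "h v = h (\<Sum>j\<in>UNIV. v $ j *\<^sub>R axis j 1)"
    using basis_expansion[of v] by (simp add: scalar_mult_eq_scaleR)
  also have "\<dots> = (\<Sum>j\<in>UNIV. v $ j *\<^sub>R h (axis j 1))"
    using assms by (simp add: linear_sum linear_scale)
  also have "norm \<dots> \<le> (\<Sum>j\<in>UNIV. norm v * norm (h (axis j 1)))"
    by (rule sum_norm_le) (auto intro!: mult_right_mono component_le_norm_cart)
  finally show "norm (h v) \<le> (\<Sum>j\<in>UNIV. norm (h (axis j 1))) * norm v"
    by (simp add: sum_distrib_left mult.commute)
qed

lemma continuous_on_det_matrix:
  fixes f' :: "'a::topological_space \<Rightarrow> real^'n \<Rightarrow> real^'n"
  assumes "\<And>j. continuous_on U (\<lambda>x. f' x (axis j 1))"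
  shows "continuous_on U (\<lambda>x. det (matrix (f' x)))"
  unfolding det_def matrix_def
  by (intro continuous_intros) (simp add: assms)

text \<open>
  Every regular point has a neighbourhood on which \<open>f\<close> is injective, and countably many of these
  neighbourhoods suffice by Lindeloef's theorem.
\<close>

lemma locally_injective_cover:
  fixes f :: "real^'n \<Rightarrow> real^'n"
  assumes U: "open U" and der: "\<And>x. x \<in> U \<Longrightarrow> (f has_derivative f' x) (at x)"
    and cont: "\<And>j. continuous_on U (\<lambda>x. f' x (axis j 1))"
  obtains W :: "nat \<Rightarrow> (real^'n) set"
    where "\<And>n. open (W n)" "\<And>n. inj_on f (W n)" "(\<Union>n. W n) = {x \<in> U. det (matrix (f' x)) \<noteq> 0}"
proof -
  define R where "R = {x \<in> U. det (matrix (f' x)) \<noteq> 0}"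
  have cdet: "continuous_on U (\<lambda>x. det (matrix (f' x)))"
    by (rule continuous_on_det_matrix) (rule cont)
  have "R = U \<inter> (\<lambda>x. det (matrix (f' x))) -` (- {0})" by (auto simp: R_def)
  then have oR: "open R"
    using continuous_open_preimage[OF cdet U, of "- {0}"] by auto
  have lin: "linear (f' x)" if "x \<in> U" for x
    using der[OF that] by (rule has_derivative_linear)
  have "\<exists>r>0. ball a r \<subseteq> R \<and> inj_on f (ball a r)" if a: "a \<in> R" for a
  proof -
    have aU: "a \<in> U" using a by (simp add: R_def)
    have "det (matrix (f' a)) \<noteq> 0" using a by (simp add: R_def)
    then have "inj (f' a)" using det_nz_iff_inj[OF lin[OF aU]] by blast
    then obtain g' where g': "linear g'" "g' \<circ> f' a = id"
      using linear_injective_left_inverse[OF lin[OF aU]] by blast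
    show ?thesis
    proof (rule has_derivative_locally_injective[OF a oR, of g' f' f])
      show "bounded_linear g'" using g' by (simp add: linear_conv_bounded_linear)
      show "g' \<circ> f' a = id" by (rule g')
      show "(f has_derivative f' x) (at x)" if "x \<in> R" for x
        using der that by (simp add: R_def)
      fix e :: real assume "e > 0"
      have "((\<lambda>x. \<Sum>j\<in>UNIV. norm (f' x (axis j 1) - f' a (axis j 1))) \<longlongrightarrow>
          (\<Sum>j\<in>(UNIV :: 'n set). norm (f' a (axis j 1) - f' a (axis j 1)))) (at a)"
        using cont U aU by (intro tendsto_intros) (auto simp: continuous_on_eq_continuous_at isCont_def)
      then have "\<forall>\<^sub>F x in at a. (\<Sum>j\<in>UNIV. norm (f' x (axis j 1) - f' a (axis j 1))) < e"
        using \<open>e > 0\<close> by (intro order_tendstoD) auto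
      moreover have "\<forall>\<^sub>F x in at a. x \<in> U"
        using U aU by (rule eventually_at_in_open')
      ultimately have "\<forall>\<^sub>F x in at a. onorm (\<lambda>v. f' x v - f' a v) < e"
      proof eventually_elim
        case (elim x)
        have "linear (\<lambda>v. f' x v - f' a v)"
          using lin elim aU by (intro linear_compose_sub) auto
        from onorm_le_sum_axis[OF this] elim show ?case by linarith
      qed
      then obtain d where "d > 0" "\<And>x. x \<noteq> a \<Longrightarrow> dist x a < d \<Longrightarrow> onorm (\<lambda>v. f' x v - f' a v) < e"
        by (auto simp: eventually_at)
      moreover have "onorm (\<lambda>v. f' a v - f' a v) < e"
        using \<open>e > 0\<close> by (simp add: onorm_zero)
      ultimately show "\<exists>d>0. \<forall>x. dist a x < d \<longrightarrow> onorm (\<lambda>v. f' x v - f' a v) < e"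
        by (metis dist_commute)
    qed blast
  qed
  then obtain r where r: "\<And>a. a \<in> R \<Longrightarrow> r a > 0 \<and> ball a (r a) \<subseteq> R \<and> inj_on f (ball a (r a))"
    by metis
  obtain F where F: "F \<subseteq> (\<lambda>a. ball a (r a)) ` R" "countable F" "\<Union>F = (\<Union>a\<in>R. ball a (r a))"
    using Lindelof[of "(\<lambda>a. ball a (r a)) ` R"] by auto
  have UF: "\<Union>F = R" unfolding F(3) using r by force
  define W where "W = from_nat_into (insert {} F)"
  have rW: "range W = insert {} F"
    unfolding W_def using F(2) by (intro range_from_nat_into) auto
  have W: "W n \<in> insert {} F" for n using rW by blast
  show thesis
  proof
    show "open (W n)" for n using W[of n] F(1) by auto
    show "inj_on f (W n)" for n using W[of n] F(1) r by auto
    show "(\<Union>n. W n) = {x \<in> U. det (matrix (f' x)) \<noteq> 0}"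
      unfolding rW using UF by (simp add: R_def)
  qed
qed

text \<open>
  An infinite set has \<open>\<infinity>\<close> elements, as in the count of critical points.
\<close>

abbreviation num_elems :: "'a set \<Rightarrow> ennreal"
  where "num_elems A \<equiv> emeasure (count_space UNIV) A"

text \<open>
  Where the derivative is invertible, the cover by sets of injectivity, made disjoint, reduces the claim to
  \<open>emeasure_differentiable_image\<close>. The remaining points of \<open>S\<close> are mapped to a null
  set by Sard's theorem, and the right-hand side does not see them.
\<close>

lemma area_formula_wellorder:
  fixes f :: "real^'n::{finite,wellorder} \<Rightarrow> real^'n::_"
  assumes U: "open U" and der: "\<And>x. x \<in> U \<Longrightarrow> (f has_derivative f' x) (at x)"
    and cont: "\<And>j. continuous_on U (\<lambda>x. f' x (axis j 1))"
    and S: "S \<in> sets borel" "S \<subseteq> U"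
    and N: "(\<lambda>z. num_elems {x \<in> S. f x = z}) \<in> borel_measurable borel"
    and k: "k \<in> borel_measurable borel"
  shows "(\<integral>\<^sup>+ z. num_elems {x \<in> S. f x = z} * k z \<partial>lborel) =
    (\<integral>\<^sup>+ x. ennreal (indicator S x * \<bar>det (matrix (f' x))\<bar>) * k (f x) \<partial>lborel)"
proof -
  obtain W :: "nat \<Rightarrow> (real^'n::_) set" where W: "\<And>n. open (W n)" "\<And>n. inj_on f (W n)"
      "(\<Union>n. W n) = {x \<in> U. det (matrix (f' x)) \<noteq> 0}"
    using locally_injective_cover[OF U der cont] by blast
  have cdet: "continuous_on U (\<lambda>x. det (matrix (f' x)))"
    by (rule continuous_on_det_matrix) (rule cont)
  have cf: "continuous_on U f"
    using der by (intro has_derivative_continuous_on) (auto intro: has_derivative_at_withinI)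
  note [measurable] = k N S(1)
  define D where "D = (\<lambda>x. ennreal (indicator S x * \<bar>det (matrix (f' x))\<bar>))"
  have "(\<lambda>x. indicator S x * \<bar>det (matrix (f' x))\<bar>) \<in> borel_measurable borel"
    using borel_measurable_continuous_on_indicator[OF S(1) continuous_on_rabs[OF continuous_on_subset[OF cdet S(2)]]]
    by simp
  then have [measurable]: "D \<in> borel_measurable borel" unfolding D_def by measurable
  define h where "h = (\<lambda>x. indicator S x *\<^sub>R f x)"
  have [measurable]: "h \<in> borel_measurable borel"
    unfolding h_def by (rule borel_measurable_continuous_on_indicator[OF S(1) continuous_on_subset[OF cf S(2)]])
  define P where "P = (\<lambda>n. S \<inter> disjointed W n)"
  have [measurable]: "disjointed W n \<in> sets borel" for n
    using sets.range_disjointed_sets[of W borel] W(1) by (force simp: borel_open)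
  have [measurable]: "P n \<in> sets borel" for n unfolding P_def by measurable
  have disjP: "disjoint_family P"
    using disjoint_family_disjointed[of W] unfolding P_def disjoint_family_on_def by blast
  have "(\<Union>n. P n) = S \<inter> (\<Union>n. disjointed W n)" by (auto simp: P_def)
  then have UP: "(\<Union>n. P n) = {x \<in> S. det (matrix (f' x)) \<noteq> 0}"
    using S(2) unfolding UN_disjointed_eq W(3) by auto
  have injP: "inj_on f (P n)" for n
    by (rule inj_on_subset[OF W(2)[of n]]) (use disjointed_subset[of W n] in \<open>auto simp: P_def\<close>)
  define Z where "Z = {x \<in> S. det (matrix (f' x)) = 0}"
  have "negligible (f ` Z)"
  proof (rule baby_Sard)
    show "(f has_derivative f' x) (at x within Z)" if "x \<in> Z" for x
      using der[of x] that S(2) by (auto simp: Z_def intro: has_derivative_at_withinI)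
    show "rank (matrix (f' x)) < CARD('n)" if "x \<in> Z" for x
      using that by (simp add: Z_def det_eq_0_rank)
  qed auto
  then have AEZ: "AE z in lebesgue. z \<notin> f ` Z"
    unfolding negligible_iff_null_sets by (rule AE_not_in)
  \<comment> \<open>It suffices to compare measures of Borel sets, that is, to take an indicator function for \<open>k\<close>.\<close>
  have "density lborel (\<lambda>z. num_elems {x \<in> S. f x = z}) = distr (density lborel D) borel h"
    (is "?A = ?B")
  proof (rule measure_eqI)
    show "sets ?A = sets ?B" by simp
    fix A assume "A \<in> sets ?A"
    then have A [measurable]: "A \<in> sets borel" by simp
    define Q where "Q = (\<lambda>n. P n \<inter> h -` A)"
    have [measurable]: "Q n \<in> sets borel" for n
    proof -
      have "h -` A \<in> sets borel" using measurable_sets[OF \<open>h \<in> borel_measurable borel\<close> A] by simp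
      then show ?thesis unfolding Q_def by measurable
    qed
    have QS: "Q n \<subseteq> S" "Q n \<subseteq> U" for n using S(2) by (auto simp: Q_def P_def)
    have injQ: "inj_on f (Q n)" for n using injP[of n] by (auto simp: Q_def inj_on_def)
    have Qm: "Q n \<in> sets borel" for n by measurable
    have derQ: "(f has_derivative f' x) (at x)" if "x \<in> Q n" for x n
      using der QS(2)[of n] that by blast
    note im = emeasure_differentiable_image[OF Qm derQ injQ continuous_on_subset[OF cdet QS(2)]]
    have [measurable]: "f ` Q n \<in> sets lebesgue" for n by (rule im(1))
    have imD: "emeasure lebesgue (f ` Q n) = (\<integral>\<^sup>+ x. D x * indicator (Q n) x \<partial>lborel)" for n
    proof -
      have "emeasure lebesgue (f ` Q n) = (\<integral>\<^sup>+ x. ennreal (indicator (Q n) x * \<bar>det (matrix (f' x))\<bar>) \<partial>lborel)"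
        by (rule im(2))
      also have "\<dots> = (\<integral>\<^sup>+ x. D x * indicator (Q n) x \<partial>lborel)"
        by (rule nn_integral_cong) (use QS(1)[of n] in \<open>auto simp: D_def indicator_def\<close>)
      finally show ?thesis .
    qed
    \<comment> \<open>Off the critical values, each disjoint piece contains at most one preimage of \<open>z\<close>.\<close>
    have count: "num_elems {x \<in> S. f x = z} * indicator A z = (\<Sum>n. indicator (f ` Q n) z)"
      if z: "z \<notin> f ` Z" for z
    proof (cases "z \<in> A")
      case False
      then have "z \<notin> f ` Q n" for n using QS(1)[of n] by (auto simp: Q_def h_def)
      with False show ?thesis by simp
    next
      case True
      have eq: "{x \<in> S. f x = z} = (\<Union>n. {x \<in> P n. f x = z})"
      proof -
        have "x \<in> (\<Union>n. P n)" if "x \<in> S" "f x = z" for x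
          unfolding UP using z that by (auto simp: Z_def)
        then show ?thesis by (auto simp: P_def)
      qed
      have one: "num_elems {x \<in> P n. f x = z} = indicator (f ` Q n) z" for n
      proof (cases "z \<in> f ` Q n")
        case True
        then obtain x where "x \<in> P n" "f x = z" by (auto simp: Q_def)
        then have "{x \<in> P n. f x = z} = {x}" using injP[of n] by (auto simp: inj_on_def)
        with True show ?thesis by simp
      next
        case False
        have "x \<in> Q n" if "x \<in> P n" "f x = z" for x
          using that True by (auto simp: Q_def P_def h_def)
        then have "{x \<in> P n. f x = z} = {}" using False by auto
        show ?thesis unfolding \<open>{x \<in> P n. f x = z} = {}\<close> using False by simp
      qed
      have "num_elems {x \<in> S. f x = z} = (\<Sum>n. num_elems {x \<in> P n. f x = z})"
        unfolding eq by (rule suminf_emeasure[symmetric]) (use disjP in \<open>auto simp: disjoint_family_on_def\<close>)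
      also have "\<dots> = (\<Sum>n. indicator (f ` Q n) z)"
        by (simp only: one)
      finally show ?thesis using True by simp
    qed
    have "emeasure ?A A = (\<integral>\<^sup>+ z. num_elems {x \<in> S. f x = z} * indicator A z \<partial>lborel)"
      by (simp add: emeasure_density)
    also have "\<dots> = (\<integral>\<^sup>+ z. num_elems {x \<in> S. f x = z} * indicator A z \<partial>lebesgue)"
      by (simp add: nn_integral_completion)
    also have "\<dots> = (\<integral>\<^sup>+ z. (\<Sum>n. indicator (f ` Q n) z) \<partial>lebesgue)"
      by (rule nn_integral_cong_AE) (use AEZ in eventually_elim, use count in auto)
    also have "\<dots> = (\<Sum>n. emeasure lebesgue (f ` Q n))"
      by (subst nn_integral_suminf) auto
    also have "\<dots> = (\<Sum>n. \<integral>\<^sup>+ x. D x * indicator (Q n) x \<partial>lborel)"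
      by (simp only: imD)
    also have "\<dots> = (\<integral>\<^sup>+ x. (\<Sum>n. D x * indicator (Q n) x) \<partial>lborel)"
      by (rule nn_integral_suminf[symmetric]) measurable
    also have "\<dots> = (\<integral>\<^sup>+ x. D x * indicator (h -` A) x \<partial>lborel)"
    proof (rule nn_integral_cong)
      fix x :: "real^'n::_"
      have sQ: "(\<Sum>n. indicator (Q n) x) = (indicator (\<Union>n. Q n) x :: ennreal)"
        using disjP by (intro suminf_indicator) (auto simp: Q_def disjoint_family_on_def)
      have Dz: "D x = 0" if "x \<in> h -` A" "x \<notin> (\<Union>n. Q n)"
      proof -
        have "x \<notin> (\<Union>n. P n)" using that by (auto simp: Q_def)
        then show ?thesis unfolding UP by (auto simp: D_def)
      qed
      have "(\<Sum>n. D x * indicator (Q n) x) = D x * indicator (\<Union>n. Q n) x"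
        by (simp add: ennreal_suminf_cmult sQ)
      also have "\<dots> = D x * indicator (h -` A) x"
        using Dz by (auto simp: indicator_def Q_def)
      finally show "(\<Sum>n. D x * indicator (Q n) x) = D x * indicator (h -` A) x" .
    qed
    also have "\<dots> = emeasure ?B A"
      using measurable_sets[OF \<open>h \<in> borel_measurable borel\<close> A]
      by (simp add: emeasure_distr emeasure_density)
    finally show "emeasure ?A A = emeasure ?B A" .
  qed
  then have "(\<integral>\<^sup>+ z. k z \<partial>?A) = (\<integral>\<^sup>+ z. k z \<partial>?B)" by simp
  also have "(\<integral>\<^sup>+ z. k z \<partial>?A) = (\<integral>\<^sup>+ z. num_elems {x \<in> S. f x = z} * k z \<partial>lborel)"
    by (simp add: nn_integral_density)
  also have "(\<integral>\<^sup>+ z. k z \<partial>?B) = (\<integral>\<^sup>+ x. D x * k (h x) \<partial>lborel)"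
    by (simp add: nn_integral_distr nn_integral_density)
  also have "\<dots> = (\<integral>\<^sup>+ x. D x * k (f x) \<partial>lborel)"
    by (intro nn_integral_cong) (auto simp: D_def h_def indicator_def)
  finally show ?thesis by (simp add: D_def)
qed

text \<open>
  A copy of an arbitrary finite index type that carries some well-order, so that coordinates can be treated
  one after the other, as in the change of variables formula. Renaming the coordinates preserves both Lebesgue
  measure (\<open>lborel_to_windex\<close>) and determinants (\<open>det_windex\<close>).
\<close>

typedef 'a windex = "UNIV :: 'a set" ..

instance windex :: (finite) finite
proof
  have "inj (Rep_windex :: 'a windex \<Rightarrow> 'a)" by (simp add: inj_on_def Rep_windex_inject)
  moreover have "finite (range (Rep_windex :: 'a windex \<Rightarrow> 'a))" by simp
  ultimately show "finite (UNIV :: 'a windex set)" by (rule finite_imageD[rotated])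
qed

definition windex_rank :: "'a::finite windex \<Rightarrow> nat"
  where "windex_rank = (SOME f. inj f)"

lemma inj_windex_rank: "inj windex_rank"
proof -
  have "\<exists>f :: 'a::finite windex \<Rightarrow> nat. inj f"
    using finite_imp_inj_to_nat_seg[of "UNIV :: 'a windex set"] by auto
  then show ?thesis unfolding windex_rank_def by (rule someI_ex)
qed

instantiation windex :: (finite) wellorder
begin

definition less_eq_windex :: "'a windex \<Rightarrow> 'a windex \<Rightarrow> bool"
  where "less_eq_windex a b \<longleftrightarrow> windex_rank a \<le> windex_rank b"

definition less_windex :: "'a windex \<Rightarrow> 'a windex \<Rightarrow> bool"
  where "less_windex a b \<longleftrightarrow> windex_rank a < windex_rank b"

instance
proof
  fix P :: "'a windex \<Rightarrow> bool" and a :: "'a windex"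
  assume step: "\<And>x. (\<And>y. y < x \<Longrightarrow> P y) \<Longrightarrow> P x"
  show "P a"
    by (induction a rule: measure_induct_rule[of windex_rank]) (rule step, simp add: less_windex_def)
qed (use inj_windex_rank in \<open>auto simp: less_eq_windex_def less_windex_def inj_on_def\<close>)

end

definition to_windex :: "real^'n \<Rightarrow> real^('n windex)"
  where "to_windex x = (\<chi> i. x $ Rep_windex i)"

definition of_windex :: "real^('n windex) \<Rightarrow> real^'n"
  where "of_windex x = (\<chi> i. x $ Abs_windex i)"

lemma windex_inverse [simp]:
  "of_windex (to_windex x) = x" "to_windex (of_windex y) = y"
  by (simp_all add: to_windex_def of_windex_def vec_eq_iff Abs_windex_inverse Rep_windex_inverse)

lemma linear_windex: "linear to_windex" "linear of_windex"
  by (auto intro!: linearI simp: to_windex_def of_windex_def vec_eq_iff)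

lemma to_windex_axis: "to_windex (axis i c) = axis (Abs_windex i) c"
  by (auto simp: to_windex_def axis_def vec_eq_iff Abs_windex_inverse Rep_windex_inverse Rep_windex_inject[symmetric])

lemma of_windex_axis: "of_windex (axis i c) = axis (Rep_windex i) c"
  by (metis Rep_windex_inverse to_windex_axis windex_inverse(1))

lemma continuous_windex: "continuous_on A to_windex" "continuous_on B of_windex"
  using linear_windex by (auto intro: linear_continuous_on simp: linear_conv_bounded_linear)

lemma bij_Rep_windex: "bij Rep_windex"
  by (metis Abs_windex_inverse Rep_windex_inverse UNIV_I bij_iff)

lemma all_windex: "(\<forall>i :: 'a windex. P i) \<longleftrightarrow> (\<forall>j. P (Abs_windex j))"
  by (metis Rep_windex_inverse)

lemma prod_Basis_real_vec: "(\<Prod>b\<in>(Basis :: (real^'n) set). g b) = (\<Prod>i\<in>UNIV. g (axis i 1))"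
proof -
  have B: "(Basis :: (real^'n) set) = range (\<lambda>i. axis i 1)"
    by (auto simp: Basis_vec_def)
  have inj: "inj (\<lambda>i. axis i 1 :: real^'n)"
    by (auto simp: inj_on_def axis_eq_axis)
  show ?thesis unfolding B prod.reindex[OF inj] o_def ..
qed

lemma lborel_to_windex: "distr lborel borel to_windex = (lborel :: (real^('n::finite windex)) measure)"
proof (rule lborel_eqI[symmetric])
  have [measurable]: "to_windex \<in> borel_measurable (borel :: (real^'n) measure)"
    by (rule borel_measurable_continuous_onI[OF continuous_windex(1)])
  fix l u :: "real^('n windex)"
  assume lu: "\<And>b. b \<in> Basis \<Longrightarrow> l \<bullet> b \<le> u \<bullet> b"
  then have lu': "l $ i \<le> u $ i" for i
    by (metis axis_in_Basis_iff Basis_real_def insertI1 cart_eq_inner_axis)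
  have "to_windex -` box l u = box (of_windex l) (of_windex u)"
    unfolding set_eq_iff vimage_eq mem_box_cart to_windex_def of_windex_def all_windex
    by (simp add: Abs_windex_inverse)
  then have "emeasure (distr lborel borel to_windex) (box l u) =
      emeasure lborel (box (of_windex l) (of_windex u))"
    by (simp add: emeasure_distr)
  also have "\<dots> = (\<Prod>b\<in>Basis. (of_windex u - of_windex l) \<bullet> b)"
    by (subst emeasure_lborel_box_eq)
       (use lu' in \<open>auto simp: Basis_vec_def of_windex_def cart_eq_inner_axis[symmetric] inner_axis\<close>)
  also have "(\<Prod>b\<in>Basis. (of_windex u - of_windex l) \<bullet> b) = (\<Prod>i\<in>UNIV. u $ Abs_windex i - l $ Abs_windex i)"
    by (simp add: prod_Basis_real_vec inner_axis of_windex_def)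
  also have "\<dots> = (\<Prod>i\<in>UNIV. u $ i - l $ i)"
    by (rule prod.reindex_bij_witness[of _ Rep_windex Abs_windex])
       (auto simp: Abs_windex_inverse Rep_windex_inverse)
  also have "\<dots> = (\<Prod>b\<in>Basis. (u - l) \<bullet> b)"
    by (simp add: prod_Basis_real_vec inner_axis)
  finally show "emeasure (distr lborel borel to_windex) (box l u) = ennreal (\<Prod>b\<in>Basis. (u - l) \<bullet> b)" .
qed simp

lemma det_windex:
  fixes A :: "real^'n^'n"
  shows "det (\<chi> i j. A $ Rep_windex i $ Rep_windex j) = det A"
proof -
  \<comment> \<open>Conjugation by the renaming is a bijection of the permutations that preserves the sign.\<close>
  have conj: "Rep_windex \<circ> p \<circ> Abs_windex = map_permutation UNIV Rep_windex p" for p :: "'n windex \<Rightarrow> 'n windex"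
  proof
    fix x :: 'n
    have "inv_into UNIV Rep_windex x = Abs_windex x"
      by (rule inv_f_eq[OF bij_is_inj[OF bij_Rep_windex]]) (simp add: Abs_windex_inverse)
    moreover have "x \<in> range Rep_windex" by (metis Abs_windex_inverse UNIV_I rangeI)
    ultimately show "(Rep_windex \<circ> p \<circ> Abs_windex) x = map_permutation UNIV Rep_windex p x"
      by (simp add: map_permutation_def)
  qed
  have bij: "bij (Abs_windex :: 'n \<Rightarrow> _)" 
    by (metis Abs_windex_inverse Rep_windex_inverse UNIV_I bij_iff)
  have "(\<Sum>p | p permutes (UNIV :: 'n windex set).
        of_int (sign p) * (\<Prod>i\<in>UNIV. A $ Rep_windex i $ Rep_windex (p i))) =
      (\<Sum>q | q permutes (UNIV :: 'n set). of_int (sign q) * (\<Prod>i\<in>UNIV. A $ i $ q i))"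
  proof (rule sum.reindex_bij_witness[of _ "\<lambda>q. Abs_windex \<circ> q \<circ> Rep_windex" "\<lambda>p. Rep_windex \<circ> p \<circ> Abs_windex"])
    fix p assume "p \<in> {p. p permutes (UNIV :: 'n windex set)}"
    then have p: "p permutes UNIV" by simp
    show "Abs_windex \<circ> (Rep_windex \<circ> p \<circ> Abs_windex) \<circ> Rep_windex = p"
      by (auto simp: Rep_windex_inverse)
    have "bij (Rep_windex \<circ> p \<circ> Abs_windex)"
      using bij bij_Rep_windex permutes_bij[OF p] by (intro bij_comp)
    then show "Rep_windex \<circ> p \<circ> Abs_windex \<in> {q. q permutes UNIV}"
      by (auto intro!: bij_imp_permutes)
    have "sign (Rep_windex \<circ> p \<circ> Abs_windex) = sign p"
      unfolding conj by (rule sign_map_permutation) (use p bij_is_inj[OF bij_Rep_windex] in auto)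
    moreover have "(\<Prod>i\<in>UNIV. A $ i $ (Rep_windex \<circ> p \<circ> Abs_windex) i) =
        (\<Prod>i\<in>UNIV. A $ Rep_windex i $ Rep_windex (p i))"
      by (rule prod.reindex_bij_witness[of _ Rep_windex Abs_windex])
         (auto simp: Abs_windex_inverse Rep_windex_inverse)
    ultimately show "of_int (sign (Rep_windex \<circ> p \<circ> Abs_windex)) * (\<Prod>i\<in>UNIV. A $ i $ (Rep_windex \<circ> p \<circ> Abs_windex) i) =
        of_int (sign p) * (\<Prod>i\<in>UNIV. A $ Rep_windex i $ Rep_windex (p i))" by simp
  next
    fix q assume "q \<in> {q. q permutes (UNIV :: 'n set)}"
    then have q: "q permutes UNIV" by simp
    show "Rep_windex \<circ> (Abs_windex \<circ> q \<circ> Rep_windex) \<circ> Abs_windex = q"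
      by (auto simp: Abs_windex_inverse)
    have "bij (Abs_windex \<circ> q \<circ> Rep_windex)"
      using bij bij_Rep_windex permutes_bij[OF q] by (intro bij_comp)
    then show "Abs_windex \<circ> q \<circ> Rep_windex \<in> {p. p permutes UNIV}"
      by (auto intro!: bij_imp_permutes)
  qed
  then show ?thesis by (simp add: det_def)
qed

lemma area_formula:
  fixes f :: "real^'n \<Rightarrow> real^'n"
  assumes U: "open U" and der: "\<And>x. x \<in> U \<Longrightarrow> (f has_derivative f' x) (at x)"
    and cont: "\<And>j. continuous_on U (\<lambda>x. f' x (axis j 1))"
    and S: "S \<in> sets borel" "S \<subseteq> U"
    and N: "(\<lambda>z. num_elems {x \<in> S. f x = z}) \<in> borel_measurable borel"
    and k: "k \<in> borel_measurable borel"
    and D: "(\<lambda>x. ennreal (indicator S x * \<bar>det (matrix (f' x))\<bar>) * k (f x)) \<in> borel_measurable borel"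
  shows "(\<integral>\<^sup>+ z. num_elems {x \<in> S. f x = z} * k z \<partial>lborel) =
    (\<integral>\<^sup>+ x. ennreal (indicator S x * \<bar>det (matrix (f' x))\<bar>) * k (f x) \<partial>lborel)"
proof -
  let ?T = "to_windex :: real^'n \<Rightarrow> _" and ?O = "of_windex :: _ \<Rightarrow> real^'n"
  have mT [measurable]: "?T \<in> borel \<rightarrow>\<^sub>M borel"
    by (rule borel_measurable_continuous_onI[OF continuous_windex(1)])
  have mO [measurable]: "?O \<in> borel \<rightarrow>\<^sub>M borel"
    by (rule borel_measurable_continuous_onI[OF continuous_windex(2)])
  have transfer: "(\<integral>\<^sup>+ x. g x \<partial>lborel) = (\<integral>\<^sup>+ y. g (?O y) \<partial>lborel)" if "g \<in> borel_measurable borel" for g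
    by (subst lborel_to_windex[symmetric], subst nn_integral_distr)
       (use that in \<open>auto intro: measurable_compose[OF mO]\<close>)
  define g where "g = (\<lambda>x. ?T (f (?O x)))"
  define g' where "g' = (\<lambda>x v. ?T (f' (?O x) (?O v)))"
  have count: "num_elems {x \<in> ?O -` S. g x = z} = num_elems {x \<in> S. f x = ?O z}" for z
  proof -
    have "bij_betw ?O {x \<in> ?O -` S. g x = z} {x \<in> S. f x = ?O z}"
      by (rule bij_betw_byWitness[of _ ?T]) (auto simp: g_def)
    then have "finite {x \<in> ?O -` S. g x = z} \<longleftrightarrow> finite {x \<in> S. f x = ?O z}"
        "card {x \<in> ?O -` S. g x = z} = card {x \<in> S. f x = ?O z}"
      by (auto simp: bij_betw_finite bij_betw_same_card)
    then show ?thesis by (simp add: emeasure_count_space)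
  qed
  have detg: "det (matrix (g' x)) = det (matrix (f' (?O x)))" for x
  proof -
    have "matrix (g' x) = (\<chi> i j. matrix (f' (?O x)) $ Rep_windex i $ Rep_windex j)"
      by (simp add: matrix_def g'_def vec_eq_iff to_windex_def of_windex_axis)
    then show ?thesis by (simp add: det_windex)
  qed
  have "(\<integral>\<^sup>+ z. num_elems {x \<in> ?O -` S. g x = z} * k (?O z) \<partial>lborel) =
      (\<integral>\<^sup>+ x. ennreal (indicator (?O -` S) x * \<bar>det (matrix (g' x))\<bar>) * k (?O (g x)) \<partial>lborel)"
  proof (rule area_formula_wellorder)
    show "open (?O -` U)" using U continuous_windex(2) by (rule open_vimage)
    show "(g has_derivative g' x) (at x)" if "x \<in> ?O -` U" for x
    proof -
      have "((\<lambda>x. f (?O x)) has_derivative (\<lambda>v. f' (?O x) (?O v))) (at x)"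
        by (rule has_derivative_compose[OF linear_imp_has_derivative[OF linear_windex(2)] der]) (use that in simp)
      from has_derivative_compose[OF this linear_imp_has_derivative[OF linear_windex(1)]]
      show ?thesis unfolding g_def g'_def .
    qed
    show "continuous_on (?O -` U) (\<lambda>x. g' x (axis j 1))" for j
      unfolding g'_def of_windex_axis
      by (intro continuous_on_compose2[OF continuous_windex(1)[of UNIV]]
          continuous_on_compose2[OF cont continuous_windex(2)]) auto
    show "?O -` S \<in> sets borel"
      using measurable_sets[OF mO S(1)] by simp
    show "?O -` S \<subseteq> ?O -` U" using S(2) by auto
    show "(\<lambda>z. num_elems {x \<in> ?O -` S. g x = z}) \<in> borel_measurable borel"
      unfolding count by (rule measurable_compose[OF mO N])
    show "(\<lambda>z. k (?O z)) \<in> borel_measurable borel"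
      by (rule measurable_compose[OF mO k])
  qed
  then show ?thesis
    using transfer[of "\<lambda>z. num_elems {x \<in> S. f x = z} * k z"] transfer[OF D] N k
    unfolding count by (simp add: detg g_def indicator_def)
qed

section \<open>Averaging over translates and Gaussian vectors\<close>

lemma nn_integral_lborel_translate:
  fixes g :: "'a::euclidean_space \<Rightarrow> ennreal"
  assumes [measurable]: "g \<in> borel_measurable borel"
  shows "(\<integral>\<^sup>+ z. g z \<partial>lborel) = (\<integral>\<^sup>+ x. g (x - a) \<partial>lborel)"
proof -
  have "(\<integral>\<^sup>+ z. g z \<partial>lborel) = (\<integral>\<^sup>+ z. g z \<partial>distr lborel borel ((+) (- a)))"
    by (simp add: lborel_distr_plus)
  also have "\<dots> = (\<integral>\<^sup>+ x. g (x - a) \<partial>lborel)"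
    by (subst nn_integral_distr) auto
  finally show ?thesis .
qed

text \<open>
  Lebesgue measure is invariant under each of the translations \<open>d z\<close>, and \<open>w\<close> is a
  probability density. This replaces the conditioning on the value of a linear image of \<open>c\<close>: if
  that image moves by \<open>z\<close> under the translation, the inner integral runs over its values.
\<close>

lemma nn_integral_leb_average_translates:
  fixes d :: "'a::euclidean_space \<Rightarrow> 'b \<Rightarrow> real"
  assumes B: "finite B" and d [measurable]: "\<And>b. b \<in> B \<Longrightarrow> (\<lambda>z. d z b) \<in> borel_measurable borel"
    and w [measurable]: "w \<in> borel_measurable borel" and w1: "(\<integral>\<^sup>+ z. w z \<partial>lborel) = 1"
    and F [measurable]: "F \<in> borel_measurable (leb_coords B)"
  shows "(\<integral>\<^sup>+ c. F c \<partial>leb_coords B) =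
    (\<integral>\<^sup>+ c. (\<integral>\<^sup>+ z. w z * F (\<lambda>b\<in>B. c b + d z b) \<partial>lborel) \<partial>leb_coords B)"
proof -
  interpret leb: sigma_finite_measure "leb_coords B" by (rule sigma_finite_leb_coords[OF B])
  interpret pair_sigma_finite "leb_coords B" "lborel :: 'a measure" ..
  have m: "(\<lambda>(c, z). w z * F (\<lambda>b\<in>B. c b + d z b)) \<in> borel_measurable (leb_coords B \<Otimes>\<^sub>M lborel)"
  proof -
    have [measurable]: "(\<lambda>p. \<lambda>b\<in>B. fst p b + d (snd p) b) \<in> leb_coords B \<Otimes>\<^sub>M lborel \<rightarrow>\<^sub>M leb_coords B"
      by (intro measurable_into_leb_coords borel_measurable_add
          measurable_compose[OF measurable_fst measurable_coord] measurable_compose[OF measurable_snd])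
         (use d in auto)
    show ?thesis unfolding split_beta by measurable
  qed
  have [measurable]: "(\<lambda>c. \<lambda>b\<in>B. c b + d z b) \<in> leb_coords B \<rightarrow>\<^sub>M leb_coords B" for z
    by (rule measurable_into_leb_coords) measurable
  have "(\<integral>\<^sup>+ c. F c \<partial>leb_coords B) = (\<integral>\<^sup>+ z. w z * (\<integral>\<^sup>+ c. F c \<partial>leb_coords B) \<partial>lborel)"
    by (simp add: nn_integral_multc w1)
  also have "\<dots> = (\<integral>\<^sup>+ z. w z * (\<integral>\<^sup>+ c. F (\<lambda>b\<in>B. c b + d z b) \<partial>leb_coords B) \<partial>lborel)"
    using nn_integral_leb_affine[OF B, of 1 F "d _"] by simp
  also have "\<dots> = (\<integral>\<^sup>+ z. (\<integral>\<^sup>+ c. w z * F (\<lambda>b\<in>B. c b + d z b) \<partial>leb_coords B) \<partial>lborel)"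
    by (intro nn_integral_cong nn_integral_cmult[symmetric]) measurable
  also have "\<dots> = (\<integral>\<^sup>+ c. (\<integral>\<^sup>+ z. w z * F (\<lambda>b\<in>B. c b + d z b) \<partial>lborel) \<partial>leb_coords B)"
    using Fubini'[OF m] by simp
  finally show ?thesis .
qed

definition std_gauss_vec :: "real^'d \<Rightarrow> real"
  where "std_gauss_vec x = (1 / sqrt (2 * pi)) ^ CARD('d) * exp (- (x \<bullet> x) / 2)"

lemma std_gauss_vec_nonneg [simp]: "0 \<le> std_gauss_vec x"
  by (simp add: std_gauss_vec_def)

lemma std_gauss_vec_eq_prod: "std_gauss_vec x = (\<Prod>i\<in>UNIV. std_normal_density (x $ i))"
  by (simp add: std_gauss_vec_def std_normal_density_def prod.distrib prod_dividef exp_sum[symmetric]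
      sum_divide_distrib sum_negf power_one_over inner_vec_def power2_eq_square)

lemma measurable_std_gauss_vec [measurable]: "std_gauss_vec \<in> borel_measurable borel"
  unfolding std_gauss_vec_def by measurable

lemma std_gauss_vec_total: "(\<integral>\<^sup>+ x. ennreal (std_gauss_vec x) \<partial>lborel) = 1"
proof -
  have 1: "(\<integral>\<^sup>+ t. ennreal (std_normal_density t) \<partial>lborel) = 1"
    using nn_integral_std_normal_exp[of 0] by simp
  have "ennreal (std_gauss_vec x) = ennreal (\<Prod>b\<in>Basis. std_normal_density (x \<bullet> b))" for x :: "real^'a"
    by (simp add: prod_Basis_real_vec std_gauss_vec_eq_prod cart_eq_inner_axis)
  then have "(\<integral>\<^sup>+ x. ennreal (std_gauss_vec (x :: real^'a)) \<partial>lborel) =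
      (\<integral>\<^sup>+ x. (\<Prod>b\<in>(Basis :: (real^'a) set). ennreal (std_normal_density (x \<bullet> b))) \<partial>lborel)"
    by (simp add: prod_ennreal)
  also have "\<dots> = (\<Prod>b\<in>(Basis :: (real^'a) set). (\<integral>\<^sup>+ t. ennreal (std_normal_density t) \<partial>lborel))"
    by (rule nn_integral_lborel_prod) auto
  finally show ?thesis by (simp add: 1)
qed

text \<open>
  The hypothesis says that the vectors \<open>u b\<close> form a tight frame. Translating the coefficients by
  \<open>z \<bullet> u b\<close> hence translates the vector \<open>\<Sum>b\<in>B. c b *\<^sub>R u b\<close>
  by \<open>s *\<^sub>R z\<close>.
\<close>

lemma tight_frame_expansion:
  assumes "\<And>j k. (\<Sum>b\<in>B. u b $ j * u b $ k) = (if j = k then s else 0)"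
  shows "(\<Sum>b\<in>B. (z \<bullet> u b) *\<^sub>R u b) = s *\<^sub>R (z :: real^'d)"
proof -
  have "(\<Sum>b\<in>B. (z \<bullet> u b) *\<^sub>R u b) $ k = s * z $ k" for k
  proof -
    have "(\<Sum>b\<in>B. (z \<bullet> u b) *\<^sub>R u b) $ k = (\<Sum>b\<in>B. \<Sum>j\<in>UNIV. z $ j * (u b $ j * u b $ k))"
      by (simp add: inner_vec_def sum_distrib_right mult.assoc)
    also have "\<dots> = (\<Sum>j\<in>UNIV. z $ j * (\<Sum>b\<in>B. u b $ j * u b $ k))"
      by (subst sum.swap) (simp add: sum_distrib_left)
    also have "\<dots> = s * z $ k"
      by (simp add: assms if_distrib[of "\<lambda>x. _ * x"] sum.delta cong: if_cong)
    finally show ?thesis .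
  qed
  then show ?thesis by (simp add: vec_eq_iff)
qed

lemma tight_frame_sum_sq_translate:
  assumes "\<And>j k. (\<Sum>b\<in>B. u b $ j * u b $ k) = (if j = k then s else 0)"
  shows "(\<Sum>b\<in>B. (c b + z \<bullet> u b)\<^sup>2) =
    (\<Sum>b\<in>B. (c b)\<^sup>2) + 2 * (z \<bullet> (\<Sum>b\<in>B. c b *\<^sub>R u b)) + s * (z \<bullet> (z :: real^'d))"
proof -
  have "(\<Sum>b\<in>B. (z \<bullet> u b)\<^sup>2) = z \<bullet> (\<Sum>b\<in>B. (z \<bullet> u b) *\<^sub>R u b)"
    by (simp add: inner_sum_right power2_eq_square)
  also have "\<dots> = s * (z \<bullet> z)" by (simp add: tight_frame_expansion[OF assms])
  finally have 1: "(\<Sum>b\<in>B. (z \<bullet> u b)\<^sup>2) = s * (z \<bullet> z)" .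
  have "z \<bullet> (\<Sum>b\<in>B. c b *\<^sub>R u b) = (\<Sum>b\<in>B. c b * (z \<bullet> u b))"
    by (simp add: inner_sum_right)
  then show ?thesis
    by (simp add: power2_sum sum.distrib sum_distrib_left mult.assoc 1 algebra_simps)
qed

lemma mult_swap_factors:
  fixes a b c d f :: "'a::comm_semiring_1"
  shows "a * b = c * d \<Longrightarrow> a * (b * f) = c * f * d" and "a * b = c \<Longrightarrow> a * f * b = c * f"
  by (auto simp flip: mult.assoc) (auto simp: mult_ac)

text \<open>
  Average over the translates of \<open>c\<close> by \<open>z \<bullet> u b\<close>, which translate \<open>X
  c = \<Sum>b\<in>B. c b *\<^sub>R u b\<close> by \<open>z\<close>, and substitute \<open>z = x - X c\<close>.
  Then \<open>f\<close> is evaluated at \<open>x\<close>, independently of \<open>c\<close>, and what is left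
  to integrate over \<open>c\<close> is a moment generating function.
\<close>

lemma gauss_coords_linear_image:
  fixes u :: "'b \<Rightarrow> real^'d"
  assumes B: "finite B" and cov: "\<And>j k. (\<Sum>b\<in>B. u b $ j * u b $ k) = (if j = k then 1 else 0)"
    and f [measurable]: "f \<in> borel_measurable borel"
  shows "(\<integral>\<^sup>+ c. ennreal (gauss_coords B c) * f (\<Sum>b\<in>B. c b *\<^sub>R u b) \<partial>leb_coords B) =
    (\<integral>\<^sup>+ x. ennreal (std_gauss_vec x) * f x \<partial>lborel)"
proof -
  interpret leb: sigma_finite_measure "leb_coords B" by (rule sigma_finite_leb_coords[OF B])
  interpret pair_sigma_finite "leb_coords B" "lborel :: (real^'d) measure" ..
  define X where "X = (\<lambda>c. \<Sum>b\<in>B. c b *\<^sub>R u b)"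
  have [measurable]: "X \<in> borel_measurable (leb_coords B)" unfolding X_def by measurable
  have gauss_cong: "gauss_coords B (\<lambda>b\<in>B. g b) = gauss_coords B g" for g
    by (simp add: gauss_coords_def)
  have X_shift: "X (\<lambda>b\<in>B. c b + z \<bullet> u b) = X c + z" for c z
    using tight_frame_expansion[OF cov, of z] by (simp add: X_def scaleR_left_distrib sum.distrib)
  \<comment> \<open>The terms that are quadratic in \<open>X c\<close> cancel.\<close>
  have dens: "std_gauss_vec (x - X c) * gauss_coords B (\<lambda>b\<in>B. c b + (x - X c) \<bullet> u b) =
      std_gauss_vec x * exp (- (x \<bullet> x) / 2) * (gauss_coords B c * exp (\<Sum>b\<in>B. (x \<bullet> u b) * c b))" for x c
  proof -
    have xX: "(\<Sum>b\<in>B. (x \<bullet> u b) * c b) = x \<bullet> X c"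
      by (simp add: X_def inner_sum_right mult.commute)
    have sq: "(\<Sum>b\<in>B. (c b + (x - X c) \<bullet> u b)\<^sup>2) =
        (\<Sum>b\<in>B. (c b)\<^sup>2) + 2 * ((x - X c) \<bullet> X c) + 1 * ((x - X c) \<bullet> (x - X c))"
      unfolding X_def by (rule tight_frame_sum_sq_translate[OF cov])
    have g: "gauss_coords B (\<lambda>b\<in>B. c b + (x - X c) \<bullet> u b) = (1 / sqrt (2 * pi)) ^ card B *
        exp (- ((\<Sum>b\<in>B. (c b)\<^sup>2) + 2 * ((x - X c) \<bullet> X c) + 1 * ((x - X c) \<bullet> (x - X c))) / 2)"
      unfolding gauss_cong unfolding gauss_coords_eq sq ..
    show ?thesis
      unfolding std_gauss_vec_def gauss_coords_eq[of B c] xX g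
      by (simp add: mult_exp_exp inner_diff_left inner_diff_right inner_commute field_simps)
  qed
  have "(\<integral>\<^sup>+ c. ennreal (gauss_coords B c) * f (X c) \<partial>leb_coords B) =
      (\<integral>\<^sup>+ c. (\<integral>\<^sup>+ z. ennreal (std_gauss_vec z) * (ennreal (gauss_coords B (\<lambda>b\<in>B. c b + z \<bullet> u b)) *
        f (X (\<lambda>b\<in>B. c b + z \<bullet> u b))) \<partial>lborel) \<partial>leb_coords B)"
    by (rule nn_integral_leb_average_translates) (use B std_gauss_vec_total in auto)
  also have "\<dots> = (\<integral>\<^sup>+ c. (\<integral>\<^sup>+ x. ennreal (std_gauss_vec (x - X c)) *
      (ennreal (gauss_coords B (\<lambda>b\<in>B. c b + (x - X c) \<bullet> u b)) * f x) \<partial>lborel) \<partial>leb_coords B)"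
  proof (rule nn_integral_cong)
    fix c
    have [measurable]: "(\<lambda>z. \<lambda>b\<in>B. c b + z \<bullet> u b) \<in> borel \<rightarrow>\<^sub>M leb_coords B"
      by (rule measurable_into_leb_coords) measurable
    show "(\<integral>\<^sup>+ z. ennreal (std_gauss_vec z) * (ennreal (gauss_coords B (\<lambda>b\<in>B. c b + z \<bullet> u b)) *
        f (X (\<lambda>b\<in>B. c b + z \<bullet> u b))) \<partial>lborel) = (\<integral>\<^sup>+ x. ennreal (std_gauss_vec (x - X c)) *
      (ennreal (gauss_coords B (\<lambda>b\<in>B. c b + (x - X c) \<bullet> u b)) * f x) \<partial>lborel)"
      unfolding X_shift by (subst nn_integral_lborel_translate[where a = "X c"]) auto
  qed
  also have "\<dots> = (\<integral>\<^sup>+ c. (\<integral>\<^sup>+ x. ennreal (std_gauss_vec x * exp (- (x \<bullet> x) / 2)) * f x *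
      ennreal (gauss_coords B c * exp (\<Sum>b\<in>B. (x \<bullet> u b) * c b)) \<partial>lborel) \<partial>leb_coords B)"
  proof (intro nn_integral_cong)
    fix c x
    have "ennreal (std_gauss_vec (x - X c)) * ennreal (gauss_coords B (\<lambda>b\<in>B. c b + (x - X c) \<bullet> u b)) =
      ennreal (std_gauss_vec x * exp (- (x \<bullet> x) / 2)) * ennreal (gauss_coords B c * exp (\<Sum>b\<in>B. (x \<bullet> u b) * c b))"
      by (simp add: ennreal_mult[symmetric] dens del: restrict_apply)
    then show "ennreal (std_gauss_vec (x - X c)) * (ennreal (gauss_coords B (\<lambda>b\<in>B. c b + (x - X c) \<bullet> u b)) * f x) =
      ennreal (std_gauss_vec x * exp (- (x \<bullet> x) / 2)) * f x * ennreal (gauss_coords B c * exp (\<Sum>b\<in>B. (x \<bullet> u b) * c b))"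
      by (rule mult_swap_factors(1))
  qed
  also have "\<dots> = (\<integral>\<^sup>+ x. (\<integral>\<^sup>+ c. ennreal (std_gauss_vec x * exp (- (x \<bullet> x) / 2)) * f x *
      ennreal (gauss_coords B c * exp (\<Sum>b\<in>B. (x \<bullet> u b) * c b)) \<partial>leb_coords B) \<partial>lborel)"
  proof (rule Fubini'[symmetric])
    have [measurable]: "(\<lambda>p. \<Sum>b\<in>B. (snd p \<bullet> u b) * fst p b) \<in> borel_measurable (leb_coords B \<Otimes>\<^sub>M lborel)"
    proof (intro borel_measurable_sum borel_measurable_times)
      fix b assume "b \<in> B"
      then show "(\<lambda>p. fst p b) \<in> borel_measurable (leb_coords B \<Otimes>\<^sub>M lborel)"
        by (intro measurable_compose[OF measurable_fst measurable_coord])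
      show "(\<lambda>p. snd p \<bullet> u b) \<in> borel_measurable (leb_coords B \<Otimes>\<^sub>M lborel)" by measurable
    qed
    show "(\<lambda>(c, x). ennreal (std_gauss_vec x * exp (- (x \<bullet> x) / 2)) * f x *
        ennreal (gauss_coords B c * exp (\<Sum>b\<in>B. (x \<bullet> u b) * c b))) \<in> borel_measurable (leb_coords B \<Otimes>\<^sub>M lborel)"
      unfolding split_beta by measurable
  qed
  also have "\<dots> = (\<integral>\<^sup>+ x. ennreal (std_gauss_vec x * exp (- (x \<bullet> x) / 2)) * f x *
      ennreal (exp ((\<Sum>b\<in>B. (x \<bullet> u b)\<^sup>2) / 2)) \<partial>lborel)"
    by (intro nn_integral_cong) (subst nn_integral_cmult, auto simp: gauss_coords_mgf[OF B])
  also have "\<dots> = (\<integral>\<^sup>+ x. ennreal (std_gauss_vec x) * f x \<partial>lborel)"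
  proof (intro nn_integral_cong)
    fix x :: "real^'d"
    have "(\<Sum>b\<in>B. (x \<bullet> u b)\<^sup>2) = x \<bullet> x"
      using tight_frame_sum_sq_translate[OF cov, of "\<lambda>_. 0" x] by simp
    then have "ennreal (std_gauss_vec x * exp (- (x \<bullet> x) / 2)) * ennreal (exp ((\<Sum>b\<in>B. (x \<bullet> u b)\<^sup>2) / 2)) =
        ennreal (std_gauss_vec x)"
      by (simp add: ennreal_mult[symmetric] mult.assoc mult_exp_exp)
    then show "ennreal (std_gauss_vec x * exp (- (x \<bullet> x) / 2)) * f x *
        ennreal (exp ((\<Sum>b\<in>B. (x \<bullet> u b)\<^sup>2) / 2)) = ennreal (std_gauss_vec x) * f x"
      by (rule mult_swap_factors(2))
  qed
  finally show ?thesis unfolding X_def .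
qed

lemma matrix_inv_invertible:
  assumes "invertible (A :: 'a::semiring_1^'n^'m)"
  shows "A ** matrix_inv A = mat 1" "matrix_inv A ** A = mat 1"
  using someI_ex[OF assms[unfolded invertible_def]] by (simp_all add: matrix_inv_def)

text \<open>
  The area formula for a map with exactly one preimage of every point.
\<close>

lemma nn_integral_lborel_linear:
  fixes A :: "real^'d^'d"
  assumes A: "det A \<noteq> 0" and [measurable]: "k \<in> borel_measurable borel"
  shows "(\<integral>\<^sup>+ x. k x \<partial>lborel) = (\<integral>\<^sup>+ y. ennreal \<bar>det A\<bar> * k (A *v y) \<partial>lborel)"
proof -
  have inv: "matrix_inv A ** A = mat 1" "A ** matrix_inv A = mat 1"
    using A by (simp_all add: invertible_det_nz matrix_inv_invertible)
  have "{y \<in> UNIV. A *v y = x} = {matrix_inv A *v x}" for x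
  proof -
    have "A *v y = x \<longleftrightarrow> y = matrix_inv A *v x" for y
      using inv by (metis matrix_vector_mul_assoc matrix_vector_mul_lid)
    then show ?thesis by auto
  qed
  then have count: "num_elems {y. A *v y = x} = 1" for x by simp
  have [measurable]: "(\<lambda>y. A *v y) \<in> borel_measurable borel"
    by (intro borel_measurable_continuous_onI linear_continuous_on)
       (simp add: linear_conv_bounded_linear[symmetric] matrix_vector_mul_linear)
  have "(\<integral>\<^sup>+ x. num_elems {y \<in> UNIV. A *v y = x} * k x \<partial>lborel) =
    (\<integral>\<^sup>+ y. ennreal (indicator UNIV y * \<bar>det (matrix ((*v) A))\<bar>) * k (A *v y) \<partial>lborel)"
    by (rule area_formula[where U = UNIV])
       (auto simp: count matrix_vector_mul_linear intro!: linear_imp_has_derivative)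
  then show ?thesis by (simp add: count)
qed

lemma measurable_quadratic_form [measurable]:
  fixes C :: "real^'d^'d"
  shows "(\<lambda>x. x \<bullet> (C *v x)) \<in> borel_measurable borel"
  by (intro borel_measurable_continuous_onI continuous_intros linear_continuous_on)
     (simp add: linear_conv_bounded_linear[symmetric] matrix_vector_mul_linear)

lemma nn_integral_centered_gaussian:
  fixes A :: "real^'d^'d"
  assumes A: "det A \<noteq> 0" and [measurable]: "h \<in> borel_measurable borel"
  shows "(\<integral>\<^sup>+ x. h x \<partial>centered_gaussian (A ** transpose A)) =
    (\<integral>\<^sup>+ y. ennreal (std_gauss_vec y) * h (A *v y) \<partial>lborel)"
proof -
  define C where "C = A ** transpose A"
  have detC: "det C = (det A)\<^sup>2" by (simp add: C_def det_mul power2_eq_square)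
  have C: "C ** matrix_inv C = mat 1"
    using A by (intro matrix_inv_invertible(1)) (simp add: invertible_det_nz detC)
  have invA: "matrix_inv A ** A = mat 1"
    using A by (simp add: invertible_det_nz matrix_inv_invertible)
  have quad: "(A *v y) \<bullet> (matrix_inv C *v (A *v y)) = y \<bullet> y" for y
  proof -
    let ?w = "matrix_inv C *v (A *v y)"
    have "A *v (transpose A *v ?w) = A *v y"
      using C by (metis C_def matrix_vector_mul_assoc matrix_vector_mul_lid)
    then have "transpose A *v ?w = y"
      using invA by (metis matrix_vector_mul_assoc matrix_vector_mul_lid)
    then show ?thesis
      using dot_lmul_matrix[of ?w A y] by (simp add: inner_commute transpose_matrix_vector)
  qed
  have "ennreal \<bar>det A\<bar> * (ennreal (exp (- ((A *v y) \<bullet> (matrix_inv C *v (A *v y))) / 2) / sqrt ((2 * pi) ^ CARD('d) * det C)) * h (A *v y))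
      = ennreal (std_gauss_vec y) * h (A *v y)" for y
  proof -
    have "sqrt ((2 * pi) ^ CARD('d) * det C) = sqrt (2 * pi) ^ CARD('d) * \<bar>det A\<bar>"
      unfolding detC real_sqrt_mult[of "(2 * pi) ^ _"] real_sqrt_power[of "2 * pi"] real_sqrt_abs ..
    then have "\<bar>det A\<bar> * (exp (- (y \<bullet> y) / 2) / sqrt ((2 * pi) ^ CARD('d) * det C)) = std_gauss_vec y"
      using A by (simp add: std_gauss_vec_def power_one_over field_simps)
    then show ?thesis
      unfolding quad mult.assoc[symmetric] by (subst ennreal_mult[symmetric]) (auto simp: detC)
  qed
  then show ?thesis
    unfolding centered_gaussian_def C_def[symmetric]
    by (subst nn_integral_density) (auto simp: nn_integral_lborel_linear[OF A])
qed

section \<open>Measurability of the number of zeros\<close>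

text \<open>
  On a compact set a continuous function has a zero if its norm has infimum \<open>0\<close>, and the infimum
  may be taken over a countable dense subset.
\<close>

lemma sets_exists_zero_compact:
  fixes F :: "'c \<Rightarrow> 'a::euclidean_space \<Rightarrow> 'b::euclidean_space"
  assumes K: "compact K" and cont: "\<And>c. c \<in> space M \<Longrightarrow> continuous_on UNIV (F c)"
    and meas [measurable]: "\<And>x. (\<lambda>c. F c x) \<in> borel_measurable M"
  shows "{c \<in> space M. \<exists>x\<in>K. F c x = 0} \<in> sets M"
proof -
  obtain D where D: "countable D" "D \<subseteq> K" "K \<subseteq> closure D"
    using separable[of K] by blast
  have "{c \<in> space M. \<exists>x\<in>K. F c x = 0} = {c \<in> space M. \<forall>n. \<exists>x\<in>D. norm (F c x) < 1 / real (Suc n)}"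
  proof (intro set_eqI iffI; clarsimp)
    fix c x n assume c: "c \<in> space M" and x: "x \<in> K" "F c x = 0"
    have "((\<lambda>y. norm (F c y)) \<longlongrightarrow> norm (F c x)) (at x)"
      using cont[OF c] by (intro tendsto_norm) (simp add: continuous_on_eq_continuous_at isCont_def)
    then have "\<forall>\<^sub>F y in at x. norm (F c y) < 1 / real (Suc n)"
      by (rule order_tendstoD) (simp add: x)
    then obtain e where e: "e > 0" "\<And>y. y \<noteq> x \<Longrightarrow> dist y x < e \<Longrightarrow> norm (F c y) < 1 / real (Suc n)"
      unfolding eventually_at by blast
    obtain y where y: "y \<in> D" "dist y x < e"
      using x D(3) e(1) closure_approachable by blast
    then have "norm (F c y) < 1 / real (Suc n)" using e(2) x by (cases "y = x") auto
    then show "\<exists>y\<in>D. norm (F c y) < 1 / (1 + real n)" using y(1) by auto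
  next
    fix c assume c: "c \<in> space M" and ex: "\<forall>n. \<exists>x\<in>D. norm (F c x) < 1 / (1 + real n)"
    then have "K \<noteq> {}" using D(2) by blast
    then obtain x where x: "x \<in> K" "\<And>y. y \<in> K \<Longrightarrow> norm (F c x) \<le> norm (F c y)"
      using continuous_attains_inf[OF K, of "\<lambda>x. norm (F c x)"] cont[OF c]
      by (auto intro: continuous_on_subset continuous_on_norm)
    have "norm (F c x) = 0"
    proof (rule ccontr)
      assume "norm (F c x) \<noteq> 0"
      then have "0 < norm (F c x)" by simp
      then obtain n where "1 / real (Suc n) < norm (F c x)" using nat_approx_posE by blast
      moreover obtain y where "y \<in> D" "norm (F c y) < 1 / (1 + real n)" using ex by blast
      ultimately show False using x(2)[of y] D(2) by auto
    qed
    then show "\<exists>x\<in>K. F c x = 0" using x(1) by auto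
  qed
  also have "\<dots> \<in> sets M"
    using D(1) by measurable
  finally show ?thesis .
qed

lemma num_elems_le:
  assumes "\<And>A. finite A \<Longrightarrow> A \<subseteq> Z \<Longrightarrow> of_nat (card A) \<le> r"
  shows "num_elems Z \<le> r"
proof (cases "finite Z")
  case True
  then show ?thesis using assms[OF True] by simp
next
  case False
  have "of_nat n \<le> r" for n
    using infinite_arbitrarily_large[OF False, of n] assms by auto
  then have "r = top" by (meson ennreal_Ex_less_of_nat not_le not_top_less order_le_less top.not_eq_extremum)
  then show ?thesis by simp
qed

text \<open>
  There are at least \<open>k\<close> points in \<open>Z\<close> exactly if \<open>k\<close> disjoint balls of
  the countable family with centers in \<open>D\<close> and radii \<open>1/(n+1)\<close> meet
  \<open>Z\<close>. Whether a ball meets a zero set is a measurable condition by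
  \<open>sets_exists_zero_compact\<close>.
\<close>

lemma num_elems_eq_SUP_disjoint_balls:
  fixes Z :: "'a::metric_space set"
  assumes dense: "\<And>X. open X \<Longrightarrow> X \<noteq> {} \<Longrightarrow> \<exists>d\<in>D. d \<in> (X :: 'a set)"
  shows "num_elems Z = (SUP J\<in>{J. finite J \<and> J \<subseteq> D \<times> UNIV \<and> disjoint_family_on (\<lambda>(q, n). cball q (1 / real (Suc n))) J}.
    if \<forall>(q, n)\<in>J. \<exists>x\<in>cball q (1 / real (Suc n)). x \<in> Z then of_nat (card J) else 0)"
    (is "_ = (SUP J\<in>?J. ?g J)")
proof (rule antisym)
  show "(SUP J\<in>?J. ?g J) \<le> num_elems Z"
  proof (rule SUP_least)
    fix J assume "J \<in> ?J"
    then have J: "finite J" "disjoint_family_on (\<lambda>(q, n). cball q (1 / real (Suc n))) J" by auto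
    show "?g J \<le> num_elems Z"
    proof (cases "\<forall>(q, n)\<in>J. \<exists>x\<in>cball q (1 / real (Suc n)). x \<in> Z")
      case True
      then have "\<forall>p\<in>J. \<exists>x. x \<in> (case p of (q, n) \<Rightarrow> cball q (1 / real (Suc n))) \<and> x \<in> Z" by auto
      then obtain x where x: "\<And>p. p \<in> J \<Longrightarrow> x p \<in> (case p of (q, n) \<Rightarrow> cball q (1 / real (Suc n))) \<and> x p \<in> Z"
        by metis
      have "inj_on x J"
        using J(2) x unfolding inj_on_def disjoint_family_on_def by fastforce
      then have "of_nat (card J) = num_elems (x ` J)"
        using J(1) by (simp add: card_image)
      also have "\<dots> \<le> num_elems Z" using x by (intro emeasure_mono) auto
      finally show ?thesis using True by simp
    qed auto
  qed
  show "num_elems Z \<le> (SUP J\<in>?J. ?g J)"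
  proof (rule num_elems_le)
    fix A assume A: "finite A" "A \<subseteq> Z"
    define E where "E = insert 1 ((\<lambda>(x, y). dist x y) ` {p \<in> A \<times> A. fst p \<noteq> snd p})"
    have E: "finite E" "E \<noteq> {}" using A(1) by (auto simp: E_def)
    define e where "e = Min E"
    have e: "e > 0" "\<And>x y. x \<in> A \<Longrightarrow> y \<in> A \<Longrightarrow> x \<noteq> y \<Longrightarrow> e \<le> dist x y"
    proof -
      show "e > 0" unfolding e_def using E by (subst Min_gr_iff) (auto simp: E_def)
      fix x y assume "x \<in> A" "y \<in> A" "x \<noteq> y"
      then have "dist x y \<in> E" unfolding E_def by force
      then show "e \<le> dist x y" unfolding e_def using E(1) by (rule Min_le[rotated])
    qed
    \<comment> \<open>Two points of \<open>A\<close> in intersecting balls have distance at most four radii.\<close>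
    obtain n where n: "1 / real (Suc n) < e / 4" using nat_approx_posE[of "e / 4"] e(1) by auto
    have "\<exists>q\<in>D. x \<in> cball q (1 / real (Suc n))" for x
      using dense[of "ball x (1 / real (Suc n))"] by (force simp: dist_commute)
    then obtain q where q: "\<And>x. q x \<in> D" "\<And>x. x \<in> cball (q x) (1 / real (Suc n))" by metis
    let ?p = "\<lambda>x. (q x, n)"
    have sep: "cball (q x) (1 / real (Suc n)) \<inter> cball (q y) (1 / real (Suc n)) = {}"
      if "x \<in> A" "y \<in> A" "x \<noteq> y" for x y
    proof (rule ccontr)
      assume "cball (q x) (1 / real (Suc n)) \<inter> cball (q y) (1 / real (Suc n)) \<noteq> {}"
      then obtain z where "dist (q x) z \<le> 1 / real (Suc n)" "dist (q y) z \<le> 1 / real (Suc n)" by auto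
      moreover have "dist (q x) x \<le> 1 / real (Suc n)" "dist (q y) y \<le> 1 / real (Suc n)"
        using q(2) by (auto simp: mem_cball)
      moreover have "dist x y \<le> dist (q x) x + dist (q x) z + dist (q y) z + dist (q y) y"
        using dist_triangle[of x y "q x"] dist_triangle[of "q x" y "z"] dist_triangle[of z y "q y"]
        by (simp add: dist_commute)
      ultimately show False using e(2)[OF that] n by linarith
    qed
    have inj: "inj_on ?p A"
    proof (rule inj_onI)
      fix x y assume "x \<in> A" "y \<in> A" "?p x = ?p y"
      then show "x = y" using sep[of x y] q(2)[of x] by auto
    qed
    have "?p ` A \<in> ?J"
      using A(1) q(1) sep by (auto simp: disjoint_family_on_def)
    then have le: "?g (?p ` A) \<le> (SUP J\<in>?J. ?g J)" by (rule SUP_upper)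
    have "?g (?p ` A) = of_nat (card A)"
      using A(2) q(2) inj by (auto simp: card_image)
    with le show "of_nat (card A) \<le> (SUP J\<in>?J. ?g J)" by (simp only:)
  qed
qed

lemma borel_measurable_num_zeros_compact:
  fixes F :: "'c \<Rightarrow> 'a::euclidean_space \<Rightarrow> 'b::euclidean_space"
  assumes K: "compact K" and cont: "\<And>c. c \<in> space M \<Longrightarrow> continuous_on UNIV (F c)"
    and meas: "\<And>x. (\<lambda>c. F c x) \<in> borel_measurable M"
  shows "(\<lambda>c. num_elems {x \<in> K. F c x = 0}) \<in> borel_measurable M"
proof -
  obtain D :: "'a set" where D: "countable D" "\<And>X. open X \<Longrightarrow> X \<noteq> {} \<Longrightarrow> \<exists>d\<in>D. d \<in> X"
    using countable_dense_exists by blast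
  let ?J = "{J. finite J \<and> J \<subseteq> D \<times> (UNIV :: nat set) \<and> disjoint_family_on (\<lambda>(q, n). cball q (1 / real (Suc n))) J}"
  have "countable {J. finite J \<and> J \<subseteq> D \<times> (UNIV :: nat set)}"
    using D(1) by (intro countable_Collect_finite_subset) auto
  then have J: "countable ?J" by (rule countable_subset[rotated]) auto
  have hit: "{c \<in> space M. \<exists>x\<in>cball q (1 / real (Suc n)) \<inter> K. F c x = 0} \<in> sets M" for q n
    by (rule sets_exists_zero_compact) (use K cont meas in auto)
  have hit' [measurable]: "Measurable.pred M (\<lambda>c. \<exists>x\<in>cball q (1 / real (Suc n)). x \<in> {x \<in> K. F c x = 0})" for q n
  proof -
    have "(\<exists>x\<in>cball q (1 / real (Suc n)). x \<in> {x \<in> K. F c x = 0}) \<longleftrightarrow>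
        (\<exists>x\<in>cball q (1 / real (Suc n)) \<inter> K. F c x = 0)" for c by blast
    with hit[of q n] show ?thesis by (simp only: pred_def)
  qed
  have eq: "num_elems {x \<in> K. F c x = 0} = (SUP J\<in>?J. if \<forall>(q, n)\<in>J. \<exists>x\<in>cball q (1 / real (Suc n)). x \<in> {x \<in> K. F c x = 0}
        then of_nat (card J) else 0)" for c
    by (rule num_elems_eq_SUP_disjoint_balls) (rule D(2))
  show ?thesis
    unfolding eq
  proof (rule borel_measurable_SUP[OF J])
    fix J assume "J \<in> ?J"
    then have [simp]: "finite J" by simp
    have pm: "Measurable.pred M (\<lambda>c. \<forall>(q, n)\<in>J. \<exists>x\<in>cball q (1 / real (Suc n)). x \<in> {x \<in> K. F c x = 0})"
    proof (rule pred_intros_finite(3))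
      show "finite J" by simp
      fix p assume "p \<in> J"
      show "Measurable.pred M (\<lambda>c. case p of (q, n) \<Rightarrow> \<exists>x\<in>cball q (1 / real (Suc n)). x \<in> {x \<in> K. F c x = 0})"
        by (cases p) (simp only: prod.case hit')
    qed
    show "(\<lambda>c. if \<forall>(q, n)\<in>J. \<exists>x\<in>cball q (1 / real (Suc n)). x \<in> {x \<in> K. F c x = 0}
        then of_nat (card J) else 0 :: ennreal) \<in> borel_measurable M"
      by (rule measurable_If[OF measurable_const measurable_const]) (use pm in \<open>simp_all only: pred_def space_borel UNIV_I\<close>)
  qed
qed

text \<open>
  Half-open cells are increasing unions of compact sets (\<open>half_open_box_eq_UN\<close>).
\<close>

lemma borel_measurable_num_zeros:
  fixes F :: "'c \<Rightarrow> 'a::euclidean_space \<Rightarrow> 'b::euclidean_space"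
  assumes K: "\<And>n :: nat. compact (K n)" "incseq K" and cont: "\<And>c. c \<in> space M \<Longrightarrow> continuous_on UNIV (F c)"
    and meas: "\<And>x. (\<lambda>c. F c x) \<in> borel_measurable M"
  shows "(\<lambda>c. num_elems {x \<in> (\<Union>n. K n). F c x = 0}) \<in> borel_measurable M"
proof -
  have "num_elems {x \<in> (\<Union>n. K n). F c x = 0} = (SUP n. num_elems {x \<in> K n. F c x = 0})" for c
  proof -
    have "(SUP n. num_elems {x \<in> K n. F c x = 0}) = num_elems (\<Union>n. {x \<in> K n. F c x = 0})"
      by (rule SUP_emeasure_incseq) (use K(2) in \<open>auto simp: incseq_def\<close>)
    also have "(\<Union>n. {x \<in> K n. F c x = 0}) = {x \<in> (\<Union>n. K n). F c x = 0}" by auto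
    finally show ?thesis by simp
  qed
  then show ?thesis
    using borel_measurable_num_zeros_compact[OF K(1) cont meas] by simp
qed

section \<open>From the unit sphere to Gaussian coefficients\<close>

definition sum_sq :: "'b set \<Rightarrow> ('b \<Rightarrow> real) \<Rightarrow> real"
  where "sum_sq B c = (\<Sum>b\<in>B. (c b)\<^sup>2)"

lemma measurable_sum_sq [measurable]: "sum_sq B \<in> borel_measurable (leb_coords B)"
  unfolding sum_sq_def by measurable

lemma sum_sq_nonneg [simp]: "0 \<le> sum_sq B c"
  by (simp add: sum_sq_def sum_nonneg)

text \<open>
  The layer cake representation of the Gaussian density: a superposition of the indicators of the balls
  \<open>q \<le> t\<close>.
\<close>

lemma exp_minus_half_eq_layers:
  assumes "0 \<le> q"
  shows "ennreal (exp (- q / 2)) = (\<integral>\<^sup>+ t. ennreal (exp (- t / 2) / 2) * indicator {q..} t \<partial>lborel)"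
proof -
  have "filterlim (\<lambda>t::real. - t / 2) at_bot at_top" by real_asymp
  then have "((\<lambda>t::real. exp (- t / 2)) \<longlongrightarrow> 0) at_top"
    by (rule filterlim_compose[OF exp_at_bot])
  from tendsto_minus[OF this] have "((\<lambda>t::real. - exp (- t / 2)) \<longlongrightarrow> 0) at_top"
    by simp
  then have "(\<integral>\<^sup>+ t. ennreal (exp (- t / 2) / 2) * indicator {q..} t \<partial>lborel) = ennreal (0 - (- exp (- q / 2)))"
    by (intro nn_integral_FTC_atLeast) (auto intro!: derivative_eq_intros)
  then show ?thesis by simp
qed

text \<open>
  For a function that is constant on rays, the integral over a ball of radius \<open>t\<close> is the one over
  the unit ball, up to a power of \<open>t\<close>. The Gaussian integral is a superposition of such
  integrals, hence a multiple \<open>K\<close> of the integral over the unit ball; the function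
  \<open>1\<close> shows what \<open>K\<close> is.
\<close>

lemma gauss_mean_eq_ball_mean:
  assumes B: "finite B" and N [measurable]: "N \<in> borel_measurable (leb_coords B)"
    and hom: "\<And>t c. t > 0 \<Longrightarrow> N (\<lambda>b\<in>B. t * c b) = N c"
  shows "(\<integral>\<^sup>+ c. ennreal (gauss_coords B c) * N c \<partial>leb_coords B) =
      (\<integral>\<^sup>+ c. N c * indicator {c. sum_sq B c \<le> 1} c \<partial>leb_coords B) /
      (\<integral>\<^sup>+ c. indicator {c. sum_sq B c \<le> 1} c \<partial>leb_coords B)"
proof -
  interpret leb: sigma_finite_measure "leb_coords B" by (rule sigma_finite_leb_coords[OF B])
  interpret pair_sigma_finite "leb_coords B" "lborel :: real measure" ..
  let ?ball = "\<lambda>c. indicator {c. sum_sq B c \<le> 1} c :: ennreal"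
  define \<kappa> where "\<kappa> = ennreal ((1 / sqrt (2 * pi)) ^ card B)"
  define K where "K = \<kappa> * (\<integral>\<^sup>+ t. ennreal (exp (- t / 2) / 2) * (ennreal (sqrt t ^ card B) * indicator {0<..} t) \<partial>lborel)"
  have scale: "(\<integral>\<^sup>+ c. ennreal (gauss_coords B c) * G c \<partial>leb_coords B) = K * (\<integral>\<^sup>+ c. G c * ?ball c \<partial>leb_coords B)"
    if [measurable]: "G \<in> borel_measurable (leb_coords B)" and homG: "\<And>t c. t > 0 \<Longrightarrow> G (\<lambda>b\<in>B. t * c b) = G c" for G
  proof -
    have [measurable]: "(\<lambda>c. indicator {sum_sq B c..} t :: ennreal) \<in> borel_measurable (leb_coords B)" for t
      unfolding indicator_def atLeast_def by measurable
    have layer: "(\<integral>\<^sup>+ c. G c * indicator {sum_sq B c..} t \<partial>leb_coords B) =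
        ennreal (sqrt t ^ card B) * indicator {0<..} t * (\<integral>\<^sup>+ c. G c * ?ball c \<partial>leb_coords B)" if "t \<noteq> 0" for t
    proof (cases "t > 0")
      case True
      have sq: "sum_sq B (\<lambda>b\<in>B. sqrt t * c b) = t * sum_sq B c" for c
        using True by (simp add: sum_sq_def power_mult_distrib sum_distrib_left)
      have "(\<integral>\<^sup>+ c. G c * indicator {sum_sq B c..} t \<partial>leb_coords B) = ennreal (sqrt t ^ card B) *
          (\<integral>\<^sup>+ c. G (\<lambda>b\<in>B. sqrt t * c b) * indicator {sum_sq B (\<lambda>b\<in>B. sqrt t * c b)..} t \<partial>leb_coords B)"
        using nn_integral_leb_affine[OF B, of "sqrt t" "\<lambda>c. G c * indicator {sum_sq B c..} t" "\<lambda>_. 0"] True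
        by simp
      also have "(\<integral>\<^sup>+ c. G (\<lambda>b\<in>B. sqrt t * c b) * indicator {sum_sq B (\<lambda>b\<in>B. sqrt t * c b)..} t \<partial>leb_coords B) =
          (\<integral>\<^sup>+ c. G c * ?ball c \<partial>leb_coords B)"
        unfolding sq using True homG[of "sqrt t"]
        by (intro nn_integral_cong) (auto simp: indicator_def field_simps)
      finally show ?thesis using True by simp
    next
      case False
      then have "\<not> sum_sq B c \<le> t" for c using that sum_sq_nonneg[of B c] by linarith
      with False show ?thesis by simp
    qed
    have m: "(\<lambda>(c, t). G c * (ennreal (exp (- t / 2) / 2) * indicator {sum_sq B c..} t))
        \<in> borel_measurable (leb_coords B \<Otimes>\<^sub>M lborel)"
      unfolding split_beta atLeast_def indicator_def by measurable
    have "(\<integral>\<^sup>+ c. ennreal (gauss_coords B c) * G c \<partial>leb_coords B) =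
        (\<integral>\<^sup>+ c. \<kappa> * (\<integral>\<^sup>+ t. G c * (ennreal (exp (- t / 2) / 2) * indicator {sum_sq B c..} t) \<partial>lborel) \<partial>leb_coords B)"
    proof (rule nn_integral_cong)
      fix c
      have "ennreal (gauss_coords B c) = \<kappa> * ennreal (exp (- sum_sq B c / 2))"
        by (simp add: gauss_coords_eq \<kappa>_def sum_sq_def ennreal_mult)
      moreover have "(\<integral>\<^sup>+ t. G c * (ennreal (exp (- t / 2) / 2) * indicator {sum_sq B c..} t) \<partial>lborel) =
          G c * ennreal (exp (- sum_sq B c / 2))"
        unfolding exp_minus_half_eq_layers[OF sum_sq_nonneg] by (rule nn_integral_cmult) measurable
      ultimately show "ennreal (gauss_coords B c) * G c =
          \<kappa> * (\<integral>\<^sup>+ t. G c * (ennreal (exp (- t / 2) / 2) * indicator {sum_sq B c..} t) \<partial>lborel)"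
        by (simp only: mult_ac)
    qed
    also have "\<dots> = \<kappa> * (\<integral>\<^sup>+ c. (\<integral>\<^sup>+ t. G c * (ennreal (exp (- t / 2) / 2) * indicator {sum_sq B c..} t) \<partial>lborel) \<partial>leb_coords B)"
      by (rule nn_integral_cmult) (use m in measurable)
    also have "(\<integral>\<^sup>+ c. (\<integral>\<^sup>+ t. G c * (ennreal (exp (- t / 2) / 2) * indicator {sum_sq B c..} t) \<partial>lborel) \<partial>leb_coords B) =
        (\<integral>\<^sup>+ t. (\<integral>\<^sup>+ c. G c * (ennreal (exp (- t / 2) / 2) * indicator {sum_sq B c..} t) \<partial>leb_coords B) \<partial>lborel)"
      by (rule Fubini'[OF m, symmetric])
    also have "\<dots> = (\<integral>\<^sup>+ t. ennreal (exp (- t / 2) / 2) * (ennreal (sqrt t ^ card B) * indicator {0<..} t) *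
        (\<integral>\<^sup>+ c. G c * ?ball c \<partial>leb_coords B) \<partial>lborel)"
    proof (rule nn_integral_cong_AE)
      have "AE t in lborel. t \<noteq> (0::real)" by (rule AE_lborel_singleton)
      then show "AE t in lborel. (\<integral>\<^sup>+ c. G c * (ennreal (exp (- t / 2) / 2) * indicator {sum_sq B c..} t) \<partial>leb_coords B) =
          ennreal (exp (- t / 2) / 2) * (ennreal (sqrt t ^ card B) * indicator {0<..} t) *
          (\<integral>\<^sup>+ c. G c * ?ball c \<partial>leb_coords B)"
      proof eventually_elim
        case (elim t)
        have "(\<integral>\<^sup>+ c. G c * (ennreal (exp (- t / 2) / 2) * indicator {sum_sq B c..} t) \<partial>leb_coords B) =
            (\<integral>\<^sup>+ c. ennreal (exp (- t / 2) / 2) * (G c * indicator {sum_sq B c..} t) \<partial>leb_coords B)"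
          by (intro nn_integral_cong) (simp only: mult.left_commute)
        also have "\<dots> = ennreal (exp (- t / 2) / 2) * (\<integral>\<^sup>+ c. G c * indicator {sum_sq B c..} t \<partial>leb_coords B)"
          by (rule nn_integral_cmult) measurable
        finally show ?case unfolding layer[OF elim] by (simp only: mult.assoc)
      qed
    qed
    also have "\<dots> = (\<integral>\<^sup>+ t. ennreal (exp (- t / 2) / 2) * (ennreal (sqrt t ^ card B) * indicator {0<..} t) \<partial>lborel) *
        (\<integral>\<^sup>+ c. G c * ?ball c \<partial>leb_coords B)"
      by (rule nn_integral_multc) measurable
    finally show ?thesis by (simp add: K_def mult.assoc)
  qed
  let ?v = "\<integral>\<^sup>+ c. ?ball c \<partial>leb_coords B"
  have one: "K * ?v = 1"
    using scale[of "\<lambda>_. 1"] gauss_coords_total[OF B] by simp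
  then have v0: "?v \<noteq> 0" by auto
  have "K \<noteq> 0" using one by auto
  then have vtop: "?v \<noteq> \<infinity>" using one by (auto simp: ennreal_mult_top)
  have "K = 1 / ?v"
    using one v0 vtop by (metis ennreal_mult_divide_eq infinity_ennreal_def)
  then show ?thesis using scale[OF N hom]
    by (simp add: divide_ennreal_def mult.commute)
qed

lemma num_critical_scale:
  assumes "t \<noteq> 0" shows "num_critical (t *\<^sub>R v) = num_critical v"
proof -
  have "((t *\<^sub>R v) has_derivative (\<lambda>_. 0)) (at \<theta>) \<longleftrightarrow> (v has_derivative (\<lambda>_. 0)) (at \<theta>)" for \<theta>
  proof
    assume "((t *\<^sub>R v) has_derivative (\<lambda>_. 0)) (at \<theta>)"
    from has_derivative_scaleR_right[OF this, of "1 / t"] assms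
    show "(v has_derivative (\<lambda>_. 0)) (at \<theta>)" by (simp add: scaleR_fun_def)
  next
    assume "(v has_derivative (\<lambda>_. 0)) (at \<theta>)"
    from has_derivative_scaleR_right[OF this, of t]
    show "((t *\<^sub>R v) has_derivative (\<lambda>_. 0)) (at \<theta>)" by (simp add: scaleR_fun_def)
  qed
  then show ?thesis by (simp add: num_critical_def critical_points_def)
qed

lemma set_integrable_box_continuous:
  fixes f :: "real^'n \<Rightarrow> real"
  assumes "continuous_on UNIV f"
  shows "set_integrable lborel (cbox 0 (\<chi> j. 2 * pi)) f"
  unfolding set_integrable_def using borel_integrable_compact[OF compact_cbox] assms
  by (blast intro: continuous_on_subset)

lemma fun_sum_apply: "(\<Sum>b\<in>B. f b) x = (\<Sum>b\<in>B. f b x)"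
  for f :: "'b \<Rightarrow> 'a \<Rightarrow> 'c::comm_monoid_add"
  by (induction B rule: infinite_finite_induct) auto

lemma l2_inner_sum_left:
  assumes "finite B" "\<And>b. b \<in> B \<Longrightarrow> continuous_on UNIV b" "continuous_on UNIV g"
  shows "l2_inner (\<Sum>b\<in>B. c b *\<^sub>R b) g = (\<Sum>b\<in>B. c b * l2_inner b g)"
proof -
  have "l2_inner (\<Sum>b\<in>B. c b *\<^sub>R b) g =
      (LINT x : cbox 0 (\<chi> j. 2 * pi) | lborel. (\<Sum>b\<in>B. c b * (b x * g x)))"
    by (simp add: l2_inner_def fun_sum_apply scaleR_fun_def sum_distrib_right mult.assoc)
  also have "\<dots> = (\<Sum>b\<in>B. LINT x : cbox 0 (\<chi> j. 2 * pi) | lborel. c b * (b x * g x))"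
    unfolding set_lebesgue_integral_def scaleR_sum_right
  proof (rule Bochner_Integration.integral_sum)
    fix b assume "b \<in> B"
    then have "continuous_on UNIV (\<lambda>x. c b * (b x * g x))"
      using assms by (intro continuous_intros) auto
    from set_integrable_box_continuous[OF this]
    show "integrable lborel (\<lambda>x. indicator (cbox 0 (\<chi> j. 2 * pi)) x *\<^sub>R (c b * (b x * g x)))"
      unfolding set_integrable_def .
  qed
  finally show ?thesis by (simp add: l2_inner_def)
qed

lemma l2_inner_commute: "l2_inner f g = l2_inner g f"
  by (simp add: l2_inner_def mult.commute)

context
  fixes V B :: "(real^'n \<Rightarrow> real) set"
  assumes ob: "l2_orthonormal_basis V B" and contB: "\<And>b. b \<in> B \<Longrightarrow> continuous_on UNIV b"
begin

abbreviation (input) comb where "comb c \<equiv> (\<Sum>b\<in>B. c b *\<^sub>R b)"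

lemma finite_basis: "finite B" and span_basis: "span B = V"
  using ob by (auto simp: l2_orthonormal_basis_def)

lemma comb_in: "comb c \<in> V"
  unfolding span_basis[symmetric] by (intro span_sum span_scale span_base)

lemma comb_surj: "v \<in> V \<Longrightarrow> \<exists>c. v = comb c"
  unfolding span_basis[symmetric] span_finite[OF finite_basis] by auto

lemma continuous_comb: "continuous_on UNIV (comb c)"
proof -
  have "comb c = (\<lambda>x. \<Sum>b\<in>B. c b * b x)" by (simp add: fun_eq_iff fun_sum_apply scaleR_fun_def)
  then show ?thesis using contB by (auto intro!: continuous_intros)
qed

lemma l2_inner_comb: "b \<in> B \<Longrightarrow> l2_inner (comb c) b = c b"
proof -
  assume b: "b \<in> B"
  have "l2_inner (comb c) b = (\<Sum>b'\<in>B. c b' * l2_inner b' b)"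
    by (rule l2_inner_sum_left) (use b contB finite_basis in auto)
  also have "\<dots> = (\<Sum>b'\<in>B. if b' = b then c b' else 0)"
    using ob b by (intro sum.cong) (auto simp: l2_orthonormal_basis_def)
  finally show ?thesis using b finite_basis by simp
qed

lemma l2_norm_comb: "l2_norm (comb c) = sqrt (sum_sq B c)"
proof -
  have "l2_inner (comb c) (comb c) = (\<Sum>b\<in>B. c b * l2_inner b (comb c))"
    by (rule l2_inner_sum_left) (use contB finite_basis continuous_comb in auto)
  also have "\<dots> = sum_sq B c"
    using l2_inner_comb by (simp add: l2_inner_commute[of _ "comb c"] sum_sq_def power2_eq_square)
  finally show ?thesis by (simp add: l2_norm_def)
qed

lemma comb_inner: "v \<in> V \<Longrightarrow> comb (\<lambda>b. l2_inner v b) = v"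
  using comb_surj l2_inner_comb by fastforce

lemma dim_eq_card_basis: "dim V = card B"
proof -
  have "independent B"
  proof (rule independent_if_scalars_zero[OF finite_basis])
    fix c b assume "(\<Sum>b\<in>B. c b *\<^sub>R b) = 0" "b \<in> B"
    then show "c b = 0" using l2_inner_comb[of b c] by (simp add: l2_inner_def)
  qed
  then show ?thesis using dim_span_eq_card_independent[of B] by (simp add: span_basis)
qed

end

text \<open>
  The area of a part of the sphere is the volume of the cone over it, up to the factor \<open>dim V\<close>,
  so that the mean over the sphere is the mean over the ball of a function that is constant on rays.
\<close>

lemma sphere_mean_eq_gauss_mean:
  fixes V :: "(real^'n \<Rightarrow> real) set"
  defines "B \<equiv> SOME B. l2_orthonormal_basis V B"
  assumes ob: "l2_orthonormal_basis V B" and contB: "\<And>b. b \<in> B \<Longrightarrow> continuous_on UNIV b" and ne: "B \<noteq> {}"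
    and meas: "(\<lambda>c. num_critical (\<Sum>b\<in>B. c b *\<^sub>R b)) \<in> borel_measurable (leb_coords B)"
  shows "1 / emeasure (sphere_area V) (l2_sphere V) * (\<integral>\<^sup>+ v. num_critical v \<partial>sphere_area V) =
    (\<integral>\<^sup>+ c. ennreal (gauss_coords B c) * num_critical (\<Sum>b\<in>B. c b *\<^sub>R b) \<partial>leb_coords B)"
proof -
  note facts = finite_basis[OF ob contB] span_basis[OF ob contB]
  have finB: "finite B" by (rule facts(1))
  define T where "T = (\<lambda>c. \<Sum>b\<in>B. c b *\<^sub>R b)"
  define co where "co = (\<lambda>v. \<lambda>b\<in>B. l2_inner v b)"
  define A where "A = vimage_algebra V co (\<Pi>\<^sub>M b\<in>B. borel :: real measure)"
  have L: "l2_lebesgue V = distr (leb_coords B) A T"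
    unfolding l2_lebesgue_def Let_def B_def[symmetric] A_def co_def T_def leb_coords_def ..
  have spA: "space A = V" by (simp add: A_def)
  have TV: "T c \<in> V" for c unfolding T_def by (rule comb_in[OF ob contB])
  have coT: "co (T c) = restrict c B" for c
    by (auto simp: co_def T_def fun_eq_iff l2_inner_comb[OF ob contB])
  have Tco: "T (co v) = v" if "v \<in> V" for v
    using comb_inner[OF ob contB that] unfolding T_def co_def by (simp cong: sum.cong)
  have Tres: "T (restrict c B) = T c" for c unfolding T_def by (rule sum.cong) auto
  have normT: "l2_norm (T c) = sqrt (sum_sq B c)" for c unfolding T_def by (rule l2_norm_comb[OF ob contB])
  have norm_eq: "l2_norm v = sqrt (sum_sq B (co v))" if "v \<in> V" for v
    using normT[of "co v"] Tco[OF that] by simp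
  have sets_leb: "sets (leb_coords B) = sets (\<Pi>\<^sub>M b\<in>B. borel)" by (rule sets_leb_coords)
  have mco [measurable]: "co \<in> A \<rightarrow>\<^sub>M leb_coords B"
  proof -
    have "co \<in> V \<rightarrow> space (\<Pi>\<^sub>M b\<in>B. borel :: real measure)" by (auto simp: co_def space_PiM)
    then have "co \<in> A \<rightarrow>\<^sub>M (\<Pi>\<^sub>M b\<in>B. borel)" unfolding A_def by (rule measurable_vimage_algebra1)
    then show ?thesis using measurable_cong_sets[OF refl sets_leb, of A] by simp
  qed
  have intoA: "g \<in> N \<rightarrow>\<^sub>M A" if "\<And>x. x \<in> space N \<Longrightarrow> g x \<in> V" "(\<lambda>x. co (g x)) \<in> N \<rightarrow>\<^sub>M leb_coords B"
    for g and N :: "'z measure"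
    unfolding A_def
    by (rule measurable_vimage_algebra2)
       (use that measurable_cong_sets[OF refl sets_leb, of N] in auto)
  have mT: "T \<in> leb_coords B \<rightarrow>\<^sub>M A"
    by (rule intoA) (use TV in \<open>auto simp: coT intro!: measurable_into_leb_coords\<close>)
  have mnorm [measurable]: "l2_norm \<in> borel_measurable A"
  proof -
    have "(\<lambda>v. sqrt (sum_sq B (co v))) \<in> borel_measurable A" by measurable
    then show ?thesis using measurable_cong[of A l2_norm] norm_eq spA by (metis (no_types, lifting))
  qed
  define R where "R = (\<lambda>v :: real^'n \<Rightarrow> real. (1 / l2_norm v) *\<^sub>R v)"
  have RT: "R (T c) = T (\<lambda>b\<in>B. (1 / sqrt (sum_sq B c)) * c b)" for c
    unfolding R_def normT unfolding T_def scaleR_sum_right by (rule sum.cong) auto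
  have RV: "R v \<in> V" if "v \<in> V" for v
    using RT[of "co v"] Tco[OF that] TV by metis
  have mR: "R \<in> A \<rightarrow>\<^sub>M A"
  proof (rule intoA)
    show "R v \<in> V" if "v \<in> space A" for v using that RV spA by simp
    have "co (R v) = (\<lambda>b\<in>B. (1 / sqrt (sum_sq B (co v))) * co v b)" if "v \<in> V" for v
      using RT[of "co v"] Tco[OF that] coT by (metis restrict_restrict Int_absorb)
    moreover have "(\<lambda>v. \<lambda>b\<in>B. (1 / sqrt (sum_sq B (co v))) * co v b) \<in> A \<rightarrow>\<^sub>M leb_coords B"
    proof (intro measurable_into_leb_coords borel_measurable_times)
      show "(\<lambda>v. co v b) \<in> borel_measurable A" if "b \<in> B" for b
        by (rule measurable_compose[OF mco measurable_coord[OF that]])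
      show "(\<lambda>v. 1 / sqrt (sum_sq B (co v))) \<in> borel_measurable A" by measurable
    qed
    ultimately show "(\<lambda>v. co (R v)) \<in> A \<rightarrow>\<^sub>M leb_coords B"
      using measurable_cong[of A "\<lambda>v. co (R v)"] spA by (metis (no_types, lifting))
  qed
  let ?P = "{v \<in> V. 0 < l2_norm v \<and> l2_norm v \<le> 1}"
  have P: "?P \<in> sets A"
  proof -
    have "{v \<in> space A. 0 < l2_norm v \<and> l2_norm v \<le> 1} \<in> sets A" by measurable
    then show ?thesis by (simp add: spA)
  qed
  have normR: "l2_norm (R v) = 1" if "v \<in> ?P" for v
  proof -
    have v: "v \<in> V" "0 < sum_sq B (co v)" using that norm_eq[of v] by auto
    have "R v = T (\<lambda>b\<in>B. (1 / sqrt (sum_sq B (co v))) * co v b)" using RT[of "co v"] Tco[OF v(1)] by simp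
    then have "l2_norm (R v) = sqrt (sum_sq B (\<lambda>b\<in>B. (1 / sqrt (sum_sq B (co v))) * co v b))"
      by (simp add: normT)
    also have "sum_sq B (\<lambda>b\<in>B. (1 / sqrt (sum_sq B (co v))) * co v b) = sum_sq B (co v) / sum_sq B (co v)"
      using v(2) unfolding sum_sq_def sum_divide_distrib
      by (intro sum.cong) (auto simp: power_mult_distrib power_divide)
    finally show ?thesis using v(2) by simp
  qed
  have setsL: "sets (l2_lebesgue V) = sets A" by (simp add: L)
  have mR': "R \<in> restrict_space (l2_lebesgue V) ?P \<rightarrow>\<^sub>M restrict_space (l2_lebesgue V) (l2_sphere V)"
  proof (rule measurable_restrict_space2)
    show "R \<in> space (restrict_space (l2_lebesgue V) ?P) \<rightarrow> l2_sphere V"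
      using normR RV by (auto simp: space_restrict_space l2_sphere_def)
    show "R \<in> restrict_space (l2_lebesgue V) ?P \<rightarrow>\<^sub>M l2_lebesgue V"
      using mR by (intro measurable_restrict_space1) (simp add: L cong: measurable_cong_sets)
  qed
  \<comment> \<open>The punctured ball differs from the ball by the null set of the origin; this uses \<open>B \<noteq> {}\<close>.\<close>
  have int: "(\<integral>\<^sup>+ v. g v \<partial>sphere_area V) =
      of_nat (card B) * (\<integral>\<^sup>+ c. g (R (T c)) * indicator {c. sum_sq B c \<le> 1} c \<partial>leb_coords B)"
    if [measurable]: "g \<in> borel_measurable A" for g
  proof -
    note [measurable] = P mT mR
    have gm: "g \<in> borel_measurable (restrict_space (l2_lebesgue V) (l2_sphere V))"
      using that by (intro measurable_restrict_space1) (simp add: L cong: measurable_cong_sets)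
    have "(\<integral>\<^sup>+ v. g v \<partial>sphere_area V) = of_nat (dim V) * (\<integral>\<^sup>+ v. g (R v) \<partial>restrict_space (l2_lebesgue V) ?P)"
      unfolding sphere_area_def R_def[symmetric]
      using gm mR' by (subst nn_integral_scale_measure) (auto simp: nn_integral_distr)
    also have "(\<integral>\<^sup>+ v. g (R v) \<partial>restrict_space (l2_lebesgue V) ?P) = (\<integral>\<^sup>+ v. g (R v) * indicator ?P v \<partial>l2_lebesgue V)"
      using P by (intro nn_integral_restrict_space) (simp add: setsL L spA Int_absorb2)
    also have "\<dots> = (\<integral>\<^sup>+ c. g (R (T c)) * indicator ?P (T c) \<partial>leb_coords B)"
      unfolding L by (subst nn_integral_distr) auto
    also have "\<dots> = (\<integral>\<^sup>+ c. g (R (T c)) * indicator {c. sum_sq B c \<le> 1} c \<partial>leb_coords B)"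
    proof (rule nn_integral_cong_AE)
      have "emeasure (leb_coords B) (\<Pi>\<^sub>E b\<in>B. {0}) = (\<Prod>b\<in>B. emeasure lborel {0 :: real})"
        unfolding leb_coords_def by (rule leb.emeasure_PiM) (use finB in auto)
      also have "\<dots> = 0" using ne finB by (simp add: card_gt_0_iff)
      finally have "(\<Pi>\<^sub>E b\<in>B. {0}) \<in> null_sets (leb_coords B)"
        unfolding leb_coords_def by (intro null_setsI sets_PiM_I_finite) (use finB in auto)
      then have "AE c in leb_coords B. c \<notin> (\<Pi>\<^sub>E b\<in>B. {0})" by (rule AE_not_in)
      then show "AE c in leb_coords B. g (R (T c)) * indicator ?P (T c) =
          g (R (T c)) * indicator {c. sum_sq B c \<le> 1} c"
        using AE_space
      proof eventually_elim
        case (elim c)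
        have "sum_sq B c \<noteq> 0"
        proof
          assume "sum_sq B c = 0"
          then have "\<forall>b\<in>B. c b = 0" using finB by (simp add: sum_sq_def sum_nonneg_eq_0_iff)
          then have "c \<in> (\<Pi>\<^sub>E b\<in>B. {0})" using elim(2) by (auto simp: space_leb_coords PiE_def extensional_def fun_eq_iff)
          then show False using elim(1) by blast
        qed
        then have "0 < sum_sq B c" using sum_sq_nonneg[of B c] by linarith
        then show ?case using TV by (simp add: normT indicator_def)
      qed
    qed
    finally show ?thesis by (simp add: dim_eq_card_basis[OF ob contB])
  qed
  have mN [measurable]: "num_critical \<in> borel_measurable A"
  proof -
    have "(\<lambda>v. num_critical (T (co v))) \<in> borel_measurable A"
      using measurable_compose[OF mco meas] by (simp add: T_def)
    then show ?thesis using measurable_cong[of A num_critical] Tco spA by (metis (no_types, lifting))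
  qed
  have space_sphere: "space (sphere_area V) = l2_sphere V"
    by (auto simp: sphere_area_def space_scale_measure space_restrict_space L spA l2_sphere_def)
  let ?ball = "\<lambda>c. indicator {c. sum_sq B c \<le> 1} c :: ennreal"
  have area: "emeasure (sphere_area V) (l2_sphere V) = of_nat (card B) * (\<integral>\<^sup>+ c. ?ball c \<partial>leb_coords B)"
    using int[of "\<lambda>_. 1"] by (simp flip: space_sphere)
  have hom: "num_critical (T (\<lambda>b\<in>B. t * c b)) = num_critical (T c)" if "t > 0" for t c
  proof -
    have "T (\<lambda>b\<in>B. t * c b) = t *\<^sub>R T c"
      unfolding T_def scaleR_sum_right by (rule sum.cong) auto
    then show ?thesis using that by (simp add: num_critical_scale)
  qed
  have "(\<integral>\<^sup>+ v. num_critical v \<partial>sphere_area V) =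
      of_nat (card B) * (\<integral>\<^sup>+ c. num_critical (R (T c)) * ?ball c \<partial>leb_coords B)"
    by (rule int) measurable
  also have "(\<integral>\<^sup>+ c. num_critical (R (T c)) * ?ball c \<partial>leb_coords B) =
      (\<integral>\<^sup>+ c. num_critical (T c) * ?ball c \<partial>leb_coords B)"
  proof (rule nn_integral_cong)
    fix c
    show "num_critical (R (T c)) * ?ball c = num_critical (T c) * ?ball c"
    proof (cases "sum_sq B c = 0")
      case True
      then have "T c = 0" using finB by (simp add: sum_sq_def sum_nonneg_eq_0_iff T_def)
      then show ?thesis by (simp add: R_def)
    next
      case False
      then have "sum_sq B c > 0" using sum_sq_nonneg[of B c] by linarith
      then have "num_critical (T (\<lambda>b\<in>B. (1 / sqrt (sum_sq B c)) * c b)) = num_critical (T c)"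
        by (intro hom) simp
      then show ?thesis by (simp only: RT)
    qed
  qed
  finally have num: "(\<integral>\<^sup>+ v. num_critical v \<partial>sphere_area V) =
      of_nat (card B) * (\<integral>\<^sup>+ c. num_critical (T c) * ?ball c \<partial>leb_coords B)" .
  have meas': "(\<lambda>c. num_critical (T c)) \<in> borel_measurable (leb_coords B)"
    using meas by (simp add: T_def)
  note mean = gauss_mean_eq_ball_mean[OF finB meas' hom]
  have n: "(of_nat (card B) :: ennreal) \<noteq> 0" "(of_nat (card B) :: ennreal) \<noteq> \<infinity>"
  proof -
    have "card B \<noteq> 0" using ne finB by (simp only: card_eq_0_iff) simp
    then show "(of_nat (card B) :: ennreal) \<noteq> 0" "(of_nat (card B) :: ennreal) \<noteq> \<infinity>" by simp_all
  qed
  define a where "a = (\<integral>\<^sup>+ c. ?ball c \<partial>leb_coords B)"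
  define x where "x = (\<integral>\<^sup>+ c. num_critical (T c) * ?ball c \<partial>leb_coords B)"
  have "1 / (of_nat (card B) * a) * (of_nat (card B) * x) = x / a"
    using divide_mult_eq[OF n, of x a] by (simp add: divide_ennreal_def mult_ac)
  also have "x / a = (\<integral>\<^sup>+ c. ennreal (gauss_coords B c) * num_critical (T c) \<partial>leb_coords B)"
    unfolding a_def x_def by (rule mean[symmetric])
  finally show ?thesis
    unfolding num area a_def x_def T_def .
qed

section \<open>A Kac-Rice formula\<close>

text \<open>
  The increment of \<open>q\<close> tends to \<open>0\<close> and is multiplied by \<open>r x\<close>, which
  is of the order of the distance from \<open>x\<close> to \<open>a\<close>.
\<close>

lemma has_derivative_vanishing_scaleR:
  fixes q :: "'a::euclidean_space \<Rightarrow> 'b::real_normed_vector" and r :: "'a \<Rightarrow> real"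
  assumes q: "isCont q a" and r: "(r has_derivative r') (at a)" and r0: "r a = 0"
  shows "((\<lambda>x. r x *\<^sub>R q x) has_derivative (\<lambda>h. r' h *\<^sub>R q a)) (at a)"
proof -
  have bl: "bounded_linear r'" using r by (rule has_derivative_bounded_linear)
  have lim: "((\<lambda>y. (r y - r a - r' (y - a)) /\<^sub>R norm (y - a)) \<longlongrightarrow> 0) (at a)"
    using r by (simp add: has_derivative_def Lim_ident_at)
  have q0: "((\<lambda>y. q y - q a) \<longlongrightarrow> 0) (at a)"
    using q by (simp add: isCont_def LIM_zero_iff)
  have A: "((\<lambda>y. ((r y - r a - r' (y - a)) /\<^sub>R norm (y - a)) *\<^sub>R q y) \<longlongrightarrow> 0 *\<^sub>R q a) (at a)"
    using q by (intro tendsto_scaleR lim) (simp add: isCont_def)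
  have Bb: "((\<lambda>y. (r' (y - a) /\<^sub>R norm (y - a)) *\<^sub>R (q y - q a)) \<longlongrightarrow> 0) (at a)"
  proof (rule Lim_null_comparison)
    show "\<forall>\<^sub>F y in at a. norm ((r' (y - a) /\<^sub>R norm (y - a)) *\<^sub>R (q y - q a)) \<le> onorm r' * norm (q y - q a)"
    proof (rule always_eventually, rule allI)
      fix y
      have "norm (r' (y - a)) \<le> onorm r' * norm (y - a)" by (rule onorm[OF bl])
      then have "norm (r' (y - a) /\<^sub>R norm (y - a)) \<le> onorm r'"
        by (cases "y = a") (auto simp: divide_simps onorm_pos_le[OF bl])
      then show "norm ((r' (y - a) /\<^sub>R norm (y - a)) *\<^sub>R (q y - q a)) \<le> onorm r' * norm (q y - q a)"
        by (simp only: norm_scaleR real_norm_def) (rule mult_right_mono, auto)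
    qed
    show "((\<lambda>y. onorm r' * norm (q y - q a)) \<longlongrightarrow> 0) (at a)"
      by (rule tendsto_mult_right_zero[OF tendsto_norm_zero[OF q0]])
  qed
  have "((\<lambda>y. (r y *\<^sub>R q y - r a *\<^sub>R q a - r' (y - a) *\<^sub>R q a) /\<^sub>R norm (y - a)) \<longlongrightarrow> 0) (at a)"
  proof (rule Lim_transform_eventually)
    show "((\<lambda>y. ((r y - r a - r' (y - a)) /\<^sub>R norm (y - a)) *\<^sub>R q y +
        (r' (y - a) /\<^sub>R norm (y - a)) *\<^sub>R (q y - q a)) \<longlongrightarrow> 0) (at a)"
      using tendsto_add[OF A Bb] by simp
    show "\<forall>\<^sub>F y in at a. ((r y - r a - r' (y - a)) /\<^sub>R norm (y - a)) *\<^sub>R q y +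
        (r' (y - a) /\<^sub>R norm (y - a)) *\<^sub>R (q y - q a) =
        (r y *\<^sub>R q y - r a *\<^sub>R q a - r' (y - a) *\<^sub>R q a) /\<^sub>R norm (y - a)"
      by (simp add: r0 algebra_simps)
  qed
  moreover have "bounded_linear (\<lambda>h. r' h *\<^sub>R q a)"
    by (rule bounded_linear_scaleR_const[OF bl])
  ultimately show ?thesis by (simp add: has_derivative_def Lim_ident_at)
qed

lemma matrix_vector_mult_expand:
  fixes A :: "real^'n^'m"
  shows "A *v y = (\<Sum>j\<in>UNIV. y $ j *\<^sub>R (A *v axis j 1))"
  unfolding matrix_vector_mult_basis scalar_mult_eq_scaleR[symmetric] by (rule matrix_mult_sum)

lemma matrix_inv_mult_cramer:
  fixes A :: "real^'n^'n"
  assumes "det A \<noteq> 0"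
  shows "matrix_inv A *v b = (\<chi> k. det (\<chi> i j. if j = k then b $ i else A $ i $ j) / det A)"
proof -
  have "A *v (matrix_inv A *v b) = b"
    using assms by (simp add: matrix_vector_mul_assoc matrix_inv_invertible invertible_det_nz)
  then show ?thesis using cramer[OF assms] by blast
qed

lemma continuous_on_det:
  fixes K :: "'a::topological_space \<Rightarrow> real^'n^'n"
  assumes "\<And>i j. continuous_on U (\<lambda>x. K x $ i $ j)"
  shows "continuous_on U (\<lambda>x. det (K x))"
  unfolding det_def by (intro continuous_intros assms)

text \<open>
  By Cramer's rule.
\<close>

lemma continuous_on_matrix_inv_mult:
  fixes K :: "'a::topological_space \<Rightarrow> real^'n^'n" and y :: "'a \<Rightarrow> real^'n"
  assumes K: "continuous_on U K" and y: "continuous_on U y" and nz: "\<And>x. x \<in> U \<Longrightarrow> det (K x) \<noteq> 0"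
  shows "continuous_on U (\<lambda>x. matrix_inv (K x) *v y x)"
proof -
  have "continuous_on U (\<lambda>x. \<chi> k. det (\<chi> i j. if j = k then y x $ i else K x $ i $ j) / det (K x))"
  proof (intro continuous_on_vec_lambda continuous_on_divide continuous_on_det)
    fix k i j :: 'n
    show "continuous_on U (\<lambda>x. (\<chi> i j. if j = k then y x $ i else K x $ i $ j) $ i $ j)"
      by (cases "j = k") (auto intro!: continuous_intros K y)
    show "continuous_on U (\<lambda>x. K x $ i $ j)" by (intro continuous_intros K)
  qed (use nz in auto)
  then show ?thesis
    by (rule continuous_on_eq) (simp add: matrix_inv_mult_cramer nz)
qed

text \<open>
  With \<open>f\<close> for the solution, \<open>f x = f a + matrix_inv (K x) *v (y x - K x *v f a)\<close>.
  The residual vanishes at \<open>a\<close>, and so it is enough that the inverse of \<open>K\<close> is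
  continuous (\<open>has_derivative_vanishing_scaleR\<close>).
\<close>

lemma has_derivative_matrix_inv_mult:
  fixes K :: "real^'m \<Rightarrow> real^'n^'n" and y :: "real^'m \<Rightarrow> real^'n"
  assumes U: "open U" "a \<in> U" and nz: "\<And>x. x \<in> U \<Longrightarrow> det (K x) \<noteq> 0" and K: "continuous_on U K"
    and y: "(y has_derivative y') (at a)"
    and Kd: "\<And>z. ((\<lambda>x. K x *v z) has_derivative K' z) (at a)"
  shows "((\<lambda>x. matrix_inv (K x) *v y x) has_derivative
    (\<lambda>h. matrix_inv (K a) *v (y' h - K' (matrix_inv (K a) *v y a) h))) (at a)"
proof -
  define f where "f = (\<lambda>x. matrix_inv (K x) *v y x)"
  define r where "r = (\<lambda>x. y x - K x *v f a)"
  define r' where "r' = (\<lambda>h. y' h - K' (f a) h)"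
  have inv: "K x *v (matrix_inv (K x) *v z) = z" "matrix_inv (K x) *v (K x *v z) = z" if "x \<in> U" for x z
    using nz[OF that] by (simp_all add: matrix_vector_mul_assoc matrix_inv_invertible invertible_det_nz)
  have r: "(r has_derivative r') (at a)"
    unfolding r_def r'_def by (intro has_derivative_diff y Kd)
  have r0: "r a = 0" using inv(1)[OF U(2)] by (simp add: r_def f_def)
  have q: "isCont (\<lambda>x. matrix_inv (K x) *v axis j 1) a" for j
    using continuous_on_matrix_inv_mult[OF K continuous_on_const nz] U
    by (simp add: continuous_on_eq_continuous_at)
  have "((\<lambda>x. \<Sum>j\<in>UNIV. r x $ j *\<^sub>R (matrix_inv (K x) *v axis j 1)) has_derivative
      (\<lambda>h. \<Sum>j\<in>UNIV. r' h $ j *\<^sub>R (matrix_inv (K a) *v axis j 1))) (at a)"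
    by (intro has_derivative_sum has_derivative_vanishing_scaleR q
        bounded_linear.has_derivative[OF bounded_linear_vec_nth r]) (simp add: r0)
  then have "((\<lambda>x. f a + matrix_inv (K x) *v r x) has_derivative (\<lambda>h. matrix_inv (K a) *v r' h)) (at a)"
    by (auto intro!: derivative_eq_intros simp flip: matrix_vector_mult_expand)
  then have "(f has_derivative (\<lambda>h. matrix_inv (K a) *v r' h)) (at a)"
  proof (rule has_derivative_transform_within_open[OF _ U])
    fix x assume "x \<in> U"
    then show "f a + matrix_inv (K x) *v r x = f x"
      using inv by (simp add: r_def f_def matrix_vector_mult_diff_distrib)
  qed
  then show ?thesis by (simp add: f_def r'_def)
qed

lemma matrix_sum_vector_mult:
  fixes A :: "'b \<Rightarrow> real^'n^'m"
  shows "(\<Sum>b\<in>B. x b *\<^sub>R A b) *v h = (\<Sum>b\<in>B. x b *\<^sub>R (A b *v h))"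
  by (induction B rule: infinite_finite_induct)
     (auto simp: matrix_vector_mult_add_rdistrib scaleR_matrix_vector_assoc)

text \<open>
  A Gaussian gradient field \<open>\<Sum>b\<in>B. c b *\<^sub>R G b \<theta>\<close> on
  \<open>\<real>\<^sup>L\<close> with Hessian \<open>\<Sum>b\<in>B. c b *\<^sub>R H b \<theta>\<close>, whose
  covariance at each point is \<open>S\<close> times the identity, and which is at each point uncorrelated
  with the Hessian there.
\<close>

locale gauss_field =
  fixes B :: "'b set" and G :: "'b \<Rightarrow> real^'n \<Rightarrow> real^'n" and H :: "'b \<Rightarrow> real^'n \<Rightarrow> real^'n^'n" and S :: real
  assumes finB: "finite B"
    and derG: "\<And>b \<theta>. b \<in> B \<Longrightarrow> (G b has_derivative (*v) (H b \<theta>)) (at \<theta>)"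
    and contH: "\<And>b. b \<in> B \<Longrightarrow> continuous_on UNIV (H b)"
    and S_pos: "0 < S"
    and iso: "\<And>\<tau> j k. (\<Sum>b\<in>B. G b \<tau> $ j * G b \<tau> $ k) = (if j = k then S else 0)"
    and orth: "\<And>\<tau> i j k. (\<Sum>b\<in>B. G b \<tau> $ k * H b \<tau> $ i $ j) = 0"
begin

text \<open>
  For a base point \<open>\<tau>\<close> the coefficients are translated by \<open>- z \<bullet> u b
  \<tau>\<close>. This subtracts \<open>K \<tau> \<theta> *v z\<close> from the gradient at
  \<open>\<theta>\<close> (\<open>grad_shift\<close>), where \<open>\<surd>S K \<tau> \<theta>\<close> is the
  covariance of the gradients at \<open>\<theta>\<close> and at \<open>\<tau>\<close>. The translated gradient
  vanishes at \<open>\<theta>\<close> exactly if \<open>z = g c \<tau> \<theta>\<close>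
  (\<open>zero_iff_g\<close>), and the derivative of \<open>g c \<tau>\<close> is \<open>M c \<tau>\<close> up
  to the inverse of \<open>K \<tau>\<close> (\<open>der_g\<close>); \<open>gb\<close> and \<open>Mb\<close>
  are the contributions of a single \<open>b\<close>. In \<open>dens\<close> the Jacobian of \<open>g c
  \<tau>\<close> multiplies the weight of \<open>z = g c \<tau> \<theta>\<close> and the Gaussian density of
  the translated coefficients.
\<close>

definition grad where "grad c \<theta> = (\<Sum>b\<in>B. c b *\<^sub>R G b \<theta>)"
definition hess where "hess c \<theta> = (\<Sum>b\<in>B. c b *\<^sub>R H b \<theta>)"
definition u where "u b \<tau> = (1 / sqrt S) *\<^sub>R G b \<tau>"
definition K :: "real^'n \<Rightarrow> real^'n \<Rightarrow> real^'n^'n"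
  where "K \<tau> \<theta> = (\<chi> j k. \<Sum>b\<in>B. G b \<theta> $ j * u b \<tau> $ k)"
definition gb where "gb b \<tau> \<theta> = matrix_inv (K \<tau> \<theta>) *v G b \<theta>"
definition g where "g c \<tau> \<theta> = (\<Sum>b\<in>B. c b *\<^sub>R gb b \<tau> \<theta>)"
definition Mb where "Mb b \<tau> \<theta> = H b \<theta> - (\<Sum>b'\<in>B. (u b' \<tau> \<bullet> gb b \<tau> \<theta>) *\<^sub>R H b' \<theta>)"
definition M where "M c \<tau> \<theta> = (\<Sum>b\<in>B. c b *\<^sub>R Mb b \<tau> \<theta>)"
definition dens where "dens c \<tau> \<theta> = \<bar>det (M c \<tau> \<theta>)\<bar> / \<bar>det (K \<tau> \<theta>)\<bar> *
  (std_gauss_vec (g c \<tau> \<theta>) * gauss_coords B (\<lambda>b. c b + (- g c \<tau> \<theta>) \<bullet> u b \<tau>))"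

lemma contG: "b \<in> B \<Longrightarrow> continuous_on UNIV (G b)"
  using derG by (intro has_derivative_continuous_on) (auto intro: has_derivative_at_withinI)

lemma u_iso: "(\<Sum>b\<in>B. u b \<tau> $ j * u b \<tau> $ k) = (if j = k then 1 else 0)"
proof -
  have "(\<Sum>b\<in>B. u b \<tau> $ j * u b \<tau> $ k) = (\<Sum>b\<in>B. G b \<tau> $ j * G b \<tau> $ k) / S"
    using S_pos by (simp add: u_def sum_divide_distrib)
  then show ?thesis using S_pos by (simp add: iso)
qed

lemma K_mult: "K \<tau> \<theta> *v z = (\<Sum>b\<in>B. (u b \<tau> \<bullet> z) *\<^sub>R G b \<theta>)"
proof -
  have "(\<Sum>k\<in>UNIV. (\<Sum>b\<in>B. G b \<theta> $ i * u b \<tau> $ k) * z $ k) =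
      (\<Sum>b\<in>B. (\<Sum>k\<in>UNIV. u b \<tau> $ k * z $ k) * G b \<theta> $ i)" for i
    unfolding sum_distrib_right by (subst sum.swap) (simp add: mult_ac)
  then show ?thesis
    by (simp add: vec_eq_iff K_def matrix_vector_mult_def inner_vec_def)
qed

lemma grad_shift: "grad (\<lambda>b\<in>B. c b + (- z) \<bullet> u b \<tau>) \<theta> = grad c \<theta> - K \<tau> \<theta> *v z"
  by (simp add: grad_def K_mult scaleR_left_diff_distrib sum_subtractf inner_commute)

lemma K_inv: "det (K \<tau> \<theta>) \<noteq> 0 \<Longrightarrow> K \<tau> \<theta> *v z = y \<longleftrightarrow> z = matrix_inv (K \<tau> \<theta>) *v y"
  by (auto simp: matrix_vector_mul_assoc matrix_inv_invertible invertible_det_nz)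

lemma g_eq: "g c \<tau> \<theta> = matrix_inv (K \<tau> \<theta>) *v grad c \<theta>"
  unfolding g_def gb_def grad_def
  by (simp add: linear_sum[OF matrix_vector_mul_linear] linear_scale[OF matrix_vector_mul_linear])

lemma zero_iff_g: "det (K \<tau> \<theta>) \<noteq> 0 \<Longrightarrow> grad (\<lambda>b\<in>B. c b + (- z) \<bullet> u b \<tau>) \<theta> = 0 \<longleftrightarrow> g c \<tau> \<theta> = z"
  using K_inv[of \<tau> \<theta> z "grad c \<theta>"] unfolding grad_shift g_eq by auto

lemma open_det_K: "open {\<theta>. det (K \<tau> \<theta>) \<noteq> 0}"
  and cont_K: "continuous_on UNIV (K \<tau>)"
  and cont_K2: "continuous_on UNIV (\<lambda>p. K (fst p) (snd p))"
proof -
  show 2: "continuous_on UNIV (\<lambda>p. K (fst p) (snd p))"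
    unfolding K_def u_def
    by (intro continuous_on_vec_lambda continuous_intros continuous_on_compose2[OF contG]) auto
  have "continuous_on UNIV (\<lambda>\<theta>. K (fst (\<tau>, \<theta>)) (snd (\<tau>, \<theta>)))"
    by (rule continuous_on_compose2[OF 2]) (auto intro!: continuous_intros)
  then show 1: "continuous_on UNIV (K \<tau>)" by simp
  have "continuous_on UNIV (\<lambda>\<theta>. det (K \<tau> \<theta>))"
    by (intro continuous_on_det continuous_intros 1)
  then show "open {\<theta>. det (K \<tau> \<theta>) \<noteq> 0}"
    by (intro open_Collect_neq) auto
qed

lemma cont_gb: "b \<in> B \<Longrightarrow> continuous_on {p. det (K (fst p) (snd p)) \<noteq> 0} (\<lambda>p. gb b (fst p) (snd p))"
  unfolding gb_def
  by (intro continuous_on_matrix_inv_mult continuous_on_subset[OF cont_K2]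
      continuous_on_compose2[OF contG] continuous_intros) auto

lemma cont_Mb: "b \<in> B \<Longrightarrow> continuous_on {p. det (K (fst p) (snd p)) \<noteq> 0} (\<lambda>p. Mb b (fst p) (snd p))"
  unfolding Mb_def u_def
  by (intro continuous_intros cont_gb continuous_on_compose2[OF contG] continuous_on_compose2[OF contH]) auto

lemma cont_section:
  assumes "continuous_on {p. det (K (fst p) (snd p)) \<noteq> 0} (\<lambda>p. f (fst p) (snd p))"
  shows "continuous_on {\<theta>. det (K \<tau> \<theta>) \<noteq> 0} (f \<tau>)"
proof -
  have "continuous_on {\<theta>. det (K \<tau> \<theta>) \<noteq> 0} (\<lambda>\<theta>. f (fst (\<tau>, \<theta>)) (snd (\<tau>, \<theta>)))"
    by (rule continuous_on_compose2[OF assms]) (auto intro!: continuous_intros)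
  then show ?thesis by simp
qed

lemma der_g:
  assumes nz: "det (K \<tau> \<theta>) \<noteq> 0"
  shows "(g c \<tau> has_derivative (*v) (matrix_inv (K \<tau> \<theta>) ** M c \<tau> \<theta>)) (at \<theta>)"
proof -
  have gb: "(gb b \<tau> has_derivative (*v) (matrix_inv (K \<tau> \<theta>) ** Mb b \<tau> \<theta>)) (at \<theta>)" if b: "b \<in> B" for b
  proof -
    have "((\<lambda>x. K \<tau> x *v z) has_derivative (\<lambda>h. \<Sum>b'\<in>B. (u b' \<tau> \<bullet> z) *\<^sub>R (H b' \<theta> *v h))) (at \<theta>)" for z
      unfolding K_mult by (intro has_derivative_sum has_derivative_scaleR_right derG)
    then have Kd: "((\<lambda>x. K \<tau> x *v z) has_derivative (\<lambda>h. \<Sum>b'\<in>B. (u b' \<tau> \<bullet> z) *\<^sub>R (H b' \<theta> *v h))) (at \<theta>)" for z .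
    have "((\<lambda>x. matrix_inv (K \<tau> x) *v G b x) has_derivative (\<lambda>h. matrix_inv (K \<tau> \<theta>) *v (H b \<theta> *v h -
        (\<Sum>b'\<in>B. (u b' \<tau> \<bullet> (matrix_inv (K \<tau> \<theta>) *v G b \<theta>)) *\<^sub>R (H b' \<theta> *v h))))) (at \<theta>)"
      by (rule has_derivative_matrix_inv_mult[OF open_det_K[of \<tau>] _ _ continuous_on_subset[OF cont_K] derG[OF b] Kd])
         (use nz in auto)
    then have "(gb b \<tau> has_derivative (\<lambda>h. matrix_inv (K \<tau> \<theta>) *v (H b \<theta> *v h -
        (\<Sum>b'\<in>B. (u b' \<tau> \<bullet> gb b \<tau> \<theta>) *\<^sub>R (H b' \<theta> *v h))))) (at \<theta>)"
      unfolding gb_def .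
    moreover have "H b \<theta> *v h - (\<Sum>b'\<in>B. (u b' \<tau> \<bullet> gb b \<tau> \<theta>) *\<^sub>R (H b' \<theta> *v h)) = Mb b \<tau> \<theta> *v h" for h
      by (simp add: Mb_def matrix_vector_mult_diff_rdistrib matrix_sum_vector_mult)
    ultimately show ?thesis by (simp only: matrix_vector_mul_assoc)
  qed
  have "(\<lambda>h. \<Sum>b\<in>B. c b *\<^sub>R ((matrix_inv (K \<tau> \<theta>) ** Mb b \<tau> \<theta>) *v h)) = (*v) (matrix_inv (K \<tau> \<theta>) ** M c \<tau> \<theta>)"
  proof
    fix h
    have "M c \<tau> \<theta> *v h = (\<Sum>b\<in>B. c b *\<^sub>R (Mb b \<tau> \<theta> *v h))"
      unfolding M_def by (rule matrix_sum_vector_mult)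
    then show "(\<Sum>b\<in>B. c b *\<^sub>R ((matrix_inv (K \<tau> \<theta>) ** Mb b \<tau> \<theta>) *v h)) = (matrix_inv (K \<tau> \<theta>) ** M c \<tau> \<theta>) *v h"
      by (simp add: linear_sum[OF matrix_vector_mul_linear] linear_scale[OF matrix_vector_mul_linear]
          flip: matrix_vector_mul_assoc)
  qed
  moreover have "(g c \<tau> has_derivative (\<lambda>h. \<Sum>b\<in>B. c b *\<^sub>R ((matrix_inv (K \<tau> \<theta>) ** Mb b \<tau> \<theta>) *v h))) (at \<theta>)"
    unfolding g_def by (intro has_derivative_sum has_derivative_scaleR_right gb)
  ultimately show ?thesis by simp
qed

lemma det_der_g:
  assumes nz: "det (K \<tau> \<theta>) \<noteq> 0"
  shows "\<bar>det (matrix ((*v) (matrix_inv (K \<tau> \<theta>) ** M c \<tau> \<theta>)))\<bar> = \<bar>det (M c \<tau> \<theta>)\<bar> / \<bar>det (K \<tau> \<theta>)\<bar>"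
proof -
  have "det (K \<tau> \<theta>) * det (matrix_inv (K \<tau> \<theta>)) = 1"
    using nz by (simp add: det_mul[symmetric] matrix_inv_invertible invertible_det_nz)
  then have "det (matrix_inv (K \<tau> \<theta>)) = 1 / det (K \<tau> \<theta>)"
    using nz by (simp add: field_simps)
  then show ?thesis by (simp add: det_mul abs_mult)
qed

lemma measurable_shift: "(\<lambda>z. \<lambda>b\<in>B. c b + (- z) \<bullet> u b \<tau>) \<in> borel \<rightarrow>\<^sub>M leb_coords B"
  by (rule measurable_into_leb_coords) measurable

lemma cont_grad: "continuous_on UNIV (grad c)"
  unfolding grad_def using contG by (intro continuous_intros) auto

lemma borel_grad: "(\<lambda>c. grad c \<theta>) \<in> borel_measurable (leb_coords B)"
  unfolding grad_def by measurable

text \<open>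
  Outside \<open>Q\<close> the matrix \<open>K\<close> may be singular, and \<open>dens\<close> need not be
  continuous; hence the cut-offs \<open>g'\<close> and \<open>M'\<close>.
\<close>

lemma measurable_dens:
  assumes Q [measurable]: "Q \<in> sets borel" and nz: "Q \<subseteq> {\<theta>. det (K \<tau> \<theta>) \<noteq> 0}"
  shows "(\<lambda>(c, \<theta>). indicator Q \<theta> * dens c \<tau> \<theta>) \<in> borel_measurable (leb_coords B \<Otimes>\<^sub>M borel)"
proof -
  let ?N = "leb_coords B \<Otimes>\<^sub>M (borel :: (real^'n) measure)"
  have gQ: "(\<lambda>\<theta>. indicator Q \<theta> *\<^sub>R gb b \<tau> \<theta>) \<in> borel_measurable borel"
    and MQ: "(\<lambda>\<theta>. indicator Q \<theta> *\<^sub>R Mb b \<tau> \<theta>) \<in> borel_measurable borel" if "b \<in> B" for b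
    using borel_measurable_continuous_on_indicator[OF Q continuous_on_subset[OF cont_section[OF cont_gb[OF that]] nz]]
      borel_measurable_continuous_on_indicator[OF Q continuous_on_subset[OF cont_section[OF cont_Mb[OF that]] nz]]
    by auto
  have c: "(\<lambda>p. fst p b) \<in> borel_measurable ?N" if "b \<in> B" for b
    by (rule measurable_compose[OF measurable_fst measurable_coord[OF that]])
  define g' where "g' = (\<lambda>p. \<Sum>b\<in>B. fst p b *\<^sub>R (indicator Q (snd p) *\<^sub>R gb b \<tau> (snd p)))"
  define M' where "M' = (\<lambda>p. \<Sum>b\<in>B. fst p b *\<^sub>R (indicator Q (snd p) *\<^sub>R Mb b \<tau> (snd p)))"
  have g' [measurable]: "g' \<in> borel_measurable ?N" unfolding g'_def
    by (intro borel_measurable_sum borel_measurable_scaleR c measurable_compose[OF measurable_snd gQ])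
  have "M' \<in> borel_measurable ?N" unfolding M'_def
    by (intro borel_measurable_sum borel_measurable_scaleR c measurable_compose[OF measurable_snd MQ])
  then have [measurable]: "(\<lambda>p. det (M' p)) \<in> borel_measurable ?N"
    by (rule measurable_compose) (intro borel_measurable_continuous_onI continuous_on_det continuous_intros)
  have "(\<lambda>\<theta>. det (K \<tau> \<theta>)) \<in> borel_measurable borel"
    by (intro borel_measurable_continuous_onI continuous_on_det continuous_intros cont_K)
  then have [measurable]: "(\<lambda>p. det (K \<tau> (snd p))) \<in> borel_measurable ?N"
    by (rule measurable_compose[OF measurable_snd])
  have [measurable]: "(\<lambda>p. gauss_coords B (\<lambda>b. fst p b + (- g' p) \<bullet> u b \<tau>)) \<in> borel_measurable ?N"
    unfolding gauss_coords_def
  proof (rule borel_measurable_prod)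
    fix b assume b: "b \<in> B"
    have [measurable]: "(\<lambda>p. fst p b) \<in> borel_measurable ?N" by (rule c[OF b])
    show "(\<lambda>p. std_normal_density (fst p b + (- g' p) \<bullet> u b \<tau>)) \<in> borel_measurable ?N"
      by measurable
  qed
  have "(\<lambda>p. indicator Q (snd p) * (\<bar>det (M' p)\<bar> / \<bar>det (K \<tau> (snd p))\<bar> *
      (std_gauss_vec (g' p) * gauss_coords B (\<lambda>b. fst p b + (- g' p) \<bullet> u b \<tau>)))) \<in> borel_measurable ?N"
    by measurable
  also have "(\<lambda>p. indicator Q (snd p) * (\<bar>det (M' p)\<bar> / \<bar>det (K \<tau> (snd p))\<bar> *
      (std_gauss_vec (g' p) * gauss_coords B (\<lambda>b. fst p b + (- g' p) \<bullet> u b \<tau>)))) =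
      (\<lambda>(c, \<theta>). indicator Q \<theta> * dens c \<tau> \<theta>)"
  proof (rule ext, clarify)
    fix c \<theta>
    show "indicator Q (snd (c, \<theta>)) * (\<bar>det (M' (c, \<theta>))\<bar> / \<bar>det (K \<tau> (snd (c, \<theta>)))\<bar> *
      (std_gauss_vec (g' (c, \<theta>)) * gauss_coords B (\<lambda>b. fst (c, \<theta>) b + (- g' (c, \<theta>)) \<bullet> u b \<tau>))) =
      indicator Q \<theta> * dens c \<tau> \<theta>"
    proof (cases "\<theta> \<in> Q")
      case True
      then have "g' (c, \<theta>) = g c \<tau> \<theta>" "M' (c, \<theta>) = M c \<tau> \<theta>"
        by (simp_all add: g'_def M'_def g_def M_def)
      then show ?thesis by (simp add: dens_def)
    qed simp
  qed
  finally show ?thesis .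
qed

text \<open>
  For each \<open>c\<close> the mean over \<open>z\<close> of the number of zeros of the translated gradient
  counts the preimages of \<open>z\<close> under \<open>g c \<tau>\<close>, with weight \<open>k\<close>; the
  area formula applies.
\<close>

lemma expected_zeros_local:
  assumes Kn: "\<And>n :: nat. compact (Kn n)" "incseq Kn"
    and nz: "(\<Union>n. Kn n) \<subseteq> {\<theta>. det (K \<tau> \<theta>) \<noteq> 0}"
  defines "Q \<equiv> \<Union>n. Kn n"
  shows "(\<integral>\<^sup>+ c. ennreal (gauss_coords B c) * num_elems {\<theta> \<in> Q. grad c \<theta> = 0} \<partial>leb_coords B) =
    (\<integral>\<^sup>+ \<theta>. indicator Q \<theta> * (\<integral>\<^sup>+ c. ennreal (dens c \<tau> \<theta>) \<partial>leb_coords B) \<partial>lborel)"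
proof -
  interpret leb: sigma_finite_measure "leb_coords B" by (rule sigma_finite_leb_coords[OF finB])
  interpret pair_sigma_finite "leb_coords B" "lborel :: (real^'n) measure" ..
  have Q [measurable]: "Q \<in> sets borel"
    unfolding Q_def using Kn(1) by (intro sets.countable_UN) (auto intro: borel_compact)
  have QU: "Q \<subseteq> {\<theta>. det (K \<tau> \<theta>) \<noteq> 0}" using nz by (simp add: Q_def)
  define N where "N = (\<lambda>c. num_elems {\<theta> \<in> Q. grad c \<theta> = 0})"
  have mN [measurable]: "N \<in> borel_measurable (leb_coords B)"
    unfolding N_def Q_def by (rule borel_measurable_num_zeros[OF Kn]) (auto intro: cont_grad borel_grad)
  let ?sh = "\<lambda>c z. \<lambda>b\<in>B. c b + (- z) \<bullet> u b \<tau>"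
  note md = measurable_dens[OF Q QU]
  have mde: "(\<lambda>(c, \<theta>). ennreal (indicator Q \<theta> * dens c \<tau> \<theta>)) \<in> borel_measurable (leb_coords B \<Otimes>\<^sub>M lborel)"
    using measurable_compose[OF md measurable_ennreal] by (simp add: split_beta cong: measurable_cong_sets)
  have "(\<integral>\<^sup>+ c. ennreal (gauss_coords B c) * N c \<partial>leb_coords B) =
      (\<integral>\<^sup>+ c. (\<integral>\<^sup>+ z. ennreal (std_gauss_vec z) * (ennreal (gauss_coords B (?sh c z)) * N (?sh c z)) \<partial>lborel) \<partial>leb_coords B)"
    by (rule nn_integral_leb_average_translates[OF finB, of "\<lambda>z b. (- z) \<bullet> u b \<tau>"])
       (auto simp: std_gauss_vec_total)
  also have "\<dots> = (\<integral>\<^sup>+ c. (\<integral>\<^sup>+ \<theta>. ennreal (indicator Q \<theta> * dens c \<tau> \<theta>) \<partial>lborel) \<partial>leb_coords B)"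
  proof (rule nn_integral_cong)
    fix c assume c: "c \<in> space (leb_coords B)"
    define k where "k = (\<lambda>z. ennreal (std_gauss_vec z) * ennreal (gauss_coords B (?sh c z)))"
    let ?f' = "\<lambda>\<theta>. (*v) (matrix_inv (K \<tau> \<theta>) ** M c \<tau> \<theta>)"
    note [measurable] = measurable_shift[of c \<tau>]
    have count: "N (?sh c z) = num_elems {\<theta> \<in> Q. g c \<tau> \<theta> = z}" for z
    proof -
      have "{\<theta> \<in> Q. grad (?sh c z) \<theta> = 0} = {\<theta> \<in> Q. g c \<tau> \<theta> = z}"
        using zero_iff_g[of \<tau> _ c z] QU by auto
      then show ?thesis by (simp only: N_def)
    qed
    have dens: "ennreal (indicator Q \<theta> * \<bar>det (matrix (?f' \<theta>))\<bar>) * k (g c \<tau> \<theta>) =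
        ennreal (indicator Q \<theta> * dens c \<tau> \<theta>)" for \<theta>
    proof (cases "\<theta> \<in> Q")
      case True
      then have 1: "\<bar>det (matrix (?f' \<theta>))\<bar> = \<bar>det (M c \<tau> \<theta>)\<bar> / \<bar>det (K \<tau> \<theta>)\<bar>"
        using QU by (intro det_der_g) auto
      have 2: "gauss_coords B (?sh c z) = gauss_coords B (\<lambda>b. c b + (- z) \<bullet> u b \<tau>)" for z
        by (simp add: gauss_coords_def)
      have 3: "ennreal d * (ennreal s * ennreal q) = ennreal (d * (s * q))" if "0 \<le> d" "0 \<le> s" "0 \<le> q" for d s q
        using that by (simp add: ennreal_mult)
      have 4: "indicator Q \<theta> = (1 :: real)" using True by simp
      show ?thesis
        unfolding k_def dens_def 1 2 4 mult_1 by (rule 3) auto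
    qed simp
    have "(\<integral>\<^sup>+ z. ennreal (std_gauss_vec z) * (ennreal (gauss_coords B (?sh c z)) * N (?sh c z)) \<partial>lborel) =
        (\<integral>\<^sup>+ z. num_elems {\<theta> \<in> Q. g c \<tau> \<theta> = z} * k z \<partial>lborel)"
      by (simp only: count k_def mult_ac)
    also have "\<dots> = (\<integral>\<^sup>+ \<theta>. ennreal (indicator Q \<theta> * \<bar>det (matrix (?f' \<theta>))\<bar>) * k (g c \<tau> \<theta>) \<partial>lborel)"
    proof (rule area_formula[OF open_det_K _ _ Q QU])
      show "(g c \<tau> has_derivative ?f' \<theta>) (at \<theta>)" if "\<theta> \<in> {\<theta>. det (K \<tau> \<theta>) \<noteq> 0}" for \<theta>
        using that by (intro der_g) simp
      show "continuous_on {\<theta>. det (K \<tau> \<theta>) \<noteq> 0} (\<lambda>\<theta>. ?f' \<theta> (axis j 1))" for j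
        unfolding matrix_vector_mul_assoc[symmetric] M_def matrix_sum_vector_mult
      proof (rule continuous_on_matrix_inv_mult)
        show "continuous_on {\<theta>. det (K \<tau> \<theta>) \<noteq> 0} (\<lambda>\<theta>. \<Sum>b\<in>B. c b *\<^sub>R (Mb b \<tau> \<theta> *v axis j 1))"
          unfolding matrix_vector_mult_basis column_def
          by (intro continuous_intros continuous_on_vec_lambda cont_section[OF cont_Mb])
      qed (auto intro: continuous_on_subset[OF cont_K])
      have "(\<lambda>z. N (?sh c z)) \<in> borel_measurable borel" by measurable
      then show "(\<lambda>z. num_elems {\<theta> \<in> Q. g c \<tau> \<theta> = z}) \<in> borel_measurable borel"
        by (simp only: count)
      show "k \<in> borel_measurable borel" unfolding k_def by measurable
      show "(\<lambda>\<theta>. ennreal (indicator Q \<theta> * \<bar>det (matrix (?f' \<theta>))\<bar>) * k (g c \<tau> \<theta>)) \<in> borel_measurable borel"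
        unfolding dens using measurable_Pair2[OF mde c] by simp
    qed
    also have "\<dots> = (\<integral>\<^sup>+ \<theta>. ennreal (indicator Q \<theta> * dens c \<tau> \<theta>) \<partial>lborel)"
      by (simp only: dens)
    finally show "(\<integral>\<^sup>+ z. ennreal (std_gauss_vec z) * (ennreal (gauss_coords B (?sh c z)) * N (?sh c z)) \<partial>lborel) =
        (\<integral>\<^sup>+ \<theta>. ennreal (indicator Q \<theta> * dens c \<tau> \<theta>) \<partial>lborel)" .
  qed
  also have "\<dots> = (\<integral>\<^sup>+ \<theta>. (\<integral>\<^sup>+ c. ennreal (indicator Q \<theta> * dens c \<tau> \<theta>) \<partial>leb_coords B) \<partial>lborel)"
    by (rule Fubini'[OF mde, symmetric])
  also have "\<dots> = (\<integral>\<^sup>+ \<theta>. indicator Q \<theta> * (\<integral>\<^sup>+ c. ennreal (dens c \<tau> \<theta>) \<partial>leb_coords B) \<partial>lborel)"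
    by (intro nn_integral_cong) (auto simp: indicator_def)
  finally show ?thesis by (simp only: N_def)
qed

end

lemma abs_det_le:
  fixes A :: "real^'n^'n"
  assumes "\<And>i j. \<bar>A $ i $ j\<bar> \<le> m"
  shows "\<bar>det A\<bar> \<le> fact CARD('n) * m ^ CARD('n)"
proof -
  have "\<bar>det A\<bar> \<le> (\<Sum>p\<in>{p. p permutes (UNIV :: 'n set)}. \<bar>of_int (sign p) * (\<Prod>i\<in>UNIV. A $ i $ p i)\<bar>)"
    unfolding det_def by (rule sum_abs)
  also have "\<dots> \<le> (\<Sum>p\<in>{p. p permutes (UNIV :: 'n set)}. m ^ CARD('n))"
  proof (rule sum_mono)
    fix p :: "'n \<Rightarrow> 'n"
    have "\<bar>of_int (sign p) * (\<Prod>i\<in>UNIV. A $ i $ p i)\<bar> = (\<Prod>i\<in>UNIV. \<bar>A $ i $ p i\<bar>)"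
      by (simp add: abs_mult abs_prod sign_def)
    also have "\<dots> \<le> (\<Prod>i\<in>(UNIV :: 'n set). m)"
      by (rule prod_mono) (use assms in auto)
    finally show "\<bar>of_int (sign p) * (\<Prod>i\<in>UNIV. A $ i $ p i)\<bar> \<le> m ^ CARD('n)" by simp
  qed
  also have "\<dots> = fact CARD('n) * m ^ CARD('n)"
    using card_permutations[of "UNIV :: 'n set" "CARD('n)"] by simp
  finally show ?thesis .
qed

text \<open>
  The constant is crude, but an exponential bound in \<open>y\<close> factors over coordinates if
  \<open>y\<close> is a sum.
\<close>

lemma power_le_exp:
  fixes y :: real
  assumes "0 \<le> y" "0 < n"
  shows "y ^ n \<le> real n ^ n * exp y"
proof -
  have "y / n \<le> exp (y / n)" using exp_ge_add_one_self[of "y / n"] by linarith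
  then have "(y / n) ^ n \<le> exp (y / n) ^ n" using assms by (intro power_mono) auto
  also have "\<dots> = exp y" using assms by (simp flip: exp_of_nat_mult)
  finally show ?thesis using assms by (simp add: power_divide field_simps)
qed

lemma abs_det_comb_le:
  fixes A :: "'b \<Rightarrow> real^'n^'n"
  assumes "\<And>b i j. b \<in> B \<Longrightarrow> \<bar>A b $ i $ j\<bar> \<le> L" "0 \<le> L"
  shows "\<bar>det (\<Sum>b\<in>B. c b *\<^sub>R A b)\<bar> \<le> fact CARD('n) * real CARD('n) ^ CARD('n) * exp (L * (\<Sum>b\<in>B. \<bar>c b\<bar>))"
proof -
  have "\<bar>det (\<Sum>b\<in>B. c b *\<^sub>R A b)\<bar> \<le> fact CARD('n) * (L * (\<Sum>b\<in>B. \<bar>c b\<bar>)) ^ CARD('n)"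
  proof (rule abs_det_le)
    fix i j
    have "\<bar>(\<Sum>b\<in>B. c b *\<^sub>R A b) $ i $ j\<bar> \<le> (\<Sum>b\<in>B. \<bar>c b * A b $ i $ j\<bar>)"
      by (simp add: sum_abs)
    also have "\<dots> \<le> (\<Sum>b\<in>B. L * \<bar>c b\<bar>)"
    proof (rule sum_mono)
      fix b assume "b \<in> B"
      from mult_right_mono[OF assms(1)[OF this, of i j] abs_ge_zero[of "c b"]]
      show "\<bar>c b * A b $ i $ j\<bar> \<le> L * \<bar>c b\<bar>" by (simp add: abs_mult mult.commute)
    qed
    finally show "\<bar>(\<Sum>b\<in>B. c b *\<^sub>R A b) $ i $ j\<bar> \<le> L * (\<Sum>b\<in>B. \<bar>c b\<bar>)"
      by (simp add: sum_distrib_left)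
  qed
  also have "\<dots> \<le> fact CARD('n) * (real CARD('n) ^ CARD('n) * exp (L * (\<Sum>b\<in>B. \<bar>c b\<bar>)))"
    using assms(2) by (intro mult_left_mono power_le_exp mult_nonneg_nonneg sum_nonneg) auto
  finally show ?thesis by (simp add: mult.assoc)
qed

lemma half_open_box_eq_UN:
  fixes a b :: "real^'n"
  shows "(\<Union>n :: nat. cbox a (\<chi> j. b $ j - 1 / real (Suc n))) = {\<theta>. \<forall>j. a $ j \<le> \<theta> $ j \<and> \<theta> $ j < b $ j}"
    and "incseq (\<lambda>n :: nat. cbox a (\<chi> j. b $ j - 1 / real (Suc n)))"
proof (rule antisym)
  show "(\<Union>n :: nat. cbox a (\<chi> j. b $ j - 1 / real (Suc n))) \<subseteq> {\<theta>. \<forall>j. a $ j \<le> \<theta> $ j \<and> \<theta> $ j < b $ j}"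
  proof clarsimp
    fix x j and n :: nat assume "x \<in> cbox a (\<chi> j. b $ j - 1 / (1 + real n))"
    then have "a $ j \<le> x $ j" "x $ j \<le> b $ j - 1 / (1 + real n)" by (auto simp: mem_box_cart)
    moreover have "0 < 1 / (1 + real n)" by simp
    ultimately show "a $ j \<le> x $ j \<and> x $ j < b $ j" by linarith
  qed
  show "{\<theta>. \<forall>j. a $ j \<le> \<theta> $ j \<and> \<theta> $ j < b $ j} \<subseteq> (\<Union>n :: nat. cbox a (\<chi> j. b $ j - 1 / real (Suc n)))"
  proof clarify
    fix x assume x: "\<forall>j. a $ j \<le> x $ j \<and> x $ j < b $ j"
    have "\<forall>\<^sub>F n in sequentially. \<forall>j. 1 / real (Suc n) < b $ j - x $ j"
    proof (rule eventually_all_finite)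
      fix j
      have "((\<lambda>n. 1 / real (Suc n)) \<longlonglongrightarrow> 0)" by (rule LIMSEQ_inverse_real_of_nat[unfolded inverse_eq_divide])
      then show "\<forall>\<^sub>F n in sequentially. 1 / real (Suc n) < b $ j - x $ j"
        by (rule order_tendstoD) (use x in simp)
    qed
    then obtain n where n: "\<And>j. 1 / real (Suc n) < b $ j - x $ j"
      by (auto simp: eventually_sequentially)
    have "x \<in> cbox a (\<chi> j. b $ j - 1 / real (Suc n))"
      unfolding mem_box_cart using x n by (auto simp: less_imp_le algebra_simps)
    then show "x \<in> (\<Union>n :: nat. cbox a (\<chi> j. b $ j - 1 / real (Suc n)))" by blast
  qed
  show "incseq (\<lambda>n :: nat. cbox a (\<chi> j. b $ j - 1 / real (Suc n)))"
  proof (rule incseq_SucI, rule subsetI)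
    fix n and x assume "x \<in> cbox a (\<chi> j. b $ j - 1 / real (Suc n))"
    moreover have "1 / real (Suc (Suc n)) \<le> 1 / real (Suc n)" by (simp add: field_simps)
    ultimately show "x \<in> cbox a (\<chi> j. b $ j - 1 / real (Suc (Suc n)))"
      unfolding mem_box_cart vec_lambda_beta by (meson diff_left_mono order_trans)
  qed
qed

definition period_cell :: "(real^'n) set"
  where "period_cell = {\<theta>. \<forall>j. 0 \<le> \<theta> $ j \<and> \<theta> $ j < 2 * pi}"

lemma emeasure_period_cell: "emeasure lborel (period_cell :: (real^'n) set) = ennreal ((2 * pi) ^ CARD('n))"
proof (rule antisym)
  have nn: "0 \<bullet> b \<le> (\<chi> j :: 'n. 2 * pi) \<bullet> b" if "b \<in> Basis" for b
    using that by (auto simp: Basis_vec_def inner_axis)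
  have 1: "emeasure lborel (cbox 0 (\<chi> j :: 'n. 2 * pi)) = ennreal ((2 * pi) ^ CARD('n))"
    using nn by (subst emeasure_lborel_cbox_eq) (simp add: prod_Basis_real_vec inner_axis)
  have 2: "emeasure lborel (box 0 (\<chi> j :: 'n. 2 * pi)) = ennreal ((2 * pi) ^ CARD('n))"
    using nn by (subst emeasure_lborel_box_eq) (simp add: prod_Basis_real_vec inner_axis)
  show "emeasure lborel (period_cell :: (real^'n) set) \<le> ennreal ((2 * pi) ^ CARD('n))"
    unfolding 1[symmetric] by (rule emeasure_mono) (auto simp: period_cell_def mem_box_cart less_imp_le)
  show "ennreal ((2 * pi) ^ CARD('n)) \<le> emeasure lborel (period_cell :: (real^'n) set)"
    unfolding 2[symmetric] by (rule emeasure_mono) (auto simp: period_cell_def mem_box_cart less_imp_le)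
qed

context gauss_field
begin

lemma K_diag: "K \<tau> \<tau> *v z = sqrt S *\<^sub>R z"
proof -
  have "K \<tau> \<tau> = (\<chi> j k. if j = k then sqrt S else 0)"
    using iso[of \<tau>] S_pos by (simp add: K_def u_def vec_eq_iff sum_divide_distrib[symmetric] real_div_sqrt)
  then show ?thesis
    by (simp add: vec_eq_iff matrix_vector_mult_def if_distrib[of "\<lambda>x. x * _"] sum.delta cong: if_cong)
qed

lemma det_K_diag: "det (K \<tau> \<tau>) = sqrt S ^ CARD('n)"
proof -
  have eq: "K \<tau> \<tau> = (\<chi> j k. if j = k then sqrt S else 0)"
    using iso[of \<tau>] S_pos by (simp add: K_def u_def vec_eq_iff sum_divide_distrib[symmetric] real_div_sqrt)
  show ?thesis unfolding eq by (subst det_diagonal) auto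
qed

lemma det_K_diag_nonzero: "det (K \<tau> \<tau>) \<noteq> 0"
  using S_pos by (simp add: det_K_diag)

lemma g_diag: "g c \<tau> \<tau> = (\<Sum>b\<in>B. c b *\<^sub>R u b \<tau>)"
proof -
  have "K \<tau> \<tau> *v (\<Sum>b\<in>B. c b *\<^sub>R u b \<tau>) = grad c \<tau>"
    using S_pos unfolding K_diag grad_def u_def by (simp add: scaleR_sum_right)
  then show ?thesis using K_inv[OF det_K_diag_nonzero, of \<tau>] by (simp add: g_eq)
qed

text \<open>
  The correction in \<open>Mb\<close> is a combination of covariances of the gradient and the Hessian at the
  same point, which vanish.
\<close>

lemma M_diag: "M c \<tau> \<tau> = hess c \<tau>"
proof -
  have "(\<Sum>b'\<in>B. (u b' \<tau> \<bullet> z) *\<^sub>R H b' \<tau>) $ i $ j = 0" for z i j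
  proof -
    have "(\<Sum>b'\<in>B. (u b' \<tau> \<bullet> z) *\<^sub>R H b' \<tau>) $ i $ j = (\<Sum>b'\<in>B. \<Sum>k\<in>UNIV. z $ k / sqrt S * (G b' \<tau> $ k * H b' \<tau> $ i $ j))"
      by (simp add: inner_vec_def u_def sum_distrib_right sum_distrib_left mult_ac)
    also have "\<dots> = (\<Sum>k\<in>UNIV. z $ k / sqrt S * (\<Sum>b'\<in>B. G b' \<tau> $ k * H b' \<tau> $ i $ j))"
      by (subst sum.swap) (simp add: sum_distrib_left)
    finally show ?thesis by (simp add: orth)
  qed
  then have "(\<Sum>b'\<in>B. (u b' \<tau> \<bullet> z) *\<^sub>R H b' \<tau>) = 0" for z by (simp add: vec_eq_iff)
  then show ?thesis by (simp add: M_def Mb_def hess_def)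
qed

text \<open>
  On the diagonal, \<open>z = g c \<tau> \<tau>\<close> is the component of \<open>c\<close> in the span of
  the translations. The translation removes it from \<open>c\<close> and the weight of \<open>z\<close>
  restores it, so that the density of \<open>c\<close> itself remains.
\<close>

lemma dens_diag:
  "dens c \<tau> \<tau> = (1 / sqrt (2 * pi * S)) ^ CARD('n) * (gauss_coords B c * \<bar>det (hess c \<tau>)\<bar>)"
proof -
  have "(\<Sum>b\<in>B. (c b + (- g c \<tau> \<tau>) \<bullet> u b \<tau>)\<^sup>2) = (\<Sum>b\<in>B. (c b)\<^sup>2) - g c \<tau> \<tau> \<bullet> g c \<tau> \<tau>"
    by (subst tight_frame_sum_sq_translate[OF u_iso]) (simp add: g_diag[symmetric])
  then have "std_gauss_vec (g c \<tau> \<tau>) * gauss_coords B (\<lambda>b. c b + (- g c \<tau> \<tau>) \<bullet> u b \<tau>) =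
      (1 / sqrt (2 * pi)) ^ CARD('n) * gauss_coords B c"
    by (simp add: std_gauss_vec_def gauss_coords_eq mult_exp_exp diff_divide_distrib)
  then show ?thesis
    using S_pos by (simp add: dens_def M_diag det_K_diag real_sqrt_mult power_divide power_mult_distrib mult_ac)
qed

text \<open>
  The exponent is at most \<open>- |c|\<^sup>2 / 4\<close> since the square of \<open>c/2 - z\<close> is
  nonnegative, where \<open>z\<close> stands for \<open>(z \<bullet> u b \<tau>)\<close> in the space of
  coefficients. The bound is uniform in \<open>z\<close>, which is needed because \<open>g c \<tau>
  \<theta>\<close> depends on \<open>\<theta>\<close>.
\<close>

lemma shifted_density_le:
  "std_gauss_vec z * gauss_coords B (\<lambda>b. c b + (- z) \<bullet> u b \<tau>) \<le>
    (1 / sqrt (2 * pi)) ^ CARD('n) * (1 / sqrt (2 * pi)) ^ card B * exp (- (\<Sum>b\<in>B. (c b)\<^sup>2) / 4)"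
proof -
  let ?q = "\<Sum>b\<in>B. (c b)\<^sup>2" and ?X = "\<Sum>b\<in>B. c b *\<^sub>R u b \<tau>"
  have zz: "(\<Sum>b\<in>B. ((- z) \<bullet> u b \<tau>)\<^sup>2) = z \<bullet> z"
    using tight_frame_sum_sq_translate[OF u_iso, of "\<lambda>_. 0" "- z"] by simp
  have "0 \<le> (\<Sum>b\<in>B. (c b / 2 + (- z) \<bullet> u b \<tau>)\<^sup>2)" by (simp add: sum_nonneg)
  also have "\<dots> = (\<Sum>b\<in>B. (c b / 2)\<^sup>2) + 2 * ((- z) \<bullet> (\<Sum>b\<in>B. (c b / 2) *\<^sub>R u b \<tau>)) + 1 * ((- z) \<bullet> (- z))"
    by (rule tight_frame_sum_sq_translate[OF u_iso])
  also have "(\<Sum>b\<in>B. (c b / 2) *\<^sub>R u b \<tau>) = (1 / 2) *\<^sub>R ?X"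
    by (simp add: scaleR_sum_right)
  finally have "0 \<le> ?q / 4 - z \<bullet> ?X + z \<bullet> z"
    by (simp add: power_divide sum_divide_distrib)
  then have "- (z \<bullet> z) / 2 + - (?q + 2 * ((- z) \<bullet> ?X) + 1 * ((- z) \<bullet> (- z))) / 2 \<le> - ?q / 4"
    by (simp add: field_simps)
  then show ?thesis
    unfolding std_gauss_vec_def gauss_coords_eq tight_frame_sum_sq_translate[OF u_iso]
    by (simp add: mult_exp_exp mult_ac power_one_over mult_left_mono divide_right_mono)
qed

lemma borel_dens: "det (K \<tau> \<theta>) \<noteq> 0 \<Longrightarrow> (\<lambda>c. dens c \<tau> \<theta>) \<in> borel_measurable (leb_coords B)"
proof -
  assume nz: "det (K \<tau> \<theta>) \<noteq> 0"
  have "(\<lambda>c. (c, \<theta>)) \<in> leb_coords B \<rightarrow>\<^sub>M leb_coords B \<Otimes>\<^sub>M borel" by simp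
  from measurable_compose[OF this measurable_dens[of "{\<theta>}" \<tau>]] nz show ?thesis by simp
qed

definition crit_dens where "crit_dens \<tau> \<theta> = (\<integral>\<^sup>+ c. ennreal (dens c \<tau> \<theta>) \<partial>leb_coords B)"

text \<open>
  By dominated convergence. Along a tail of the sequence the determinant of \<open>K\<close> is bounded away
  from \<open>0\<close>.
\<close>

lemma crit_dens_tendsto:
  assumes X: "X \<longlonglongrightarrow> (\<tau>, \<tau>)"
  shows "(\<lambda>i. crit_dens (fst (X i)) (snd (X i))) \<longlonglongrightarrow> crit_dens \<tau> \<tau>"
proof -
  have detX: "(\<lambda>i. det (K (fst (X i)) (snd (X i)))) \<longlonglongrightarrow> det (K \<tau> \<tau>)"
  proof -
    have "continuous_on UNIV (\<lambda>p. det (K (fst p) (snd p)))"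
      by (intro continuous_on_det continuous_intros cont_K2)
    from continuous_on_tendsto_compose[OF this X] show ?thesis by simp
  qed
  have "0 < det (K \<tau> \<tau>)" using S_pos by (simp add: det_K_diag)
  then have "\<forall>\<^sub>F i in sequentially. det (K \<tau> \<tau>) / 2 < det (K (fst (X i)) (snd (X i)))"
    by (intro order_tendstoD(1)[OF detX]) simp
  then obtain N where N: "\<And>i. N \<le> i \<Longrightarrow> det (K \<tau> \<tau>) / 2 < det (K (fst (X i)) (snd (X i)))"
    by (auto simp: eventually_sequentially)
  define Y where "Y = (\<lambda>i. X (i + N))"
  have Y: "Y \<longlonglongrightarrow> (\<tau>, \<tau>)" unfolding Y_def using X by (rule LIMSEQ_ignore_initial_segment)
  have detY: "det (K \<tau> \<tau>) / 2 < det (K (fst (Y i)) (snd (Y i)))" for i unfolding Y_def by (rule N) simp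
  have nzY: "det (K (fst (Y i)) (snd (Y i))) \<noteq> 0" for i using detY[of i] \<open>0 < det (K \<tau> \<tau>)\<close> by linarith
  let ?U = "{p. det (K (fst p) (snd p)) \<noteq> 0}"
  have lim: "(\<lambda>i. f (fst (Y i)) (snd (Y i))) \<longlonglongrightarrow> f \<tau> \<tau>"
    if "continuous_on ?U (\<lambda>p. f (fst p) (snd p))" for f :: "_ \<Rightarrow> _ \<Rightarrow> 'z::topological_space"
    using continuous_on_tendsto_compose[OF that Y] nzY det_K_diag_nonzero by simp
  have "\<exists>L. \<forall>b\<in>B. \<forall>i. norm (Mb b (fst (Y i)) (snd (Y i))) \<le> L"
  proof -
    have "\<exists>l. \<forall>i. norm (Mb b (fst (Y i)) (snd (Y i))) \<le> l" if "b \<in> B" for b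
      using convergent_imp_Bseq[OF convergentI[OF lim[OF cont_Mb[OF that]]]] by (auto simp: Bseq_def)
    then obtain l where l: "\<And>b i. b \<in> B \<Longrightarrow> norm (Mb b (fst (Y i)) (snd (Y i))) \<le> l b" by metis
    have "norm (Mb b (fst (Y i)) (snd (Y i))) \<le> (\<Sum>b\<in>B. l b)" if "b \<in> B" for b i
    proof -
      have "0 \<le> l b'" if "b' \<in> B" for b' using order_trans[OF norm_ge_zero l[OF that]] .
      then have "l b \<le> (\<Sum>b\<in>B. l b)" using that finB by (intro member_le_sum) auto
      with l[OF that, of i] show ?thesis by linarith
    qed
    then show ?thesis by blast
  qed
  then obtain L0 where L0: "\<And>b i. b \<in> B \<Longrightarrow> norm (Mb b (fst (Y i)) (snd (Y i))) \<le> L0" by blast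
  define L where "L = \<bar>L0\<bar>"
  have L: "\<bar>Mb b (fst (Y i)) (snd (Y i)) $ j $ k\<bar> \<le> L" if "b \<in> B" for b i j k
  proof -
    have "\<bar>Mb b (fst (Y i)) (snd (Y i)) $ j $ k\<bar> \<le> norm (Mb b (fst (Y i)) (snd (Y i)) $ j)"
      by (rule component_le_norm_cart)
    also have "\<dots> \<le> norm (Mb b (fst (Y i)) (snd (Y i)))" by (rule Finite_Cartesian_Product.norm_nth_le)
    also have "\<dots> \<le> L" using L0[OF that, of i] by (simp add: L_def)
    finally show ?thesis .
  qed
  define C where "C = fact CARD('n) * real CARD('n) ^ CARD('n) / (det (K \<tau> \<tau>) / 2) *
    ((1 / sqrt (2 * pi)) ^ CARD('n) * (1 / sqrt (2 * pi)) ^ card B)"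
  let ?w = "\<lambda>c. exp (L * (\<Sum>b\<in>B. \<bar>c b\<bar>) - (\<Sum>b\<in>B. (c b)\<^sup>2) / 4)"
  have bound: "dens c (fst (Y i)) (snd (Y i)) \<le> C * ?w c" for c i
  proof -
    let ?t = "fst (Y i)" and ?s = "snd (Y i)"
    have "\<bar>det (M c ?t ?s)\<bar> \<le> fact CARD('n) * real CARD('n) ^ CARD('n) * exp (L * (\<Sum>b\<in>B. \<bar>c b\<bar>))"
      unfolding M_def by (rule abs_det_comb_le) (use L in \<open>auto simp: L_def\<close>)
    then have "\<bar>det (M c ?t ?s)\<bar> / \<bar>det (K ?t ?s)\<bar> \<le>
        fact CARD('n) * real CARD('n) ^ CARD('n) * exp (L * (\<Sum>b\<in>B. \<bar>c b\<bar>)) / (det (K \<tau> \<tau>) / 2)"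
      using detY[of i] \<open>0 < det (K \<tau> \<tau>)\<close> by (intro frac_le) auto
    from mult_mono[OF this shifted_density_le[of "g c ?t ?s" c ?t]]
    have "dens c ?t ?s \<le> fact CARD('n) * real CARD('n) ^ CARD('n) * exp (L * (\<Sum>b\<in>B. \<bar>c b\<bar>)) / (det (K \<tau> \<tau>) / 2) *
        ((1 / sqrt (2 * pi)) ^ CARD('n) * (1 / sqrt (2 * pi)) ^ card B * exp (- (\<Sum>b\<in>B. (c b)\<^sup>2) / 4))"
      unfolding dens_def using \<open>0 < det (K \<tau> \<tau>)\<close> by auto
    also have "\<dots> = C * ?w c"
    proof -
      have "?w c = exp (L * (\<Sum>b\<in>B. \<bar>c b\<bar>)) * exp (- (\<Sum>b\<in>B. (c b)\<^sup>2) / 4)"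
        by (simp add: mult_exp_exp)
      then show ?thesis by (simp only: C_def) simp
    qed
    finally show ?thesis .
  qed
  have C0: "0 \<le> C" using \<open>0 < det (K \<tau> \<tau>)\<close> by (simp add: C_def)
  have "(\<lambda>i. crit_dens (fst (Y i)) (snd (Y i))) \<longlonglongrightarrow> crit_dens \<tau> \<tau>"
    unfolding crit_dens_def
  proof (rule nn_integral_dominated_convergence)
    show "(\<lambda>c. ennreal (dens c (fst (Y i)) (snd (Y i)))) \<in> borel_measurable (leb_coords B)" for i
      by (intro measurable_compose[OF borel_dens[OF nzY] measurable_ennreal])
    show "(\<lambda>c. ennreal (dens c \<tau> \<tau>)) \<in> borel_measurable (leb_coords B)"
      by (intro measurable_compose[OF borel_dens[OF det_K_diag_nonzero] measurable_ennreal])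
    show "(\<lambda>c. ennreal (C * ?w c)) \<in> borel_measurable (leb_coords B)" by measurable
    have "integrable (leb_coords B) (\<lambda>c. C * ?w c)"
      by (rule integrable_mult_right[OF integrable_exp_abs_quarter[OF finB]])
    then show "(\<integral>\<^sup>+ c. ennreal (C * ?w c) \<partial>leb_coords B) < \<infinity>"
      using C0 by (subst nn_integral_eq_integral) auto
    show "AE c in leb_coords B. ennreal (dens c (fst (Y i)) (snd (Y i))) \<le> ennreal (C * ?w c)" for i
      using bound by (intro always_eventually allI ennreal_leI) auto
    show "AE c in leb_coords B. (\<lambda>i. ennreal (dens c (fst (Y i)) (snd (Y i)))) \<longlonglongrightarrow> ennreal (dens c \<tau> \<tau>)"
    proof (intro always_eventually allI tendsto_ennrealI)
      fix c
      have "continuous_on ?U (\<lambda>p. dens c (fst p) (snd p))"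
        unfolding dens_def M_def g_def std_gauss_vec_def gauss_coords_eq u_def
        by (intro continuous_intros continuous_on_det continuous_on_compose2[OF contG] cont_gb cont_Mb
             continuous_on_subset[OF cont_K2]) auto
      from lim[OF this] show "(\<lambda>i. dens c (fst (Y i)) (snd (Y i))) \<longlonglongrightarrow> dens c \<tau> \<tau>" .
    qed
  qed
  then show ?thesis unfolding Y_def by (rule LIMSEQ_offset)
qed

text \<open>
  By compactness: a sequence of counterexamples for \<open>\<delta> = 1/(n+1)\<close> would contradict
  \<open>crit_dens_tendsto\<close> at a limit point of the base points.
\<close>

lemma crit_dens_near_diagonal:
  assumes T: "compact T" and P0: "\<And>\<tau>. crit_dens \<tau> \<tau> = ennreal P0" "0 \<le> P0" and \<epsilon>: "0 < \<epsilon>"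
  shows "\<exists>\<delta>>0. \<forall>\<tau>\<in>T. \<forall>\<theta>. dist \<theta> \<tau> < \<delta> \<longrightarrow> det (K \<tau> \<theta>) \<noteq> 0 \<and>
    ennreal (P0 - \<epsilon>) \<le> crit_dens \<tau> \<theta> \<and> crit_dens \<tau> \<theta> \<le> ennreal (P0 + \<epsilon>)"
proof (rule ccontr)
  let ?good = "\<lambda>\<tau> \<theta>. det (K \<tau> \<theta>) \<noteq> 0 \<and> ennreal (P0 - \<epsilon>) \<le> crit_dens \<tau> \<theta> \<and> crit_dens \<tau> \<theta> \<le> ennreal (P0 + \<epsilon>)"
  assume "\<not> ?thesis"
  then have "\<exists>\<tau>\<in>T. \<exists>\<theta>. dist \<theta> \<tau> < \<delta> \<and> \<not> ?good \<tau> \<theta>" if "0 < \<delta>" for \<delta>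
    using that by blast
  then have "\<exists>\<tau> \<theta>. \<tau> \<in> T \<and> dist \<theta> \<tau> < 1 / real (Suc n) \<and> \<not> ?good \<tau> \<theta>" for n :: nat
    by (meson of_nat_0_less_iff zero_less_Suc zero_less_divide_1_iff)
  then obtain t s where ts: "\<And>n :: nat. t n \<in> T" "\<And>n. dist (s n) (t n) < 1 / real (Suc n)" "\<And>n. \<not> ?good (t n) (s n)"
    by metis
  obtain \<tau> r where r: "strict_mono (r :: nat \<Rightarrow> nat)" "(t \<circ> r) \<longlonglongrightarrow> \<tau>"
    using T ts(1) unfolding compact_def by metis
  have "(\<lambda>n. dist (s n) (t n)) \<longlonglongrightarrow> 0"
  proof (rule tendsto_sandwich[of "\<lambda>_. 0"])
    show "(\<lambda>n. 1 / real (Suc n)) \<longlonglongrightarrow> 0" by (rule LIMSEQ_inverse_real_of_nat[unfolded inverse_eq_divide])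
  qed (use ts(2) in \<open>auto intro!: always_eventually less_imp_le\<close>)
  then have "(\<lambda>n. dist (s (r n)) (t (r n))) \<longlonglongrightarrow> 0"
    using LIMSEQ_subseq_LIMSEQ[OF _ r(1), of "\<lambda>n. dist (s n) (t n)" 0] by (simp add: o_def)
  then have "(\<lambda>n. norm (t (r n) - s (r n))) \<longlonglongrightarrow> 0"
    by (simp add: dist_norm norm_minus_commute)
  then have ts0: "(\<lambda>n. t (r n) - s (r n)) \<longlonglongrightarrow> 0" by (rule tendsto_norm_zero_cancel)
  have t: "(\<lambda>n. t (r n)) \<longlonglongrightarrow> \<tau>" using r(2) by (simp only: o_def)
  from tendsto_diff[OF t ts0] have s: "(\<lambda>n. s (r n)) \<longlonglongrightarrow> \<tau>" by simp
  from t s have X: "(\<lambda>n. (t (r n), s (r n))) \<longlonglongrightarrow> (\<tau>, \<tau>)" by (rule tendsto_Pair)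
  have "(\<lambda>n. det (K (t (r n)) (s (r n)))) \<longlonglongrightarrow> det (K \<tau> \<tau>)"
  proof -
    have "continuous_on UNIV (\<lambda>p. det (K (fst p) (snd p)))"
      by (intro continuous_on_det continuous_intros cont_K2)
    from continuous_on_tendsto_compose[OF this X] show ?thesis by simp
  qed
  then have 1: "\<forall>\<^sub>F n in sequentially. det (K (t (r n)) (s (r n))) \<noteq> 0"
    using det_K_diag_nonzero by (rule tendsto_imp_eventually_ne)
  have lim: "(\<lambda>n. crit_dens (t (r n)) (s (r n))) \<longlonglongrightarrow> ennreal P0"
    using crit_dens_tendsto[OF X] by (simp add: P0)
  have 2: "\<forall>\<^sub>F n in sequentially. crit_dens (t (r n)) (s (r n)) < ennreal (P0 + \<epsilon>)"
    by (rule order_tendstoD(2)[OF lim]) (use P0(2) \<epsilon> in \<open>simp add: ennreal_less_iff\<close>)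
  have 3: "\<forall>\<^sub>F n in sequentially. ennreal (P0 - \<epsilon>) \<le> crit_dens (t (r n)) (s (r n))"
  proof (cases "P0 \<le> \<epsilon>")
    case True
    then have "ennreal (P0 - \<epsilon>) = 0" by (simp add: ennreal_neg)
    then show ?thesis by simp
  next
    case False
    then have "\<forall>\<^sub>F n in sequentially. ennreal (P0 - \<epsilon>) < crit_dens (t (r n)) (s (r n))"
      by (intro order_tendstoD(1)[OF lim]) (use \<epsilon> in \<open>simp add: ennreal_less_iff\<close>)
    then show ?thesis by (rule eventually_mono) auto
  qed
  have "\<forall>\<^sub>F n in sequentially. False"
    using 1 2 3
  proof eventually_elim
    case (elim n)
    then show ?case using ts(3)[of "r n"] less_imp_le[OF elim(2)] by blast
  qed
  then show False by simp
qed

text \<open>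
  The period cell is cut into the pieces of a cubic grid of mesh \<open>1/m\<close>. On each piece, with a
  base point in it, the density deviates from \<open>P0\<close> by at most \<open>\<epsilon>\<close>.
\<close>

lemma expected_zeros_period_cell:
  assumes h: "\<And>\<tau>. (\<integral>\<^sup>+ c. ennreal (gauss_coords B c * \<bar>det (hess c \<tau>)\<bar>) \<partial>leb_coords B) = ennreal h" "0 \<le> h"
  shows "(\<integral>\<^sup>+ c. ennreal (gauss_coords B c) * num_elems {\<theta> \<in> period_cell. grad c \<theta> = 0} \<partial>leb_coords B) =
    ennreal ((2 * pi) ^ CARD('n) * ((1 / sqrt (2 * pi * S)) ^ CARD('n) * h))"
proof -
  define P0 where "P0 = (1 / sqrt (2 * pi * S)) ^ CARD('n) * h"
  define V where "V = (2 * pi) ^ CARD('n)"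
  have P0: "crit_dens \<tau> \<tau> = ennreal P0" "0 \<le> P0" for \<tau>
  proof -
    have m: "(\<lambda>c. ennreal (gauss_coords B c * \<bar>det (hess c \<tau>)\<bar>)) \<in> borel_measurable (leb_coords B)"
    proof -
      have "(\<lambda>c. hess c \<tau>) \<in> borel_measurable (leb_coords B)" unfolding hess_def by measurable
      then have "(\<lambda>c. det (hess c \<tau>)) \<in> borel_measurable (leb_coords B)"
        by (rule measurable_compose) (intro borel_measurable_continuous_onI continuous_on_det continuous_intros)
      then show ?thesis by measurable
    qed
    show "crit_dens \<tau> \<tau> = ennreal P0"
      unfolding crit_dens_def dens_diag P0_def using h S_pos m
      by (simp add: ennreal_mult nn_integral_cmult)
    show "0 \<le> P0" using h(2) S_pos by (simp add: P0_def)
  qed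
  define E where "E = (\<lambda>Q. \<integral>\<^sup>+ c. ennreal (gauss_coords B c) * num_elems {\<theta> \<in> Q. grad c \<theta> = 0} \<partial>leb_coords B)"
  have est: "ennreal (P0 - \<epsilon>) * ennreal V \<le> E period_cell \<and> E period_cell \<le> ennreal (P0 + \<epsilon>) * ennreal V"
    if \<epsilon>: "0 < \<epsilon>" for \<epsilon>
  proof -
    obtain \<delta> where \<delta>: "0 < \<delta>" "\<And>\<tau> \<theta>. \<tau> \<in> cbox 0 (\<chi> j. 2 * pi) \<Longrightarrow> dist \<theta> \<tau> < \<delta> \<Longrightarrow> det (K \<tau> \<theta>) \<noteq> 0 \<and>
        ennreal (P0 - \<epsilon>) \<le> crit_dens \<tau> \<theta> \<and> crit_dens \<tau> \<theta> \<le> ennreal (P0 + \<epsilon>)"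
      using crit_dens_near_diagonal[OF compact_cbox P0 \<epsilon>] by metis
    obtain m :: nat where m: "real CARD('n) / \<delta> < real m" using reals_Archimedean2 by blast
    then have m0: "0 < real m" using \<delta>(1) by (smt (verit) divide_nonneg_pos of_nat_0_le_iff)
    \<comment> \<open>The pieces are enumerated by the codes of their integer corners; a number that is no code yields the empty piece.\<close>
    define cell :: "real^'n \<Rightarrow> int^'n" where "cell = (\<lambda>\<theta>. \<chi> j. \<lfloor>real m * \<theta> $ j\<rfloor>)"
    define A where "A = (\<lambda>i. {\<theta> \<in> period_cell. to_nat (cell \<theta>) = i})"
    define a :: "nat \<Rightarrow> real^'n" where "a = (\<lambda>i. \<chi> j. max 0 (of_int ((from_nat i :: int^'n) $ j) / m))"
    define b :: "nat \<Rightarrow> real^'n" where "b = (\<lambda>i. \<chi> j. min (2 * pi) ((of_int ((from_nat i :: int^'n) $ j) + 1) / m))"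
    define Kn where "Kn = (\<lambda>i n. if to_nat (from_nat i :: int^'n) = i then cbox (a i) (\<chi> j. b i $ j - 1 / real (Suc n)) else {})"
    have Kn: "compact (Kn i n)" "incseq (Kn i)" for i n
      using half_open_box_eq_UN(2)[of "a i" "b i"] by (auto simp: Kn_def incseq_def)
    have UKn: "(\<Union>n. Kn i n) = A i" for i
    proof (cases "to_nat (from_nat i :: int^'n) = i")
      case True
      have "(to_nat (cell \<theta>) = i) \<longleftrightarrow> cell \<theta> = from_nat i" for \<theta>
        using True by (metis from_nat_to_nat)
      moreover have "cell \<theta> = from_nat i \<longleftrightarrow> (\<forall>j. of_int ((from_nat i :: int^'n) $ j) / m \<le> \<theta> $ j \<and>
          \<theta> $ j < (of_int ((from_nat i :: int^'n) $ j) + 1) / m)" for \<theta>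
        unfolding cell_def vec_eq_iff using m0
        by (simp add: floor_eq_iff pos_divide_le_eq pos_less_divide_eq mult.commute)
      moreover have "(\<Union>n. Kn i n) = {\<theta>. \<forall>j. a i $ j \<le> \<theta> $ j \<and> \<theta> $ j < b i $ j}"
        unfolding half_open_box_eq_UN(1)[symmetric] using True by (simp add: Kn_def)
      ultimately show ?thesis
        by (auto simp: A_def period_cell_def a_def b_def)
    next
      case False
      then have "to_nat (cell \<theta>) \<noteq> i" for \<theta> by (metis from_nat_to_nat)
      with False show ?thesis by (simp add: Kn_def A_def)
    qed
    have A_borel [measurable]: "A i \<in> sets borel" for i
      unfolding UKn[symmetric] by (rule sets.countable_UN) (use Kn(1) in \<open>auto intro: borel_compact\<close>)
    have UA: "(\<Union>i. A i) = period_cell" by (auto simp: A_def)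
    have disjA: "disjoint_family A" by (auto simp: A_def disjoint_family_on_def)
    have near: "dist \<theta> \<tau> < \<delta>" if "\<theta> \<in> A i" "\<tau> \<in> A i" for i \<theta> \<tau>
    proof -
      have "cell \<theta> = cell \<tau>" using that by (auto simp: A_def)
      have "\<bar>(\<theta> - \<tau>) $ j\<bar> \<le> 1 / m" for j
      proof -
        have "\<lfloor>real m * \<theta> $ j\<rfloor> = \<lfloor>real m * \<tau> $ j\<rfloor>"
          using \<open>cell \<theta> = cell \<tau>\<close> by (simp add: cell_def vec_eq_iff)
        then have "\<bar>real m * \<theta> $ j - real m * \<tau> $ j\<bar> \<le> 1" by linarith
        then have "real m * \<bar>\<theta> $ j - \<tau> $ j\<bar> \<le> 1"
          using m0 by (simp add: abs_mult flip: right_diff_distrib)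
        then show ?thesis using m0 by (simp add: field_simps)
      qed
      then have "(\<Sum>j\<in>UNIV. \<bar>(\<theta> - \<tau>) $ j\<bar>) \<le> (\<Sum>j\<in>(UNIV :: 'n set). 1 / m)" by (rule sum_mono)
      then have "dist \<theta> \<tau> \<le> real CARD('n) / m"
        using norm_le_l1_cart[of "\<theta> - \<tau>"] by (simp add: dist_norm)
      also have "\<dots> < \<delta>" using m m0 \<delta>(1) by (simp add: field_simps)
      finally show ?thesis .
    qed
    have EA: "ennreal (P0 - \<epsilon>) * emeasure lborel (A i) \<le> E (A i) \<and> E (A i) \<le> ennreal (P0 + \<epsilon>) * emeasure lborel (A i)" for i
    proof (cases "A i = {}")
      case False
      then obtain \<tau> where \<tau>: "\<tau> \<in> A i" by blast
      then have "\<tau> \<in> cbox 0 (\<chi> j. 2 * pi)" by (auto simp: A_def period_cell_def mem_box_cart less_imp_le)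
      from \<delta>(2)[OF this] near[OF _ \<tau>]
      have A: "det (K \<tau> \<theta>) \<noteq> 0 \<and> ennreal (P0 - \<epsilon>) \<le> crit_dens \<tau> \<theta> \<and> crit_dens \<tau> \<theta> \<le> ennreal (P0 + \<epsilon>)"
        if "\<theta> \<in> A i" for \<theta> using that by blast
      have "(\<Union>n. Kn i n) \<subseteq> {\<theta>. det (K \<tau> \<theta>) \<noteq> 0}" unfolding UKn using A by blast
      from expected_zeros_local[OF Kn this]
      have E: "E (A i) = (\<integral>\<^sup>+ \<theta>. indicator (A i) \<theta> * crit_dens \<tau> \<theta> \<partial>lborel)"
        unfolding UKn E_def crit_dens_def .
      have cm: "(\<integral>\<^sup>+ \<theta>. x * indicator (A i) \<theta> \<partial>lborel) = x * emeasure lborel (A i)" for x :: ennreal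
        by (simp add: nn_integral_cmult)
      have "(\<integral>\<^sup>+ \<theta>. ennreal (P0 - \<epsilon>) * indicator (A i) \<theta> \<partial>lborel) \<le> E (A i)"
        unfolding E by (rule nn_integral_mono) (use A in \<open>auto simp: indicator_def\<close>)
      moreover have "E (A i) \<le> (\<integral>\<^sup>+ \<theta>. ennreal (P0 + \<epsilon>) * indicator (A i) \<theta> \<partial>lborel)"
        unfolding E by (rule nn_integral_mono) (use A in \<open>auto simp: indicator_def\<close>)
      ultimately show ?thesis unfolding cm by blast
    qed (simp add: E_def)
    have N: "(\<lambda>c. num_elems {\<theta> \<in> A i. grad c \<theta> = 0}) \<in> borel_measurable (leb_coords B)" for i
      unfolding UKn[symmetric] by (rule borel_measurable_num_zeros[OF Kn]) (auto intro: cont_grad borel_grad)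
    have numA: "num_elems {\<theta> \<in> period_cell. grad c \<theta> = 0} = (\<Sum>i. num_elems {\<theta> \<in> A i. grad c \<theta> = 0})" for c
    proof -
      have "{\<theta> \<in> period_cell. grad c \<theta> = 0} = (\<Union>i. {\<theta> \<in> A i. grad c \<theta> = 0})" using UA by blast
      also have "num_elems \<dots> = (\<Sum>i. num_elems {\<theta> \<in> A i. grad c \<theta> = 0})"
        by (rule suminf_emeasure[symmetric]) (use disjA in \<open>auto simp: disjoint_family_on_def\<close>)
      finally show ?thesis .
    qed
    have "E period_cell = (\<integral>\<^sup>+ c. (\<Sum>i. ennreal (gauss_coords B c) * num_elems {\<theta> \<in> A i. grad c \<theta> = 0}) \<partial>leb_coords B)"
      unfolding E_def numA ennreal_suminf_cmult ..
    also have "\<dots> = (\<Sum>i. E (A i))"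
      unfolding E_def by (rule nn_integral_suminf) (use N in measurable)
    finally have sumE: "E period_cell = (\<Sum>i. E (A i))" .
    have sumV: "(\<Sum>i. emeasure lborel (A i)) = ennreal V"
      unfolding V_def emeasure_period_cell[symmetric] UA[symmetric]
      by (rule suminf_emeasure) (use disjA in auto)
    have "(\<Sum>i. ennreal (P0 - \<epsilon>) * emeasure lborel (A i)) \<le> (\<Sum>i. E (A i))"
      by (intro suminf_le) (use EA in auto)
    moreover have "(\<Sum>i. E (A i)) \<le> (\<Sum>i. ennreal (P0 + \<epsilon>) * emeasure lborel (A i))"
      by (intro suminf_le) (use EA in auto)
    ultimately show ?thesis by (simp only: sumE ennreal_suminf_cmult sumV)
  qed
  have V: "0 < V" by (simp add: V_def)
  have fin: "E period_cell < \<infinity>"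
  proof -
    have "E period_cell \<le> ennreal ((P0 + 1) * V)"
      using est[of 1] V P0(2) by (simp add: ennreal_mult)
    also have "\<dots> < \<infinity>" by simp
    finally show ?thesis .
  qed
  then obtain e where e: "E period_cell = ennreal e" "0 \<le> e" by (cases "E period_cell") auto
  have up: "e \<le> (P0 + \<epsilon>) * V" and lo: "(P0 - \<epsilon>) * V \<le> e" if "0 < \<epsilon>" for \<epsilon>
  proof -
    show "e \<le> (P0 + \<epsilon>) * V"
      using est[OF that] that V P0(2) e by (simp add: ennreal_mult[symmetric] del: ennreal_plus)
    show "(P0 - \<epsilon>) * V \<le> e"
    proof (cases "P0 \<le> \<epsilon>")
      case True
      then have "(P0 - \<epsilon>) * V \<le> 0" using V by (simp add: mult_nonpos_nonneg)
      with e(2) show ?thesis by linarith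
    next
      case False
      then show ?thesis using est[OF that] V e by (simp add: ennreal_mult[symmetric])
    qed
  qed
  have "e = P0 * V"
  proof (rule antisym; rule field_le_epsilon)
    fix x :: real assume "0 < x"
    show "e \<le> P0 * V + x" using up[of "x / V"] \<open>0 < x\<close> V by (simp add: distrib_right)
    show "P0 * V \<le> e + x" using lo[of "x / V"] \<open>0 < x\<close> V by (simp add: left_diff_distrib)
  qed
  then show ?thesis using e unfolding E_def P0_def V_def by (simp add: mult.commute)
qed

end

section \<open>The trigonometric basis\<close>

lemma integral_lborel_prod_Basis:
  fixes f :: "'a::euclidean_space \<Rightarrow> real \<Rightarrow> complex"
  assumes "\<And>b. b \<in> Basis \<Longrightarrow> integrable lborel (f b)"
  shows "(\<integral>x. (\<Prod>b\<in>Basis. f b (x \<bullet> b)) \<partial>lborel) = (\<Prod>b\<in>Basis. \<integral>t. f b t \<partial>lborel)"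
proof -
  have [measurable]: "f b \<in> borel_measurable borel" if "b \<in> Basis" for b
    using borel_measurable_integrable[OF assms[OF that]] by simp
  have mT: "(\<lambda>c. \<Sum>b\<in>Basis. c b *\<^sub>R b) \<in> (\<Pi>\<^sub>M b\<in>Basis. lborel) \<rightarrow>\<^sub>M (borel :: 'a measure)"
    by measurable
  have "(\<integral>x. (\<Prod>b\<in>Basis. f b (x \<bullet> b)) \<partial>lborel) =
      (\<integral>c. (\<Prod>b\<in>Basis. f b ((\<Sum>i\<in>Basis. c i *\<^sub>R i) \<bullet> b)) \<partial>(\<Pi>\<^sub>M b\<in>(Basis :: 'a set). lborel))"
    by (subst lborel_eq, rule integral_distr[OF mT]) measurable
  also have "\<dots> = (\<integral>c. (\<Prod>b\<in>Basis. f b (c b)) \<partial>(\<Pi>\<^sub>M b\<in>(Basis :: 'a set). lborel))"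
    by (intro Bochner_Integration.integral_cong refl prod.cong)
       (simp add: inner_sum_left inner_Basis if_distrib[of "\<lambda>x. _ * x"] cong: if_cong)
  also have "\<dots> = (\<Prod>b\<in>Basis. \<integral>t. f b t \<partial>lborel)"
    by (rule leb.product_integral_prod) (use assms in auto)
  finally show ?thesis .
qed

lemma integral_cis_period:
  fixes k :: int
  shows "(\<integral>t. indicator {0..2 * pi} t *\<^sub>R cis (of_int k * t) \<partial>lborel) = (if k = 0 then of_real (2 * pi) else 0)"
    and "integrable lborel (\<lambda>t. indicator {0..2 * pi} t *\<^sub>R cis (of_int k * t))"
proof -
  have cont: "continuous_on {0..2 * pi} (\<lambda>t. cis (of_int k * t))"
    by (simp add: cis_conv_exp) (intro continuous_intros)
  show "integrable lborel (\<lambda>t. indicator {0..2 * pi} t *\<^sub>R cis (of_int k * t))"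
    using borel_integrable_compact[OF compact_Icc cont] .
  show "(\<integral>t. indicator {0..2 * pi} t *\<^sub>R cis (of_int k * t) \<partial>lborel) = (if k = 0 then of_real (2 * pi) else 0)"
  proof (cases "k = 0")
    case True
    then have "(\<integral>t. indicator {0..2 * pi} t *\<^sub>R cis (of_int k * t) \<partial>lborel) =
        (\<integral>t. indicator {0..2 * pi} t *\<^sub>R (1 :: complex) \<partial>lborel)" by simp
    also have "\<dots> = of_real (2 * pi)" by (simp add: scaleR_conv_of_real)
    finally show ?thesis using True by simp
  next
    case False
    let ?F = "\<lambda>t. cis (of_int k * t) / (\<i> * of_int k)"
    have "(\<integral>t. indicator {0..2 * pi} t *\<^sub>R cis (of_int k * t) \<partial>lborel) = ?F (2 * pi) - ?F 0"
    proof (rule integral_FTC_atLeastAtMost)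
      show "(?F has_vector_derivative cis (of_int k * t)) (at t within {0..2 * pi})" for t
      proof -
        have "((\<lambda>t. exp (\<i> * (of_int k * of_real t)) / (\<i> * of_int k)) has_vector_derivative
            exp (\<i> * (of_int k * of_real t))) (at t within {0..2 * pi})"
          using False
          by (auto intro!: derivative_eq_intros has_vector_derivative_real_field simp: field_simps)
        then show ?thesis by (simp add: cis_conv_exp)
      qed
    qed (use cont in auto)
    also have "cis (of_int k * (2 * pi)) = 1"
      using cis_multiple_2pi[of "of_int k"] by (simp add: mult_ac)
    finally show ?thesis using False by simp
  qed
qed

lemma phase_linear: "linear (phase m)"
  by (rule linearI) (simp_all add: phase_def sum.distrib sum_distrib_left algebra_simps)

lemma phase_add_diff: "phase (m + m') \<theta> = phase m \<theta> + phase m' \<theta>" "phase (m - m') \<theta> = phase m \<theta> - phase m' \<theta>"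
  by (simp_all add: phase_def sum.distrib sum_subtractf algebra_simps)

lemma continuous_phase [continuous_intros]: "continuous_on A (phase m)"
  using phase_linear by (intro linear_continuous_on) (simp add: linear_conv_bounded_linear)

text \<open>
  The integral is a product of integrals over one period in each coordinate.
\<close>

lemma integral_cis_phase:
  fixes k :: "int^'n"
  shows "(LINT \<theta> : cbox 0 (\<chi> j. 2 * pi) | lborel. cis (phase k \<theta>)) = (if k = 0 then of_real ((2 * pi) ^ CARD('n)) else 0)"
proof -
  define idx where "idx = (\<lambda>b :: real^'n. SOME j. b = axis j 1)"
  have idx: "idx (axis j 1) = j" for j
    unfolding idx_def by (rule some_equality) (auto simp: axis_eq_axis)
  let ?f = "\<lambda>b t. indicator {0..2 * pi} t *\<^sub>R cis (of_int (k $ idx b) * t)"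
  have "indicator (cbox 0 (\<chi> j. 2 * pi)) \<theta> *\<^sub>R cis (phase k \<theta>) = (\<Prod>b\<in>Basis. ?f b (\<theta> \<bullet> b))" for \<theta> :: "real^'n"
  proof -
    have "(\<Prod>b\<in>Basis. ?f b (\<theta> \<bullet> b)) = (\<Prod>j\<in>UNIV. indicator {0..2 * pi} (\<theta> $ j) *\<^sub>R cis (of_int (k $ j) * \<theta> $ j))"
      by (simp add: prod_Basis_real_vec idx inner_axis)
    also have "\<dots> = (\<Prod>j\<in>UNIV. of_real (indicator {0..2 * pi} (\<theta> $ j))) * (\<Prod>j\<in>UNIV. cis (of_int (k $ j) * \<theta> $ j))"
      by (simp only: scaleR_conv_of_real prod.distrib)
    also have "(\<Prod>j\<in>UNIV. cis (of_int (k $ j) * \<theta> $ j)) = cis (phase k \<theta>)"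
      by (simp add: cis_conv_exp exp_sum[symmetric] phase_def sum_distrib_left)
    also have "(\<Prod>j\<in>UNIV. of_real (indicator {0..2 * pi} (\<theta> $ j))) = (of_real (indicator (cbox 0 (\<chi> j. 2 * pi)) \<theta>) :: complex)"
    proof (cases "\<theta> \<in> cbox 0 (\<chi> j. 2 * pi)")
      case True
      then show ?thesis by (simp add: mem_box_cart)
    next
      case False
      then obtain j where "\<theta> $ j \<notin> {0..2 * pi}" by (auto simp: mem_box_cart)
      then have "(\<Prod>j\<in>UNIV. of_real (indicator {0..2 * pi} (\<theta> $ j))) = (0 :: complex)"
        by (intro prod_zero bexI[of _ j]) auto
      with False show ?thesis by simp
    qed
    finally show ?thesis by (simp add: scaleR_conv_of_real)
  qed
  then have "(LINT \<theta> : cbox 0 (\<chi> j. 2 * pi) | lborel. cis (phase k \<theta>)) =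
      (\<integral>\<theta>. (\<Prod>b\<in>Basis. ?f b (\<theta> \<bullet> b)) \<partial>(lborel :: (real^'n) measure))"
    by (simp only: set_lebesgue_integral_def)
  also have "\<dots> = (\<Prod>b\<in>(Basis :: (real^'n) set). \<integral>t. ?f b t \<partial>lborel)"
    by (rule integral_lborel_prod_Basis) (rule integral_cis_period(2))
  also have "\<dots> = (\<Prod>j\<in>UNIV. if k $ j = 0 then of_real (2 * pi) else 0)"
    by (simp only: integral_cis_period(1) prod_Basis_real_vec idx)
  also have "\<dots> = (if k = 0 then of_real ((2 * pi) ^ CARD('n)) else 0)"
  proof (cases "k = 0")
    case False
    then obtain j where "k $ j \<noteq> 0" by (auto simp: vec_eq_iff)
    then show ?thesis using False by (auto intro!: prod_zero)
  qed simp
  finally show ?thesis .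
qed

lemma integral_cos_sin_phase:
  fixes k :: "int^'n"
  shows "(LINT \<theta> : cbox 0 (\<chi> j. 2 * pi) | lborel. cos (phase k \<theta>)) = (if k = 0 then (2 * pi) ^ CARD('n) else 0)"
    and "(LINT \<theta> : cbox 0 (\<chi> j. 2 * pi) | lborel. sin (phase k \<theta>)) = 0"
proof -
  let ?Q = "cbox 0 (\<chi> j. 2 * pi) :: (real^'n) set"
  have int: "integrable lborel (\<lambda>\<theta>. indicator ?Q \<theta> *\<^sub>R cis (phase k \<theta>))"
    by (rule borel_integrable_compact[OF compact_cbox])
       (simp add: cis_conv_exp, intro continuous_intros)
  have "Re (LINT \<theta> : ?Q | lborel. cis (phase k \<theta>)) = (LINT \<theta> : ?Q | lborel. cos (phase k \<theta>))"
    unfolding set_lebesgue_integral_def by (subst integral_Re[OF int, symmetric]) simp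
  then show "(LINT \<theta> : ?Q | lborel. cos (phase k \<theta>)) = (if k = 0 then (2 * pi) ^ CARD('n) else 0)"
    unfolding integral_cis_phase by (simp only: if_distrib[of Re] Re_complex_of_real zero_complex.sel)
  have "Im (LINT \<theta> : ?Q | lborel. cis (phase k \<theta>)) = (LINT \<theta> : ?Q | lborel. sin (phase k \<theta>))"
    unfolding set_lebesgue_integral_def by (subst integral_Im[OF int, symmetric]) simp
  then show "(LINT \<theta> : ?Q | lborel. sin (phase k \<theta>)) = 0"
    unfolding integral_cis_phase by (simp only: if_distrib[of Im] Im_complex_of_real zero_complex.sel if_cancel)
qed

text \<open>
  By the product formulas. The terms with phase \<open>m + m'\<close> integrate to \<open>0\<close>; two
  frequencies of the cone never add up to \<open>0\<close> (\<open>freq_cone_add_nonzero\<close>).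
\<close>

lemma l2_inner_trig:
  fixes m m' :: "int^'n"
  assumes "m + m' \<noteq> 0"
  shows "l2_inner (\<lambda>\<theta>. cos (phase m \<theta>)) (\<lambda>\<theta>. cos (phase m' \<theta>)) = (if m = m' then (2 * pi) ^ CARD('n) / 2 else 0)"
    and "l2_inner (\<lambda>\<theta>. sin (phase m \<theta>)) (\<lambda>\<theta>. sin (phase m' \<theta>)) = (if m = m' then (2 * pi) ^ CARD('n) / 2 else 0)"
    and "l2_inner (\<lambda>\<theta>. sin (phase m \<theta>)) (\<lambda>\<theta>. cos (phase m' \<theta>)) = 0"
proof -
  let ?Q = "cbox 0 (\<chi> j. 2 * pi) :: (real^'n) set"
  have si: "set_integrable lborel ?Q (\<lambda>\<theta>. cos (phase k \<theta>) / 2)" "set_integrable lborel ?Q (\<lambda>\<theta>. sin (phase k \<theta>) / 2)"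
    for k by (intro set_integrable_box_continuous continuous_intros; simp)+
  have "l2_inner (\<lambda>\<theta>. cos (phase m \<theta>)) (\<lambda>\<theta>. cos (phase m' \<theta>)) =
      (LINT \<theta> : ?Q | lborel. cos (phase (m - m') \<theta>) / 2 + cos (phase (m + m') \<theta>) / 2)"
    unfolding l2_inner_def cos_times_cos phase_add_diff by (simp add: add_divide_distrib)
  also have "\<dots> = (if m = m' then (2 * pi) ^ CARD('n) / 2 else 0)"
    using assms by (subst set_integral_add[OF si(1) si(1)]) (simp add: integral_cos_sin_phase)
  finally show "l2_inner (\<lambda>\<theta>. cos (phase m \<theta>)) (\<lambda>\<theta>. cos (phase m' \<theta>)) = (if m = m' then (2 * pi) ^ CARD('n) / 2 else 0)" .
  have "l2_inner (\<lambda>\<theta>. sin (phase m \<theta>)) (\<lambda>\<theta>. sin (phase m' \<theta>)) =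
      (LINT \<theta> : ?Q | lborel. cos (phase (m - m') \<theta>) / 2 - cos (phase (m + m') \<theta>) / 2)"
    unfolding l2_inner_def sin_times_sin phase_add_diff by (simp add: diff_divide_distrib)
  also have "\<dots> = (if m = m' then (2 * pi) ^ CARD('n) / 2 else 0)"
    using assms by (subst set_integral_diff(2)[OF si(1) si(1)]) (simp add: integral_cos_sin_phase)
  finally show "l2_inner (\<lambda>\<theta>. sin (phase m \<theta>)) (\<lambda>\<theta>. sin (phase m' \<theta>)) = (if m = m' then (2 * pi) ^ CARD('n) / 2 else 0)" .
  have "l2_inner (\<lambda>\<theta>. sin (phase m \<theta>)) (\<lambda>\<theta>. cos (phase m' \<theta>)) =
      (LINT \<theta> : ?Q | lborel. sin (phase (m + m') \<theta>) / 2 + sin (phase (m - m') \<theta>) / 2)"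
    unfolding l2_inner_def sin_times_cos phase_add_diff by (simp add: add_divide_distrib)
  also have "\<dots> = 0"
    by (subst set_integral_add[OF si(2) si(2)]) (simp add: integral_cos_sin_phase)
  finally show "l2_inner (\<lambda>\<theta>. sin (phase m \<theta>)) (\<lambda>\<theta>. cos (phase m' \<theta>)) = 0" .
qed

lemma freq_cone_add_nonzero:
  assumes "m \<in> freq_cone" "m' \<in> freq_cone" shows "m + m' \<noteq> 0"
proof
  assume "m + m' = 0"
  then have "m $ i + m' $ i = 0" for i by (metis vector_add_component zero_index)
  then have opp: "m' $ i = - (m $ i)" for i by (metis add_eq_0_iff)
  obtain j where j: "m $ j > 0" "\<And>i. i < j \<Longrightarrow> m $ i = 0" using assms(1) by (auto simp: freq_cone_def)
  obtain l where l: "m' $ l > 0" "\<And>i. i < l \<Longrightarrow> m' $ i = 0" using assms(2) by (auto simp: freq_cone_def)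
  show False using j l opp[of j] opp[of l] by (cases j l rule: linorder_cases) auto
qed

text \<open>
  The norm in \<open>L\<^sup>2\<close> of the cosine and of the sine of any nonzero frequency.
\<close>

definition trig_norm :: "'n itself \<Rightarrow> real"
  where "trig_norm _ = sqrt ((2 * pi) ^ CARD('n) / 2)"

definition trig_fun :: "(int^'n) \<times> bool \<Rightarrow> real^'n \<Rightarrow> real"
  where "trig_fun p \<theta> = (if snd p then sin (phase (fst p) \<theta>) else cos (phase (fst p) \<theta>)) / trig_norm TYPE('n)"

lemma trig_norm_pos: "0 < trig_norm TYPE('n)"
  by (simp add: trig_norm_def)

lemma l2_inner_scale: "l2_inner (\<lambda>x. f x / s) (\<lambda>x. g x / t) = l2_inner f g / (s * t)"
  by (simp add: l2_inner_def set_lebesgue_integral_def)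

lemma trig_fun_orthonormal:
  fixes p q :: "(int^'n::{finite,linorder}) \<times> bool"
  assumes "fst p \<in> freq_cone" "fst q \<in> freq_cone"
  shows "l2_inner (trig_fun p) (trig_fun q) = (if p = q then 1 else 0)"
proof -
  obtain a b where p: "p = (a, b)" by (cases p)
  obtain a' b' where q: "q = (a', b')" by (cases q)
  have nz: "a + a' \<noteq> 0" "a' + a \<noteq> 0" using freq_cone_add_nonzero assms p q by auto
  have e: "trig_fun (m, True) = (\<lambda>\<theta>. sin (phase m \<theta>) / trig_norm TYPE('n))"
    "trig_fun (m, False) = (\<lambda>\<theta>. cos (phase m \<theta>) / trig_norm TYPE('n))" for m :: "int^'n::_"
    by (auto simp: trig_fun_def)
  have sq: "trig_norm TYPE('n) * trig_norm TYPE('n) = (2 * pi) ^ CARD('n) / 2"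
    by (simp add: trig_norm_def)
  have pos: "((2 * pi) ^ CARD('n) / 2 :: real) \<noteq> 0" by simp
  have cs: "l2_inner (\<lambda>\<theta>. cos (phase a \<theta>)) (\<lambda>\<theta>. sin (phase a' \<theta>)) = 0"
    by (subst l2_inner_commute) (rule l2_inner_trig(3)[OF nz(2)])
  show ?thesis
    unfolding p q by (cases b; cases b')
      (simp_all only: e l2_inner_scale sq l2_inner_trig[OF nz(1)] cs, use pos in auto)
qed

lemma continuous_trig_fun:
  fixes p :: "(int^'n) \<times> bool"
  shows "continuous_on UNIV (trig_fun p)"
  unfolding trig_fun_def[abs_def] using trig_norm_pos[where 'n = 'n]
  by (cases "snd p") (auto intro!: continuous_intros)

lemma inj_trig_fun:
  fixes M :: "(int^'n::{finite,linorder}) set"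
  shows "M \<subseteq> freq_cone \<Longrightarrow> inj_on trig_fun (M \<times> UNIV)"
proof (rule inj_onI)
  fix p q :: "(int^'n::_) \<times> bool"
  assume "M \<subseteq> freq_cone" "p \<in> M \<times> UNIV" "q \<in> M \<times> UNIV" "trig_fun p = trig_fun q"
  then have "fst p \<in> freq_cone" "fst q \<in> freq_cone" "trig_fun p = trig_fun q" by auto
  then have "(if p = q then 1 else 0) = (1 :: real)"
    using trig_fun_orthonormal[of p q] trig_fun_orthonormal[of q q] by simp
  then show "p = q" by (simp split: if_splits)
qed

lemma trig_basis:
  fixes M :: "(int^'n::{finite,linorder}) set"
  assumes "finite M" "M \<subseteq> freq_cone"
  shows "l2_orthonormal_basis (trig_space M) (trig_fun ` (M \<times> UNIV))"
proof -
  let ?C = "(\<lambda>m \<theta>. cos (phase m \<theta>)) ` M \<union> (\<lambda>m \<theta>. sin (phase m \<theta>)) ` M"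
  have sc: "trig_fun (m, False) = (1 / trig_norm TYPE('n)) *\<^sub>R (\<lambda>\<theta>. cos (phase m \<theta>))"
    "trig_fun (m, True) = (1 / trig_norm TYPE('n)) *\<^sub>R (\<lambda>\<theta>. sin (phase m \<theta>))"
    "(\<lambda>\<theta>. cos (phase m \<theta>)) = trig_norm TYPE('n) *\<^sub>R trig_fun (m, False)"
    "(\<lambda>\<theta>. sin (phase m \<theta>)) = trig_norm TYPE('n) *\<^sub>R trig_fun (m, True)" for m :: "int^'n::_"
    using trig_norm_pos[where 'n = 'n] by (auto simp: trig_fun_def scaleR_fun_def fun_eq_iff)
  have 1: "trig_fun p \<in> trig_space M" if "p \<in> M \<times> UNIV" for p
  proof -
    obtain m b where "p = (m, b)" "m \<in> M" using \<open>p \<in> M \<times> UNIV\<close> by auto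
    then show ?thesis
      unfolding trig_space_def
      by (cases b) (simp_all only: sc(1,2), (intro span_scale span_base, blast)+)
  qed
  have "?C \<subseteq> span (trig_fun ` (M \<times> UNIV))"
    by (auto simp: sc(3,4) intro!: span_scale[OF span_base])
  then have "trig_space M \<subseteq> span (trig_fun ` (M \<times> UNIV))"
    unfolding trig_space_def by (intro span_minimal subspace_span)
  moreover have "span (trig_fun ` (M \<times> UNIV)) \<subseteq> trig_space M"
    using 1 unfolding trig_space_def by (intro span_minimal subspace_span) auto
  moreover have "trig_fun ` (M \<times> UNIV) \<subseteq> trig_space M" using 1 by blast
  moreover have "l2_inner f g = (if f = g then 1 else 0)"
    if fg: "f \<in> trig_fun ` (M \<times> UNIV)" "g \<in> trig_fun ` (M \<times> UNIV)" for f g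
  proof -
    obtain p q where pq: "p \<in> M \<times> UNIV" "q \<in> M \<times> UNIV" "f = trig_fun p" "g = trig_fun q" using fg by auto
    then have "f = g \<longleftrightarrow> p = q" using inj_trig_fun[OF assms(2)] by (auto simp: inj_on_def)
    moreover have "fst p \<in> freq_cone" "fst q \<in> freq_cone" using pq(1,2) assms(2) by auto
    ultimately show ?thesis using trig_fun_orthonormal[of p q] pq(3,4) by simp
  qed
  ultimately show ?thesis using assms(1) by (simp add: l2_orthonormal_basis_def)
qed

lemma dim_trig_space:
  fixes M :: "(int^'n::{finite,linorder}) set"
  assumes "finite M" "M \<subseteq> freq_cone"
  shows "dim (trig_space M) = 2 * card M"
  using dim_eq_card_basis[OF trig_basis[OF assms]] continuous_trig_fun card_image[OF inj_trig_fun[OF assms(2)]]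
  by (auto simp: card_cartesian_product mult.commute)

definition freq_vec :: "int^'n \<Rightarrow> real^'n"
  where "freq_vec m = (\<chi> j. of_int (m $ j))"

lemma phase_eq_inner: "phase m h = freq_vec m \<bullet> h"
  by (simp add: phase_def freq_vec_def inner_vec_def)

definition trig_grad :: "(int^'n) \<times> bool \<Rightarrow> real^'n \<Rightarrow> real^'n"
  where "trig_grad p \<theta> = trig_fun (fst p, \<not> snd p) \<theta> *\<^sub>R (if snd p then freq_vec (fst p) else - freq_vec (fst p))"

definition trig_hess :: "(int^'n) \<times> bool \<Rightarrow> real^'n \<Rightarrow> real^'n^'n"
  where "trig_hess p \<theta> = (\<chi> i j. - (trig_fun p \<theta> * freq_vec (fst p) $ i * freq_vec (fst p) $ j))"

lemma trig_fun_has_derivative: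
  fixes p :: "(int^'n) \<times> bool"
  shows "(trig_fun p has_derivative (\<lambda>h. trig_grad p \<theta> \<bullet> h)) (at \<theta>)"
proof -
  have ph: "(phase m has_derivative phase m) (at \<theta>)" for m :: "int^'n"
    by (rule linear_imp_has_derivative[OF phase_linear])
  show ?thesis
    unfolding trig_fun_def[abs_def] trig_grad_def using trig_norm_pos[where 'n = 'n]
    by (cases "snd p") (auto intro!: derivative_eq_intros ph simp: phase_eq_inner)
qed

lemma trig_hess_mult: "trig_hess p \<theta> *v h = - (trig_fun p \<theta> * (freq_vec (fst p) \<bullet> h)) *\<^sub>R freq_vec (fst p)"
  by (simp add: vec_eq_iff trig_hess_def matrix_vector_mult_def inner_vec_def sum_distrib_left sum_distrib_right mult_ac sum_negf)

lemma trig_grad_has_derivative: "(trig_grad p has_derivative (*v) (trig_hess p \<theta>)) (at \<theta>)"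
proof -
  have "((\<lambda>\<theta>. trig_fun (fst p, \<not> snd p) \<theta> *\<^sub>R (if snd p then freq_vec (fst p) else - freq_vec (fst p))) has_derivative
      (\<lambda>h. (trig_grad (fst p, \<not> snd p) \<theta> \<bullet> h) *\<^sub>R (if snd p then freq_vec (fst p) else - freq_vec (fst p)))) (at \<theta>)"
    by (rule has_derivative_scaleR_left[OF trig_fun_has_derivative])
  moreover have "(trig_grad (fst p, \<not> snd p) \<theta> \<bullet> h) *\<^sub>R (if snd p then freq_vec (fst p) else - freq_vec (fst p)) =
      trig_hess p \<theta> *v h" for h
    unfolding trig_hess_mult trig_grad_def by (cases p; cases "snd p") simp_all
  ultimately show ?thesis by (simp add: trig_grad_def[abs_def])
qed

lemma continuous_trig_hess: "continuous_on UNIV (trig_hess p)"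
  unfolding trig_hess_def[abs_def] by (intro continuous_on_vec_lambda continuous_intros continuous_trig_fun)

lemma trig_fun_sq_sum: "(trig_fun (m, True) \<theta>)\<^sup>2 + (trig_fun (m, False) \<theta>)\<^sup>2 = 2 / (2 * pi) ^ CARD('n)"
  for \<theta> :: "real^'n"
proof -
  have "(trig_fun (m, True) \<theta>)\<^sup>2 + (trig_fun (m, False) \<theta>)\<^sup>2 = ((sin (phase m \<theta>))\<^sup>2 + (cos (phase m \<theta>))\<^sup>2) / (trig_norm TYPE('n))\<^sup>2"
    by (simp add: trig_fun_def power_divide add_divide_distrib[symmetric])
  then show ?thesis by (simp add: trig_norm_def)
qed

lemma sum_freq_pairs:
  fixes f :: "(int^'n) \<times> bool \<Rightarrow> real"
  shows "(\<Sum>p\<in>M \<times> UNIV. f p) = (\<Sum>m\<in>M. f (m, True) + f (m, False))"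
  unfolding sum.cartesian_product' by (simp add: UNIV_bool add.commute)

lemma trig_grad_sum:
  fixes \<tau> :: "real^'n"
  shows "(\<Sum>p\<in>M \<times> UNIV. trig_grad p \<tau> $ j * trig_grad p \<tau> $ k) = 2 / (2 * pi) ^ CARD('n) * (\<Sum>m\<in>M. freq_vec m $ j * freq_vec m $ k)"
proof -
  have "trig_grad (m, True) \<tau> $ j * trig_grad (m, True) \<tau> $ k + trig_grad (m, False) \<tau> $ j * trig_grad (m, False) \<tau> $ k =
      ((trig_fun (m, True) \<tau>)\<^sup>2 + (trig_fun (m, False) \<tau>)\<^sup>2) * (freq_vec m $ j * freq_vec m $ k)" for m
    by (simp add: trig_grad_def power2_eq_square algebra_simps)
  then show ?thesis unfolding sum_freq_pairs by (simp only: trig_fun_sq_sum sum_distrib_left)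
qed

lemma trig_hess_sum:
  fixes \<tau> :: "real^'n"
  shows "(\<Sum>p\<in>M \<times> UNIV. trig_hess p \<tau> $ i $ j * trig_hess p \<tau> $ k $ l) =
    2 / (2 * pi) ^ CARD('n) * (\<Sum>m\<in>M. freq_vec m $ i * freq_vec m $ j * freq_vec m $ k * freq_vec m $ l)"
proof -
  have "trig_hess (m, True) \<tau> $ i $ j * trig_hess (m, True) \<tau> $ k $ l + trig_hess (m, False) \<tau> $ i $ j * trig_hess (m, False) \<tau> $ k $ l =
      ((trig_fun (m, True) \<tau>)\<^sup>2 + (trig_fun (m, False) \<tau>)\<^sup>2) * (freq_vec m $ i * freq_vec m $ j * freq_vec m $ k * freq_vec m $ l)" for m
    by (simp add: trig_hess_def power2_eq_square algebra_simps)
  then show ?thesis unfolding sum_freq_pairs by (simp only: trig_fun_sq_sum sum_distrib_left)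
qed

text \<open>
  For each frequency, the gradient involves the derivative of the wave and the Hessian the wave itself: the
  contributions of the sine and of the cosine have opposite signs.
\<close>

lemma trig_grad_hess_sum: "(\<Sum>p\<in>M \<times> UNIV. trig_grad p \<tau> $ k * trig_hess p \<tau> $ i $ j) = 0"
  unfolding sum_freq_pairs by (rule sum.neutral) (simp add: trig_grad_def trig_hess_def)

definition trig_coef :: "(real^'n \<Rightarrow> real) \<Rightarrow> (int^'n) \<times> bool \<Rightarrow> real"
  where "trig_coef v p = l2_inner v (trig_fun p)"

locale trig_setting =
  fixes M :: "(int^'n::{finite,linorder}) set" and B :: "(real^'n::_ \<Rightarrow> real) set"
  assumes finM: "finite M" and cone: "M \<subseteq> freq_cone"
    and ob: "l2_orthonormal_basis (trig_space M) B"
begin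

text \<open>
  The gradient and the Hessian of \<open>v\<close>, in terms of its trigonometric coefficients. For every
  function of the space they are linear in the coefficients, which brings Parseval's identity to bear on sums
  over \<open>B\<close>.
\<close>

definition G where "G v \<theta> = (\<Sum>p\<in>M \<times> UNIV. trig_coef v p *\<^sub>R trig_grad p \<theta>)"
definition H where "H v \<theta> = (\<Sum>p\<in>M \<times> UNIV. trig_coef v p *\<^sub>R trig_hess p \<theta>)"

lemma expansion: "v \<in> trig_space M \<Longrightarrow> v = (\<Sum>p\<in>M \<times> UNIV. trig_coef v p *\<^sub>R trig_fun p)"
  using comb_inner[OF trig_basis[OF finM cone]] continuous_trig_fun
  by (fastforce simp: sum.reindex[OF inj_trig_fun[OF cone]] trig_coef_def)

lemma B_sub: "b \<in> B \<Longrightarrow> b \<in> trig_space M"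
  using ob by (auto simp: l2_orthonormal_basis_def)

lemma v_has_derivative: "v \<in> trig_space M \<Longrightarrow> (v has_derivative (\<lambda>h. G v \<theta> \<bullet> h)) (at \<theta>)"
proof -
  assume v: "v \<in> trig_space M"
  have "((\<lambda>x. \<Sum>p\<in>M \<times> UNIV. trig_coef v p *\<^sub>R trig_fun p x) has_derivative
      (\<lambda>h. \<Sum>p\<in>M \<times> UNIV. trig_coef v p *\<^sub>R (trig_grad p \<theta> \<bullet> h))) (at \<theta>)"
    by (intro has_derivative_sum has_derivative_scaleR_right trig_fun_has_derivative)
  moreover have "(\<lambda>x. \<Sum>p\<in>M \<times> UNIV. trig_coef v p *\<^sub>R trig_fun p x) = v"
    by (subst (2) expansion[OF v]) (simp add: fun_eq_iff fun_sum_apply scaleR_fun_def)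
  moreover have "(\<lambda>h. \<Sum>p\<in>M \<times> UNIV. trig_coef v p *\<^sub>R (trig_grad p \<theta> \<bullet> h)) = (\<lambda>h. G v \<theta> \<bullet> h)"
    by (simp add: G_def inner_sum_left)
  ultimately show ?thesis by simp
qed

lemma contB: "b \<in> B \<Longrightarrow> continuous_on UNIV b"
  by (rule has_derivative_continuous_on, rule has_derivative_at_withinI, rule v_has_derivative[OF B_sub])

lemma finite_B: "finite B"
  using ob by (simp add: l2_orthonormal_basis_def)

lemma trig_fun_in: "p \<in> M \<times> UNIV \<Longrightarrow> trig_fun p \<in> trig_space M"
  using trig_basis[OF finM cone] by (auto simp: l2_orthonormal_basis_def)

text \<open>
  The inner product of two trigonometric functions, expanded in the basis \<open>B\<close>.
\<close>

lemma parseval: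
  assumes p: "p \<in> M \<times> UNIV" and q: "q \<in> M \<times> UNIV"
  shows "(\<Sum>b\<in>B. trig_coef b p * trig_coef b q) = (if p = q then 1 else 0)"
proof -
  have "l2_inner (\<Sum>b\<in>B. l2_inner (trig_fun p) b *\<^sub>R b) (trig_fun q) = (\<Sum>b\<in>B. l2_inner (trig_fun p) b * l2_inner b (trig_fun q))"
    by (rule l2_inner_sum_left[OF finite_B contB continuous_trig_fun])
  moreover have "(\<Sum>b\<in>B. l2_inner (trig_fun p) b *\<^sub>R b) = trig_fun p"
    by (rule comb_inner[OF ob contB trig_fun_in[OF p]])
  moreover have "l2_inner (trig_fun p) (trig_fun q) = (if p = q then 1 else 0)"
    by (rule trig_fun_orthonormal) (use p q cone in auto)
  ultimately show ?thesis by (simp add: trig_coef_def l2_inner_commute[of "trig_fun p"])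
qed

lemma parseval_bilinear:
  "(\<Sum>b\<in>B. (\<Sum>p\<in>M \<times> UNIV. trig_coef b p * x p) * (\<Sum>q\<in>M \<times> UNIV. trig_coef b q * y q)) = (\<Sum>p\<in>M \<times> UNIV. x p * y p)"
proof -
  have "(\<Sum>b\<in>B. (\<Sum>p\<in>M \<times> UNIV. trig_coef b p * x p) * (\<Sum>q\<in>M \<times> UNIV. trig_coef b q * y q)) =
      (\<Sum>b\<in>B. \<Sum>p\<in>M \<times> UNIV. \<Sum>q\<in>M \<times> UNIV. x p * y q * (trig_coef b p * trig_coef b q))"
    by (simp only: sum_product) (simp add: mult_ac)
  also have "\<dots> = (\<Sum>p\<in>M \<times> UNIV. \<Sum>q\<in>M \<times> UNIV. x p * y q * (\<Sum>b\<in>B. trig_coef b p * trig_coef b q))"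
    by (subst sum.swap, rule sum.cong[OF refl], subst sum.swap) (simp only: sum_distrib_left)
  also have "\<dots> = (\<Sum>p\<in>M \<times> UNIV. \<Sum>q\<in>M \<times> UNIV. if p = q then x p * y q else 0)"
    by (intro sum.cong refl) (simp only: parseval, simp)
  also have "\<dots> = (\<Sum>p\<in>M \<times> UNIV. x p * y p)"
    using finM by (intro sum.cong refl) (simp add: sum.delta)
  finally show ?thesis .
qed

lemma cov_eq:
  assumes "\<And>b. f b = (\<Sum>p\<in>M \<times> UNIV. trig_coef b p * x p)" "\<And>b. g b = (\<Sum>q\<in>M \<times> UNIV. trig_coef b q * y q)"
  shows "(\<Sum>b\<in>B. f b * g b) = (\<Sum>p\<in>M \<times> UNIV. x p * y p)"
  unfolding assms by (rule parseval_bilinear)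

lemma G_cov: "(\<Sum>b\<in>B. G b \<tau> $ j * G b \<tau> $ k) = 2 / (2 * pi) ^ CARD('n) * (\<Sum>m\<in>M. freq_vec m $ j * freq_vec m $ k)"
  unfolding trig_grad_sum[where M = M and \<tau> = \<tau>, symmetric] by (rule cov_eq) (simp_all add: G_def)

lemma H_cov: "(\<Sum>b\<in>B. H b \<tau> $ i $ j * H b \<tau> $ k $ l) =
    2 / (2 * pi) ^ CARD('n) * (\<Sum>m\<in>M. freq_vec m $ i * freq_vec m $ j * freq_vec m $ k * freq_vec m $ l)"
  unfolding trig_hess_sum[where M = M and \<tau> = \<tau>, symmetric] by (rule cov_eq) (simp_all add: H_def)

lemma GH_cov: "(\<Sum>b\<in>B. G b \<tau> $ k * H b \<tau> $ i $ j) = 0"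
  unfolding trig_grad_hess_sum[where M = M and \<tau> = \<tau> and k = k and i = i and j = j, symmetric]
  by (rule cov_eq) (simp_all add: G_def H_def)

lemma G_has_derivative: "(G v has_derivative (*v) (H v \<theta>)) (at \<theta>)"
proof -
  have "(G v has_derivative (\<lambda>h. \<Sum>p\<in>M \<times> UNIV. trig_coef v p *\<^sub>R (trig_hess p \<theta> *v h))) (at \<theta>)"
    unfolding G_def[abs_def] by (intro has_derivative_sum has_derivative_scaleR_right trig_grad_has_derivative)
  moreover have "(\<lambda>h. \<Sum>p\<in>M \<times> UNIV. trig_coef v p *\<^sub>R (trig_hess p \<theta> *v h)) = (*v) (H v \<theta>)"
    by (simp add: fun_eq_iff H_def matrix_sum_vector_mult)
  ultimately show ?thesis by simp
qed

lemma continuous_H: "continuous_on UNIV (H v)"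
  unfolding H_def[abs_def] by (intro continuous_intros continuous_trig_hess)

lemma gauss_field:
  assumes "0 < S" "\<And>j k. 2 / (2 * pi) ^ CARD('n) * (\<Sum>m\<in>M. freq_vec m $ j * freq_vec m $ k) = (if j = k then S else 0)"
  shows "gauss_field B G H S"
  by unfold_locales (rule finite_B G_has_derivative continuous_H assms(1) GH_cov | simp only: G_cov assms(2))+

end

section \<open>Critical points on the torus\<close>

lemma equiv_torus_rel: "equiv UNIV (torus_rel :: ((real^'n) \<times> (real^'n)) set)"
proof (rule equivI)
  show "refl_on UNIV (torus_rel :: ((real^'n) \<times> (real^'n)) set)"
    unfolding torus_rel_def by (rule refl_onI) (auto intro!: exI[of _ 0])
  show "sym (torus_rel :: ((real^'n) \<times> (real^'n)) set)"
  proof (rule symI)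
    fix x y :: "real^'n" assume "(x, y) \<in> torus_rel"
    then obtain k where "\<And>j. y $ j - x $ j = 2 * pi * of_int (k j)" unfolding torus_rel_def by simp metis
    then have "x $ j - y $ j = 2 * pi * of_int (- k j)" for j by (simp add: algebra_simps)
    then show "(y, x) \<in> torus_rel" unfolding torus_rel_def by blast
  qed
  show "trans (torus_rel :: ((real^'n) \<times> (real^'n)) set)"
  proof (rule transI)
    fix x y z :: "real^'n" assume "(x, y) \<in> torus_rel" "(y, z) \<in> torus_rel"
    then obtain k l where "\<And>j. y $ j - x $ j = 2 * pi * of_int (k j)" "\<And>j. z $ j - y $ j = 2 * pi * of_int (l j)"
      unfolding torus_rel_def by simp metis
    then have "z $ j - x $ j = 2 * pi * of_int (k j + l j)" for j
      by (simp add: algebra_simps)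
    then show "(x, z) \<in> torus_rel" unfolding torus_rel_def by blast
  qed
qed auto

lemma period_cell_unique:
  assumes "x \<in> period_cell" "y \<in> period_cell" "(x, y) \<in> torus_rel"
  shows "x = y"
proof -
  have "x $ j = y $ j" for j
  proof -
    obtain k :: int where k: "y $ j - x $ j = 2 * pi * of_int k" using assms(3) by (auto simp: torus_rel_def)
    have b: "0 \<le> x $ j" "x $ j < 2 * pi" "0 \<le> y $ j" "y $ j < 2 * pi" using assms(1,2) by (auto simp: period_cell_def)
    have "2 * pi * of_int k < 2 * pi * 1" "2 * pi * (- 1) < 2 * pi * of_int k" using k b by linarith+
    then have "of_int k < (1 :: real)" "(- 1 :: real) < of_int k"
      unfolding mult_less_cancel_left_pos[of "2 * pi", OF mult_pos_pos[OF zero_less_numeral pi_gt_zero]] by auto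
    then have "k = 0" by linarith
    then show ?thesis using k by simp
  qed
  then show ?thesis by (simp add: vec_eq_iff)
qed

lemma period_cell_representative: "\<exists>y\<in>period_cell. (x, y) \<in> torus_rel"
proof -
  define y where "y = (\<chi> j. x $ j - 2 * pi * of_int \<lfloor>x $ j / (2 * pi)\<rfloor>)"
  have "0 \<le> y $ j \<and> y $ j < 2 * pi" for j
  proof -
    have "of_int \<lfloor>x $ j / (2 * pi)\<rfloor> \<le> x $ j / (2 * pi)" "x $ j / (2 * pi) < of_int \<lfloor>x $ j / (2 * pi)\<rfloor> + 1"
      by linarith+
    then have "of_int \<lfloor>x $ j / (2 * pi)\<rfloor> * (2 * pi) \<le> x $ j" "x $ j < (of_int \<lfloor>x $ j / (2 * pi)\<rfloor> + 1) * (2 * pi)"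
      by (simp_all only: pos_le_divide_eq pos_divide_less_eq mult_pos_pos zero_less_numeral pi_gt_zero)
    then show ?thesis by (simp add: y_def algebra_simps)
  qed
  then have "y \<in> period_cell" by (simp add: period_cell_def)
  moreover have "y $ j - x $ j = 2 * pi * of_int (- \<lfloor>x $ j / (2 * pi)\<rfloor>)" for j by (simp add: y_def)
  then have "(x, y) \<in> torus_rel" unfolding torus_rel_def by blast
  ultimately show ?thesis by blast
qed

lemma phase_torus_rel:
  assumes "(x, y) \<in> torus_rel"
  shows "\<exists>N :: int. phase m y = phase m x + 2 * pi * of_int N"
proof -
  obtain k where k: "\<And>j. y $ j - x $ j = 2 * pi * of_int (k j)"
    using assms unfolding torus_rel_def by simp metis
  have "phase m y - phase m x = (\<Sum>j\<in>UNIV. of_int (m $ j) * (y $ j - x $ j))"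
    by (simp add: phase_def sum_subtractf right_diff_distrib)
  also have "\<dots> = 2 * pi * of_int (\<Sum>j\<in>UNIV. m $ j * k j)"
    by (simp add: k sum_distrib_left mult_ac)
  finally show ?thesis by (intro exI[of _ "\<Sum>j\<in>UNIV. m $ j * k j"]) (simp add: algebra_simps)
qed

lemma trig_fun_periodic:
  assumes "(x, y) \<in> torus_rel" shows "trig_fun p y = trig_fun p x"
proof -
  obtain N :: int where "phase (fst p) y = phase (fst p) x + 2 * pi * of_int N"
    using phase_torus_rel[OF assms] by blast
  then show ?thesis by (simp add: trig_fun_def sin_add cos_add)
qed

context trig_setting
begin

lemma G_periodic: "(x, y) \<in> torus_rel \<Longrightarrow> G v y = G v x"
  by (simp add: G_def trig_grad_def trig_fun_periodic)

lemma critical_iff: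
  "((\<Sum>b\<in>B. c b *\<^sub>R b) has_derivative (\<lambda>_. 0)) (at \<theta>) \<longleftrightarrow> (\<Sum>b\<in>B. c b *\<^sub>R G b \<theta>) = 0"
proof -
  have "((\<lambda>x. \<Sum>b\<in>B. c b *\<^sub>R b x) has_derivative (\<lambda>h. \<Sum>b\<in>B. c b *\<^sub>R (G b \<theta> \<bullet> h))) (at \<theta>)"
    by (intro has_derivative_sum has_derivative_scaleR_right v_has_derivative B_sub)
  moreover have "(\<Sum>b\<in>B. c b *\<^sub>R b) = (\<lambda>x. \<Sum>b\<in>B. c b *\<^sub>R b x)"
    by (simp add: fun_eq_iff fun_sum_apply scaleR_fun_def)
  ultimately have d: "((\<Sum>b\<in>B. c b *\<^sub>R b) has_derivative (\<lambda>h. (\<Sum>b\<in>B. c b *\<^sub>R G b \<theta>) \<bullet> h)) (at \<theta>)"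
    by (simp add: inner_sum_left)
  show ?thesis
  proof
    assume "((\<Sum>b\<in>B. c b *\<^sub>R b) has_derivative (\<lambda>_. 0)) (at \<theta>)"
    from has_derivative_unique[OF d this] show "(\<Sum>b\<in>B. c b *\<^sub>R G b \<theta>) = 0"
      by (metis inner_eq_zero_iff)
  qed (use d in simp)
qed

text \<open>
  Each class of the torus has exactly one representative in the half-open period cell.
\<close>

lemma num_critical_eq:
  "num_critical (\<Sum>b\<in>B. c b *\<^sub>R b) = num_elems {\<theta> \<in> period_cell. (\<Sum>b\<in>B. c b *\<^sub>R G b \<theta>) = 0}"
proof -
  let ?g = "\<lambda>\<theta>. \<Sum>b\<in>B. c b *\<^sub>R G b \<theta>"
  have per: "?g y = ?g x" if "(x, y) \<in> torus_rel" for x y using G_periodic[OF that] by simp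
  have "bij_betw (\<lambda>\<theta>. torus_rel `` {\<theta>}) {\<theta> \<in> period_cell. ?g \<theta> = 0} (critical_points (\<Sum>b\<in>B. c b *\<^sub>R b))"
    unfolding bij_betw_def
  proof
    show "inj_on (\<lambda>\<theta>. torus_rel `` {\<theta>}) {\<theta> \<in> period_cell. ?g \<theta> = 0}"
    proof (rule inj_onI)
      fix x y assume "x \<in> {\<theta> \<in> period_cell. ?g \<theta> = 0}" "y \<in> {\<theta> \<in> period_cell. ?g \<theta> = 0}"
        "torus_rel `` {x} = torus_rel `` {y}"
      then show "x = y"
        using period_cell_unique[of x y] eq_equiv_class[OF _ equiv_torus_rel, of x y] by auto
    qed
    show "(\<lambda>\<theta>. torus_rel `` {\<theta>}) ` {\<theta> \<in> period_cell. ?g \<theta> = 0} = critical_points (\<Sum>b\<in>B. c b *\<^sub>R b)"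
    proof (intro equalityI subsetI)
      fix P assume "P \<in> (\<lambda>\<theta>. torus_rel `` {\<theta>}) ` {\<theta> \<in> period_cell. ?g \<theta> = 0}"
      then obtain \<theta> where "P = torus_rel `` {\<theta>}" "?g \<theta> = 0" by auto
      then show "P \<in> critical_points (\<Sum>b\<in>B. c b *\<^sub>R b)"
        unfolding critical_points_def critical_iff
        using equiv_class_self[OF equiv_torus_rel, of \<theta>] by (auto intro: quotientI)
    next
      fix P assume "P \<in> critical_points (\<Sum>b\<in>B. c b *\<^sub>R b)"
      then obtain x \<theta> where P: "P = torus_rel `` {x}" "(x, \<theta>) \<in> torus_rel" "?g \<theta> = 0"
        unfolding critical_points_def critical_iff by (auto elim!: quotientE)
      obtain y where y: "y \<in> period_cell" "(x, y) \<in> torus_rel" using period_cell_representative by blast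
      have "?g y = 0" using per[OF y(2)] per[OF P(2)] P(3) by simp
      moreover have "P = torus_rel `` {y}" unfolding P(1) by (rule equiv_class_eq[OF equiv_torus_rel y(2)])
      ultimately show "P \<in> (\<lambda>\<theta>. torus_rel `` {\<theta>}) ` {\<theta> \<in> period_cell. ?g \<theta> = 0}"
        using y(1) by blast
    qed
  qed
  then show ?thesis
    unfolding num_critical_def
    by (simp add: emeasure_count_space bij_betw_finite bij_betw_same_card)
qed

end

text \<open>
  The Kac-Rice formula on the torus. What remains to be found is the scale \<open>S\<close> of the gradient,
  and the expectation \<open>h\<close> of the absolute Hessian determinant at a point.
\<close>

lemma mean_critical_eq:
  fixes M :: "(int^'n::{finite,linorder}) set"
  defines "B \<equiv> SOME B. l2_orthonormal_basis (trig_space M) B"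
  assumes M: "finite M" "M \<subseteq> freq_cone" "M \<noteq> {}" and S: "0 < S"
    and iso: "\<And>j k. 2 / (2 * pi) ^ CARD('n) * (\<Sum>m\<in>M. freq_vec m $ j * freq_vec m $ k) = (if j = k then S else 0)"
    and h: "\<And>\<tau>. (\<integral>\<^sup>+ c. ennreal (gauss_coords B c * \<bar>det (\<Sum>b\<in>B. c b *\<^sub>R trig_setting.H M b \<tau>)\<bar>) \<partial>leb_coords B) = ennreal h" "0 \<le> h"
  shows "mean_critical M = ennreal ((2 * pi) ^ CARD('n) * ((1 / sqrt (2 * pi * S)) ^ CARD('n) * h))"
proof -
  have ob: "l2_orthonormal_basis (trig_space M) B"
    unfolding B_def by (rule someI[where P = "l2_orthonormal_basis (trig_space M)", OF trig_basis[OF M(1,2)]])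
  interpret trig_setting M B by unfold_locales (rule M ob)+
  interpret gf: gauss_field B G H S by (rule gauss_field[OF S iso])
  have grad: "gf.grad c \<theta> = (\<Sum>b\<in>B. c b *\<^sub>R G b \<theta>)" for c \<theta> by (rule gf.grad_def)
  have hess: "gf.hess c \<theta> = (\<Sum>b\<in>B. c b *\<^sub>R H b \<theta>)" for c \<theta> by (rule gf.hess_def)
  have "B \<noteq> {}"
  proof
    assume "B = {}"
    then have "dim (trig_space M) = 0" using dim_eq_card_basis[OF ob contB] by simp
    then show False using dim_trig_space[OF M(1,2)] M by simp
  qed
  have num: "num_critical (\<Sum>b\<in>B. c b *\<^sub>R b) = num_elems {\<theta> \<in> period_cell. gf.grad c \<theta> = 0}" for c
    unfolding grad by (rule num_critical_eq)
  have cell: "(\<Union>n :: nat. cbox 0 (\<chi> j. (\<chi> j :: 'n. 2 * pi) $ j - 1 / real (Suc n))) = period_cell"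
    unfolding half_open_box_eq_UN by (simp add: period_cell_def)
  have meas: "(\<lambda>c. num_critical (\<Sum>b\<in>B. c b *\<^sub>R b)) \<in> borel_measurable (leb_coords B)"
    unfolding num cell[symmetric]
    by (rule borel_measurable_num_zeros[OF compact_cbox half_open_box_eq_UN(2)])
       (auto intro: gf.cont_grad gf.borel_grad)
  have "mean_critical M = (\<integral>\<^sup>+ c. ennreal (gauss_coords B c) * num_critical (\<Sum>b\<in>B. c b *\<^sub>R b) \<partial>leb_coords B)"
    unfolding mean_critical_def Let_def
    by (rule sphere_mean_eq_gauss_mean[of "trig_space M", folded B_def, OF ob contB \<open>B \<noteq> {}\<close> meas])
  also have "\<dots> = ennreal ((2 * pi) ^ CARD('n) * ((1 / sqrt (2 * pi * S)) ^ CARD('n) * h))"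
    unfolding num by (rule gf.expected_zeros_period_cell) (use h in \<open>simp_all add: hess\<close>)
  finally show ?thesis .
qed

section \<open>Power sums over boxes of frequencies\<close>

definition int_box :: "nat \<Rightarrow> (int^'n) set"
  where "int_box \<nu> = {m. \<forall>j. \<bar>m $ j\<bar> \<le> int \<nu>}"

definition power_sum :: "nat \<Rightarrow> nat \<Rightarrow> real"
  where "power_sum \<nu> e = (\<Sum>k\<in>{- int \<nu>..int \<nu>}. of_int k ^ e)"

lemma int_box_bij: "bij_betw (\<lambda>m j. m $ j) (int_box \<nu> :: (int^'n) set) (PiE UNIV (\<lambda>_. {- int \<nu>..int \<nu>}))"
  by (rule bij_betw_byWitness[of _ "\<lambda>f. \<chi> j. f j"]) (auto simp: int_box_def abs_le_iff minus_le_iff PiE_iff)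

lemma finite_int_box: "finite (int_box \<nu> :: (int^'n) set)"
  using bij_betw_finite[OF int_box_bij[of \<nu>]] by (simp add: finite_PiE)

lemma sum_int_box_prod:
  fixes g :: "'n::finite \<Rightarrow> int \<Rightarrow> real"
  shows "(\<Sum>m\<in>int_box \<nu>. \<Prod>t\<in>UNIV. g t (m $ t)) = (\<Prod>t\<in>UNIV. \<Sum>k\<in>{- int \<nu>..int \<nu>}. g t k)"
proof -
  have "(\<Prod>t\<in>UNIV. \<Sum>k\<in>{- int \<nu>..int \<nu>}. g t k) = (\<Sum>f\<in>PiE UNIV (\<lambda>_. {- int \<nu>..int \<nu>}). \<Prod>t\<in>UNIV. g t (f t))"
    by (rule prod_sum_PiE) auto
  also have "\<dots> = (\<Sum>m\<in>int_box \<nu>. \<Prod>t\<in>UNIV. g t (m $ t))"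
    by (rule sum.reindex_bij_betw[OF int_box_bij, symmetric])
  finally show ?thesis by simp
qed

lemma power_sum_Suc: "power_sum (Suc \<nu>) e = power_sum \<nu> e + real (Suc \<nu>) ^ e + (- real (Suc \<nu>)) ^ e"
proof -
  have "{- int (Suc \<nu>)..int (Suc \<nu>)} = insert (int (Suc \<nu>)) (insert (- int (Suc \<nu>)) {- int \<nu>..int \<nu>})"
    by auto
  then show ?thesis by (simp add: power_sum_def)
qed

lemma power_sum_0: "power_sum \<nu> 0 = 2 * real \<nu> + 1"
  by (induction \<nu>) (simp add: power_sum_def, simp add: power_sum_Suc)

lemma power_sum_odd: "odd e \<Longrightarrow> power_sum \<nu> e = 0"
proof (induction \<nu>)
  case 0
  then show ?case by (simp add: power_sum_def odd_pos)
qed (simp add: power_sum_Suc power_minus_odd del: of_nat_Suc)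

lemma power_sum_2: "power_sum \<nu> 2 = power_sum \<nu> 0 * (real \<nu> * (real \<nu> + 1) / 3)"
  unfolding power_sum_0
  by (induction \<nu>) (simp add: power_sum_def, simp add: power_sum_Suc field_simps power2_eq_square)

lemma power_sum_4: "power_sum \<nu> 4 = power_sum \<nu> 0 * (real \<nu> * (real \<nu> + 1) * (3 * real \<nu> ^ 2 + 3 * real \<nu> - 1) / 15)"
  unfolding power_sum_0
  by (induction \<nu>) (simp add: power_sum_def, simp add: power_sum_Suc field_simps power2_eq_square power4_eq_xxxx)

text \<open>
  Normalizing by the number of points makes the coordinates behave like independent random variables, each
  uniformly distributed on \<open>{- \<nu>..\<nu>}\<close>.
\<close>

lemma sum_int_box_pow:
  fixes e :: "'n::finite \<Rightarrow> nat"
  shows "(\<Sum>m\<in>int_box \<nu>. \<Prod>t\<in>UNIV. of_int (m $ t) ^ e t) =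
    power_sum \<nu> 0 ^ CARD('n) * (\<Prod>t\<in>UNIV. power_sum \<nu> (e t) / power_sum \<nu> 0)"
proof -
  have nz: "power_sum \<nu> 0 \<noteq> 0" by (simp add: power_sum_0)
  have "(\<Sum>m\<in>int_box \<nu>. \<Prod>t\<in>UNIV. of_int (m $ t) ^ e t) = (\<Prod>t\<in>(UNIV :: 'n set). power_sum \<nu> (e t))"
    unfolding power_sum_def by (rule sum_int_box_prod)
  then show ?thesis using nz by (simp add: prod_dividef)
qed

lemma sum_pairs_int_box:
  "(\<Sum>m\<in>(int_box \<nu> :: (int^'n) set). freq_vec m $ j * freq_vec m $ k) =
    power_sum \<nu> 0 ^ CARD('n) * (if j = k then power_sum \<nu> 2 / power_sum \<nu> 0 else 0)"
proof -
  have nz: "power_sum \<nu> 0 \<noteq> 0" by (simp add: power_sum_0)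
  define e :: "'n \<Rightarrow> nat" where "e = (\<lambda>t. of_bool (t = j) + of_bool (t = k))"
  have "freq_vec m $ j * freq_vec m $ k = (\<Prod>t\<in>UNIV. of_int (m $ t) ^ e t)" for m :: "int^'n"
    by (simp add: e_def power_add prod.distrib freq_vec_def of_bool_def if_distrib[of "\<lambda>n. _ ^ n"] prod.delta cong: if_cong)
  moreover have "(\<Prod>t\<in>UNIV. power_sum \<nu> (e t) / power_sum \<nu> 0) = (if j = k then power_sum \<nu> 2 / power_sum \<nu> 0 else 0)"
  proof (cases "j = k")
    case True
    then have "power_sum \<nu> (e t) / power_sum \<nu> 0 = (if t = k then power_sum \<nu> 2 / power_sum \<nu> 0 else 1)" for t
      using nz by (simp add: e_def numeral_2_eq_2)
    with True show ?thesis by (simp add: prod.delta)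
  next
    case False
    then have "power_sum \<nu> (e j) / power_sum \<nu> 0 = 0" by (simp add: e_def power_sum_odd)
    with False show ?thesis by (auto intro!: prod_zero)
  qed
  ultimately show ?thesis by (simp only: sum_int_box_pow)
qed

text \<open>
  The fourth moments of independent symmetric coordinates: a term survives only if the indices pair up. With
  \<open>i \<le> j\<close> and \<open>k \<le> l\<close>, the pairings are \<open>i = j, k = l\<close> and
  \<open>i = k, j = l\<close>.
\<close>

lemma sum_quadruples_int_box:
  fixes i j k l :: "'n::{finite,linorder}"
  assumes "i \<le> j" "k \<le> l"
  shows "(\<Sum>m\<in>(int_box \<nu> :: (int^'n::_) set). freq_vec m $ i * freq_vec m $ j * freq_vec m $ k * freq_vec m $ l) =
    power_sum \<nu> 0 ^ CARD('n) *
      (if i = j \<and> k = l then if i = k then power_sum \<nu> 4 / power_sum \<nu> 0 else (power_sum \<nu> 2 / power_sum \<nu> 0)\<^sup>2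
       else if i = k \<and> j = l then (power_sum \<nu> 2 / power_sum \<nu> 0)\<^sup>2 else 0)"
proof -
  have nz: "power_sum \<nu> 0 \<noteq> 0" by (simp add: power_sum_0)
  define e :: "'n \<Rightarrow> nat" where "e = (\<lambda>t. of_bool (t = i) + of_bool (t = j) + of_bool (t = k) + of_bool (t = l))"
  let ?P = "\<Prod>t\<in>UNIV. power_sum \<nu> (e t) / power_sum \<nu> 0" and ?s = "power_sum \<nu> 2 / power_sum \<nu> 0"
  have "freq_vec m $ i * freq_vec m $ j * freq_vec m $ k * freq_vec m $ l = (\<Prod>t\<in>UNIV. of_int (m $ t) ^ e t)" for m :: "int^'n::_"
    by (simp add: e_def power_add prod.distrib freq_vec_def of_bool_def if_distrib[of "\<lambda>n. _ ^ n"] prod.delta cong: if_cong)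
  moreover have "?P = (if i = j \<and> k = l then if i = k then power_sum \<nu> 4 / power_sum \<nu> 0 else ?s\<^sup>2
       else if i = k \<and> j = l then ?s\<^sup>2 else 0)"
  proof -
    have pair: "?P = ?s\<^sup>2" if "a \<noteq> b" "\<And>t. e t = (if t = a then 2 else if t = b then 2 else 0)" for a b
    proof -
      have "power_sum \<nu> (e t) / power_sum \<nu> 0 = (if t = a then ?s else 1) * (if t = b then ?s else 1)" for t
        using that nz by simp
      then show ?thesis by (simp add: prod.distrib prod.delta power2_eq_square)
    qed
    have zero: "?P = 0" if "odd (e t)" for t
      by (intro prod_zero bexI[of _ t]) (simp_all add: power_sum_odd that)
    consider "i = j" "k = l" "i = k" | "i = j" "k = l" "i \<noteq> k" | "i \<noteq> j" "i = k" "j = l"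
      | "\<not> (i = j \<and> k = l)" "\<not> (i = k \<and> j = l)" by blast
    then show ?thesis
    proof cases
      case 1
      then have "power_sum \<nu> (e t) / power_sum \<nu> 0 = (if t = i then power_sum \<nu> 4 / power_sum \<nu> 0 else 1)" for t
        using nz by (simp add: e_def eval_nat_numeral)
      with 1 show ?thesis by (simp add: prod.delta)
    next
      case 2
      have "?P = ?s\<^sup>2" by (rule pair[of i k]) (use 2 in \<open>auto simp: e_def\<close>)
      with 2 show ?thesis by simp
    next
      case 3
      have "?P = ?s\<^sup>2" by (rule pair[of i j]) (use 3 in \<open>auto simp: e_def\<close>)
      with 3 show ?thesis by simp
    next
      case 4
      have "\<exists>t. odd (e t)"
      proof (rule ccontr)
        assume "\<nexists>t. odd (e t)"
        then have "even (e i)" "even (e j)" "even (e k)" "even (e l)" by auto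
        then show False using 4 assms
          by (auto simp: e_def of_bool_def split: if_splits)
      qed
      then show ?thesis using zero 4 by auto
    qed
  qed
  ultimately show ?thesis by (simp only: sum_int_box_pow)
qed

text \<open>
  Of any two opposite nonzero frequencies exactly one lies in the cone.
\<close>

lemma int_box_split:
  fixes \<nu> :: nat
  defines "F \<equiv> freq_box \<nu> :: (int^'n::{finite,linorder}) set"
  shows "int_box \<nu> = insert 0 (F \<union> uminus ` F)" "0 \<notin> F \<union> uminus ` F" "F \<inter> uminus ` F = {}"
proof -
  have cone: "m \<in> freq_cone \<or> - m \<in> freq_cone" if "m \<noteq> 0" for m :: "int^'n::_"
  proof -
    have ne: "{j. m $ j \<noteq> 0} \<noteq> {}" using that by (auto simp: vec_eq_iff)
    define j where "j = Min {j. m $ j \<noteq> 0}"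
    have j: "m $ j \<noteq> 0" using Min_in[of "{j. m $ j \<noteq> 0}"] ne by (simp add: j_def)
    have lt: "m $ i = 0" if "i < j" for i
    proof (rule ccontr)
      assume "m $ i \<noteq> 0"
      then have "j \<le> i" unfolding j_def by (intro Min_le) auto
      with that show False by simp
    qed
    show ?thesis
    proof (cases "m $ j > 0")
      case True
      then show ?thesis using lt by (auto simp: freq_cone_def)
    next
      case False
      then have "(- m) $ j > 0" using j by simp
      then show ?thesis using lt by (auto simp: freq_cone_def)
    qed
  qed
  show "int_box \<nu> = insert 0 (F \<union> uminus ` F)"
  proof (rule set_eqI)
    fix m :: "int^'n::_"
    have "- m \<in> F \<Longrightarrow> m \<in> uminus ` F" by (metis image_eqI minus_minus)
    moreover have "m \<in> int_box \<nu> \<Longrightarrow> m \<noteq> 0 \<Longrightarrow> m \<in> F \<or> - m \<in> F"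
      using cone[of m] by (auto simp: F_def freq_box_def int_box_def)
    ultimately show "m \<in> int_box \<nu> \<longleftrightarrow> m \<in> insert 0 (F \<union> uminus ` F)"
      by (auto simp: F_def freq_box_def int_box_def)
  qed
  show "0 \<notin> F \<union> uminus ` F" by (auto simp: F_def freq_box_def freq_cone_def)
  show "F \<inter> uminus ` F = {}"
  proof -
    have "m \<noteq> - m'" if "m \<in> F" "m' \<in> F" for m m'
      using freq_cone_add_nonzero[of m m'] that by (auto simp: F_def freq_box_def eq_neg_iff_add_eq_0)
    then show ?thesis by blast
  qed
qed

lemma finite_freq_box: "finite (freq_box \<nu> :: (int^'n::{finite,linorder}) set)"
  by (rule finite_subset[OF _ finite_int_box[of \<nu>]]) (auto simp: freq_box_def int_box_def)

lemma sum_freq_box: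
  fixes f :: "int^'n::{finite,linorder} \<Rightarrow> real"
  assumes "f 0 = 0" "\<And>m. f (- m) = f m"
  shows "2 * (\<Sum>m\<in>freq_box \<nu>. f m) = (\<Sum>m\<in>int_box \<nu>. f m)"
proof -
  have "(\<Sum>m\<in>uminus ` freq_box \<nu>. f m) = (\<Sum>m\<in>freq_box \<nu>. f m)"
    by (simp add: sum.reindex assms)
  then show ?thesis
    unfolding int_box_split(1) using int_box_split(2,3)[of \<nu>, where 'n = 'n] finite_freq_box[of \<nu>, where 'n = 'n]
    by (simp add: sum.union_disjoint assms)
qed

lemma card_freq_box: "2 * card (freq_box \<nu> :: (int^'n::{finite,linorder}) set) + 1 = (2 * \<nu> + 1) ^ CARD('n)"
proof -
  have "card (int_box \<nu> :: (int^'n::_) set) = card (PiE (UNIV :: 'n set) (\<lambda>_. {- int \<nu>..int \<nu>}))"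
    by (rule bij_betw_same_card[OF int_box_bij])
  also have "\<dots> = (2 * \<nu> + 1) ^ CARD('n)"
  proof -
    have "nat (2 * int \<nu> + 1) = Suc (2 * \<nu>)" by linarith
    then show ?thesis by (simp add: card_PiE)
  qed
  finally have "card (int_box \<nu> :: (int^'n::_) set) = (2 * \<nu> + 1) ^ CARD('n)" .
  moreover have "card (int_box \<nu> :: (int^'n::_) set) = 2 * card (freq_box \<nu> :: (int^'n::_) set) + 1"
    unfolding int_box_split(1) using int_box_split(2,3)[of \<nu>, where 'n = 'n] finite_freq_box[of \<nu>, where 'n = 'n]
    by (simp add: card_Un_disjoint card_image)
  ultimately show ?thesis by simp
qed

lemma sum_pairs_freq_box:
  "2 * (\<Sum>m\<in>(freq_box \<nu> :: (int^'n::{finite,linorder}) set). freq_vec m $ j * freq_vec m $ k) =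
    power_sum \<nu> 0 ^ CARD('n) * (if j = k then power_sum \<nu> 2 / power_sum \<nu> 0 else 0)"
  unfolding sum_pairs_int_box[symmetric] by (rule sum_freq_box) (simp_all add: freq_vec_def)

lemma sum_quadruples_freq_box:
  fixes i j k l :: "'n::{finite,linorder}"
  assumes "i \<le> j" "k \<le> l"
  shows "2 * (\<Sum>m\<in>(freq_box \<nu> :: (int^'n::_) set). freq_vec m $ i * freq_vec m $ j * freq_vec m $ k * freq_vec m $ l) =
    power_sum \<nu> 0 ^ CARD('n) *
      (if i = j \<and> k = l then if i = k then power_sum \<nu> 4 / power_sum \<nu> 0 else (power_sum \<nu> 2 / power_sum \<nu> 0)\<^sup>2
       else if i = k \<and> j = l then (power_sum \<nu> 2 / power_sum \<nu> 0)\<^sup>2 else 0)"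
  unfolding sum_quadruples_int_box[OF assms, symmetric] by (rule sum_freq_box) (simp_all add: freq_vec_def)

section \<open>Gaussian symmetric matrices\<close>

lemma idx_le: "idx_row p \<le> idx_col p"
  using Rep_sym_index[of p] by (auto simp: idx_row_def idx_col_def split_beta)

lemma idx_eqI: "idx_row p = idx_row q \<Longrightarrow> idx_col p = idx_col q \<Longrightarrow> p = q"
  by (metis Rep_sym_index_inject idx_col_def idx_row_def prod_eqI)

lemma idx_Abs: "i \<le> j \<Longrightarrow> idx_row (Abs_sym_index (i, j)) = i \<and> idx_col (Abs_sym_index (i, j)) = j"
  by (simp add: idx_row_def idx_col_def Abs_sym_index_inverse)

lemma sym_of_coords_nth:
  fixes x :: "real^('n::{finite,linorder} sym_index)"
  assumes "i \<le> j"
  shows "sym_of_coords x $ i $ j = x $ Abs_sym_index (i, j)" "sym_of_coords x $ j $ i = x $ Abs_sym_index (i, j)"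
proof -
  have iff: "i = idx_row p \<and> j = idx_col p \<or> i = idx_col p \<and> j = idx_row p \<longleftrightarrow> p = Abs_sym_index (i, j)"
    "j = idx_row p \<and> i = idx_col p \<or> j = idx_col p \<and> i = idx_row p \<longleftrightarrow> p = Abs_sym_index (i, j)" for p
    using idx_le[of p] idx_Abs[OF assms] assms by (auto intro!: idx_eqI)
  have "sym_of_coords x $ i $ j = (\<Sum>p\<in>UNIV. if p = Abs_sym_index (i, j) then x $ p else 0)"
    by (simp add: sym_of_coords_def sym_unit_def iff if_distrib[of "\<lambda>y. _ * y"] cong: if_cong)
  then show "sym_of_coords x $ i $ j = x $ Abs_sym_index (i, j)" by (simp add: sum.delta)
  have "sym_of_coords x $ j $ i = (\<Sum>p\<in>UNIV. if p = Abs_sym_index (i, j) then x $ p else 0)"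
    by (simp add: sym_of_coords_def sym_unit_def iff if_distrib[of "\<lambda>y. _ * y"] cong: if_cong)
  then show "sym_of_coords x $ j $ i = x $ Abs_sym_index (i, j)" by (simp add: sum.delta)
qed

definition coords_of_sym :: "real^('n::{finite,linorder})^('n::{finite,linorder}) \<Rightarrow> real^('n::{finite,linorder} sym_index)"
  where "coords_of_sym X = (\<chi> p. X $ idx_row p $ idx_col p)"

lemma sym_of_coords_of_sym:
  assumes "\<And>i j. X $ i $ j = X $ j $ i"
  shows "sym_of_coords (coords_of_sym X) = X"
  unfolding vec_eq_iff
proof (intro allI)
  fix i j
  show "sym_of_coords (coords_of_sym X) $ i $ j = X $ i $ j"
  proof (cases "i \<le> j")
    case True
    then show ?thesis by (simp add: sym_of_coords_nth(1) coords_of_sym_def idx_Abs)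
  next
    case False
    then have "j \<le> i" by simp
    then show ?thesis by (simp add: sym_of_coords_nth(2) coords_of_sym_def idx_Abs assms[of i j])
  qed
qed

lemma linear_sym_of_coords: "linear sym_of_coords"
  by (rule linearI) (simp_all add: sym_of_coords_def scaleR_left_distrib sum.distrib scaleR_sum_right)

lemma continuous_sym_of_coords: "continuous_on A sym_of_coords"
  using linear_sym_of_coords by (intro linear_continuous_on) (simp add: linear_conv_bounded_linear)

lemma measurable_det_sym [measurable]: "(\<lambda>x. det (sym_of_coords x)) \<in> borel_measurable borel"
  by (intro borel_measurable_continuous_onI continuous_on_det continuous_intros continuous_sym_of_coords)

lemma det_scaleR_matrix: "det (c *\<^sub>R (X :: real^'n^'n)) = c ^ CARD('n) * det X"
  unfolding det_def by (simp add: prod.distrib sum_distrib_left mult_ac)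

text \<open>
  A symmetric square root of \<open>G(r, 1)\<close> has the same shape. If \<open>y\<close> is its
  off-diagonal entry and \<open>y + \<surd>(r - 1)\<close> its diagonal entry, the condition is \<open>L
  y\<^sup>2 + 2 y \<surd>(r - 1) = 1\<close>, of which \<open>root_off\<close> is the positive solution.
\<close>

definition root_off :: "'n itself \<Rightarrow> real \<Rightarrow> real"
  where "root_off _ r = (sqrt (r - 1 + CARD('n)) - sqrt (r - 1)) / CARD('n)"

definition cov_root :: "real \<Rightarrow> real^('n::{finite,linorder} sym_index)^('n sym_index)"
  where "cov_root r = diag_block_sum (G_matrix (root_off TYPE('n) r + sqrt (r - 1)) (root_off TYPE('n) r))"

lemma diag_block_sum_nth:
  "diag_block_sum (G_matrix a b) $ p $ q = (if idx_row p = idx_col p \<and> idx_row q = idx_col q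
    then (if idx_row p = idx_row q then a else b) else if p = q then 1 else 0)"
  by (simp add: diag_block_sum_def G_matrix_def)

lemma sum_diag_idx:
  fixes f :: "'n::{finite,linorder} sym_index \<Rightarrow> real"
  shows "(\<Sum>p\<in>UNIV. if idx_row p = idx_col p then f p else 0) = (\<Sum>i\<in>UNIV. f (Abs_sym_index (i, i)))"
proof -
  have "(\<Sum>p\<in>UNIV. if idx_row p = idx_col p then f p else 0) = (\<Sum>p\<in>{p. idx_row p = idx_col p}. f p)"
    by (simp add: sum.If_cases)
  also have "\<dots> = (\<Sum>i\<in>UNIV. f (Abs_sym_index (i, i)))"
    by (rule sum.reindex_bij_witness[of _ "\<lambda>i. Abs_sym_index (i, i)" idx_row])
       (auto simp: idx_Abs intro!: idx_eqI arg_cong[of _ _ f])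
  finally show ?thesis .
qed

lemma root_off_eq:
  fixes r :: real
  assumes "1 < r"
  shows "real CARD('n::finite) * root_off TYPE('n) r + sqrt (r - 1) = sqrt (r - 1 + real CARD('n))"
    and "real CARD('n) * (root_off TYPE('n) r)\<^sup>2 + 2 * root_off TYPE('n) r * sqrt (r - 1) = 1"
proof -
  let ?n = "real CARD('n)" and ?y = "root_off TYPE('n) r" and ?d = "sqrt (r - 1)"
  have n: "0 < ?n" by simp
  show 1: "?n * ?y + ?d = sqrt (r - 1 + ?n)" using n by (simp add: root_off_def)
  have "(?n * ?y + ?d)\<^sup>2 = r - 1 + ?n" unfolding 1 using assms by simp
  moreover have "?d\<^sup>2 = r - 1" using assms by simp
  ultimately have "?n * (?n * ?y\<^sup>2 + 2 * ?y * ?d) = ?n * 1" by (simp add: power2_eq_square algebra_simps)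
  then show "?n * ?y\<^sup>2 + 2 * ?y * ?d = 1" using n by (simp only: mult_cancel_left) simp
qed

lemma cov_root_sq:
  assumes "1 < r"
  shows "cov_root r ** transpose (cov_root r) = (diag_block_sum (G_matrix r 1) :: real^('n::{finite,linorder} sym_index)^('n sym_index))"
  unfolding vec_eq_iff
proof (intro allI)
  fix p q :: "'n sym_index"
  let ?y = "root_off TYPE('n) r" and ?d = "sqrt (r - 1)"
  let ?A = "cov_root r :: real^('n::{finite,linorder} sym_index)^('n sym_index)"
  have A: "?A $ p $ s = (if idx_row p = idx_col p \<and> idx_row s = idx_col s
    then (if idx_row p = idx_row s then ?y + ?d else ?y) else if p = s then 1 else 0)" for p s
    by (simp add: cov_root_def diag_block_sum_nth)
  have AA: "(?A ** transpose ?A) $ p $ q = (\<Sum>s\<in>UNIV. ?A $ p $ s * ?A $ q $ s)"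
    by (simp add: matrix_matrix_mult_def transpose_def)
  have "(\<Sum>s\<in>UNIV. ?A $ p $ s * ?A $ q $ s) = diag_block_sum (G_matrix r 1) $ p $ q"
  proof (cases "idx_row p = idx_col p \<and> idx_row q = idx_col q")
    case True
    then have nz: "p = s \<longrightarrow> idx_row s = idx_col s" for s by auto
    have "(\<Sum>s\<in>UNIV. ?A $ p $ s * ?A $ q $ s) =
        (\<Sum>s\<in>UNIV. if idx_row s = idx_col s then (?y + ?d * of_bool (idx_row p = idx_row s)) * (?y + ?d * of_bool (idx_row q = idx_row s)) else 0)"
      using True by (intro sum.cong refl) (auto simp: A)
    also have "\<dots> = (\<Sum>i\<in>UNIV. (?y + ?d * of_bool (idx_row p = i)) * (?y + ?d * of_bool (idx_row q = i)))"
      unfolding sum_diag_idx by (simp add: idx_Abs)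
    also have "\<dots> = (\<Sum>i\<in>UNIV. ?y\<^sup>2 + ?y * ?d * of_bool (idx_row p = i) + ?y * ?d * of_bool (idx_row q = i) +
        ?d\<^sup>2 * of_bool (idx_row p = idx_row q) * of_bool (idx_row p = i))"
      by (intro sum.cong refl) (auto simp: algebra_simps power2_eq_square)
    also have "\<dots> = CARD('n) * ?y\<^sup>2 + 2 * ?y * ?d + ?d\<^sup>2 * of_bool (idx_row p = idx_row q)"
      by (simp add: sum.distrib flip: sum_distrib_left)
    also have "\<dots> = diag_block_sum (G_matrix r 1) $ p $ q"
      using True assms root_off_eq(2)[OF assms, where 'n = 'n] by (simp add: diag_block_sum_nth)
    finally show ?thesis .
  next
    case False
    have "(\<Sum>s\<in>UNIV. ?A $ p $ s * ?A $ q $ s) = (\<Sum>s\<in>UNIV. if s = p then of_bool (p = q) else 0)"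
      using False by (intro sum.cong refl) (auto simp: A)
    moreover have "diag_block_sum (G_matrix r 1) $ p $ q = (if p = q then 1 else 0)"
      unfolding diag_block_sum_nth using False by (simp only: if_False)
    ultimately show ?thesis by simp
  qed
  then show "(?A ** transpose ?A) $ p $ q = diag_block_sum (G_matrix r 1) $ p $ q" by (simp only: AA)
qed

text \<open>
  The kernel is trivial: for \<open>z\<close> in the kernel, adding up the diagonal components gives
  \<open>\<surd>(r - 1 + L)\<close> times the trace of \<open>z\<close>, so the trace vanishes, and then each
  component does.
\<close>

lemma det_cov_root:
  assumes "1 < r"
  shows "det (cov_root r :: real^('n::{finite,linorder} sym_index)^('n sym_index)) \<noteq> 0"
proof -
  let ?y = "root_off TYPE('n) r" and ?d = "sqrt (r - 1)"
  let ?A = "cov_root r :: real^('n::{finite,linorder} sym_index)^('n sym_index)"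
  have A: "?A $ p $ s = (if idx_row p = idx_col p \<and> idx_row s = idx_col s
    then (if idx_row p = idx_row s then ?y + ?d else ?y) else if p = s then 1 else 0)" for p s
    by (simp add: cov_root_def diag_block_sum_nth)
  have "z = 0" if z: "?A *v z = 0" for z
  proof -
    define Z where "Z = (\<Sum>i\<in>UNIV. z $ Abs_sym_index (i, i))"
    have off: "z $ p = 0" if "idx_row p \<noteq> idx_col p" for p
    proof -
      have "(?A *v z) $ p = (\<Sum>s\<in>UNIV. if s = p then z $ p else 0)"
        unfolding matrix_vector_mult_def vec_lambda_beta
        using that by (intro sum.cong refl) (auto simp: A)
      then show ?thesis using z by (simp add: sum.delta)
    qed
    have diag: "?y * Z + ?d * z $ p = 0" if p: "idx_row p = idx_col p" for p
    proof -
      have "(?A *v z) $ p = (\<Sum>s\<in>UNIV. if idx_row s = idx_col s then ?y * z $ s + (if s = p then ?d * z $ p else 0) else 0)"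
        unfolding matrix_vector_mult_def vec_lambda_beta
        using p by (intro sum.cong refl) (auto simp: A algebra_simps intro: idx_eqI)
      also have "\<dots> = ?y * Z + (\<Sum>i\<in>UNIV. if Abs_sym_index (i, i) = p then ?d * z $ p else 0)"
        unfolding sum_diag_idx by (simp add: sum.distrib Z_def sum_distrib_left)
      also have "(\<Sum>i\<in>UNIV. if Abs_sym_index (i, i) = p then ?d * z $ p else 0) = (\<Sum>i\<in>UNIV. if i = idx_row p then ?d * z $ p else 0)"
      proof (rule sum.cong[OF refl])
        fix i
        have "Abs_sym_index (i, i) = p \<longleftrightarrow> i = idx_row p"
          using p idx_Abs[of i i] by (auto intro!: idx_eqI)
        then show "(if Abs_sym_index (i, i) = p then ?d * z $ p else 0) = (if i = idx_row p then ?d * z $ p else 0)" by simp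
      qed
      finally show ?thesis using z by (simp add: sum.delta)
    qed
    have "0 = (\<Sum>i\<in>(UNIV :: 'n set). ?y * Z + ?d * z $ Abs_sym_index (i, i))"
      by (rule sum.neutral[symmetric]) (simp add: diag idx_Abs)
    also have "\<dots> = (CARD('n) * ?y + ?d) * Z"
      by (simp add: sum.distrib Z_def algebra_simps flip: sum_distrib_left)
    finally have "Z = 0"
      using root_off_eq(1)[OF assms, where 'n = 'n] assms by (simp add: add_nonneg_eq_0_iff)
    have "z $ p = 0" for p
      using off[of p] diag[of p] \<open>Z = 0\<close> assms by (cases "idx_row p = idx_col p") auto
    then show ?thesis by (simp add: vec_eq_iff)
  qed
  then have "\<exists>B. B ** ?A = mat 1" by (simp add: matrix_left_invertible_ker)
  then show ?thesis using invertible_det_nz invertible_left_inverse by blast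
qed

text \<open>
  The expectation of \<open>|det X|\<close> for \<open>X\<close> with covariance \<open>G(r, 1) \<oplus>
  1\<close>, written so that \<open>r\<close> does not occur in the measure: this makes it accessible to
  dominated convergence.
\<close>

definition mean_abs_det :: "'n::{finite,linorder} itself \<Rightarrow> real \<Rightarrow> ennreal"
  where "mean_abs_det _ r = (\<integral>\<^sup>+ x. ennreal (std_gauss_vec x) *
    ennreal \<bar>det (sym_of_coords (cov_root r *v (x :: real^('n sym_index))))\<bar> \<partial>lborel)"

lemma measurable_matrix_mult [measurable]: "(*v) (A :: real^'n^'m) \<in> borel_measurable borel"
  by (intro borel_measurable_continuous_onI linear_continuous_on)
     (simp add: linear_conv_bounded_linear[symmetric] matrix_vector_mul_linear)

lemma mean_abs_det_coords:
  "mean_abs_det TYPE('n::{finite,linorder}) r = (\<integral>\<^sup>+ c. ennreal (gauss_coords UNIV c *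
    \<bar>det (\<Sum>p\<in>(UNIV :: 'n sym_index set). c p *\<^sub>R sym_of_coords (cov_root r *v axis p 1))\<bar>) \<partial>leb_coords UNIV)"
proof -
  have "mean_abs_det TYPE('n) r = (\<integral>\<^sup>+ c. ennreal (gauss_coords UNIV c) *
      ennreal \<bar>det (sym_of_coords (cov_root r *v (\<Sum>p\<in>(UNIV :: 'n sym_index set). c p *\<^sub>R axis p 1)))\<bar> \<partial>leb_coords UNIV)"
    unfolding mean_abs_det_def
  proof (rule gauss_coords_linear_image[symmetric])
    fix j k :: "'n sym_index"
    show "(\<Sum>b\<in>UNIV. axis b 1 $ j * axis b 1 $ k) = (if j = k then 1 else (0 :: real))"
      by (auto simp: axis_def if_distrib[of "\<lambda>x. x * _"] cong: if_cong)
    show "(\<lambda>x :: real^('n sym_index). ennreal \<bar>det (sym_of_coords (cov_root r *v x))\<bar>) \<in> borel_measurable borel"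
      using measurable_compose[OF measurable_matrix_mult measurable_det_sym] by measurable
  qed simp
  then show ?thesis
    by (simp add: linear_sum[OF matrix_vector_mul_linear] linear_scale[OF matrix_vector_mul_linear]
        linear_sum[OF linear_sym_of_coords] linear_scale[OF linear_sym_of_coords] ennreal_mult)
qed

lemma continuous_on_if_const:
  "continuous_on A f \<Longrightarrow> continuous_on A g \<Longrightarrow> continuous_on A (\<lambda>x. if P then f x else g x)"
  by (cases P) simp_all

lemma mean_abs_det_tendsto:
  assumes r: "r \<longlonglongrightarrow> r0"
  shows "(\<lambda>n. mean_abs_det TYPE('n::{finite,linorder}) (r n)) \<longlonglongrightarrow> mean_abs_det TYPE('n) r0"
    and "mean_abs_det TYPE('n) r0 < \<infinity>"
proof -
  let ?T = "\<lambda>r p. sym_of_coords (cov_root r *v axis p 1) ::  real^'n::_^'n::_"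
  have cont: "continuous_on UNIV (\<lambda>r. ?T r p $ i $ j)" for p i j
  proof -
    have "continuous_on UNIV (\<lambda>r. (cov_root r :: real^('n sym_index)^('n sym_index)) $ a $ b)" for a b
      unfolding cov_root_def diag_block_sum_nth root_off_def
      by (intro continuous_on_if_const continuous_intros) simp_all
    then have "continuous_on UNIV (\<lambda>r. cov_root r *v axis p 1 :: real^('n sym_index))"
      unfolding matrix_vector_mult_basis column_def by (intro continuous_on_vec_lambda)
    then have "continuous_on UNIV (\<lambda>r. ?T r p)"
      by (intro continuous_on_compose2[OF continuous_sym_of_coords[of UNIV]]) auto
    then show ?thesis by (intro continuous_intros)
  qed
  have lim: "(\<lambda>n. ?T (r n) p $ i $ j) \<longlonglongrightarrow> ?T r0 p $ i $ j" for p i j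
    using continuous_on_tendsto_compose[OF cont r] by simp
  have limT: "(\<lambda>n. ?T (r n) p) \<longlonglongrightarrow> ?T r0 p" for p
    by (intro vec_tendstoI lim)
  have "\<exists>l. \<forall>n. \<bar>?T (r n) p $ i $ j\<bar> \<le> l" for p i j
    using convergent_imp_Bseq[OF convergentI[OF lim]] unfolding Bseq_def real_norm_def by blast
  then obtain l where l: "\<And>p i j n. \<bar>?T (r n) p $ i $ j\<bar> \<le> l p i j" by metis
  define L where "L = (\<Sum>p\<in>UNIV. \<Sum>i\<in>UNIV. \<Sum>j\<in>UNIV. l p i j)"
  have l0: "0 \<le> l p i j" for p i j using order_trans[OF abs_ge_zero l] .
  have "l p i j \<le> L" for p i j
  proof -
    have "l p i j \<le> (\<Sum>j\<in>UNIV. l p i j)" by (rule member_le_sum) (auto simp: l0)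
    also have "\<dots> \<le> (\<Sum>i\<in>UNIV. \<Sum>j\<in>UNIV. l p i j)" by (rule member_le_sum) (auto simp: l0 sum_nonneg)
    also have "\<dots> \<le> L" unfolding L_def by (rule member_le_sum) (auto simp: l0 sum_nonneg)
    finally show ?thesis .
  qed
  then have L: "\<bar>?T (r n) p $ i $ j\<bar> \<le> L" for p i j n using l order_trans by blast
  have L': "\<bar>?T r0 p $ i $ j\<bar> \<le> L" for p i j
    by (rule tendsto_upperbound[OF tendsto_rabs[OF lim[of p i j]]]) (auto intro!: always_eventually L)
  have L0: "0 \<le> L" by (auto simp: L_def l0 intro!: sum_nonneg)
  define C where "C = (1 / sqrt (2 * pi)) ^ CARD('n sym_index) * (fact CARD('n) * real CARD('n) ^ CARD('n))"
  let ?w = "\<lambda>c :: 'n sym_index \<Rightarrow> real. exp (L * (\<Sum>b\<in>UNIV. \<bar>c b\<bar>) - (\<Sum>b\<in>UNIV. (c b)\<^sup>2) / 4)"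
  let ?f = "\<lambda>r c. gauss_coords UNIV c * \<bar>det (\<Sum>p\<in>UNIV. c p *\<^sub>R ?T r p)\<bar>"
  have bound: "?f s c \<le> C * ?w c" if "\<And>p i j. \<bar>?T s p $ i $ j\<bar> \<le> L" for s c
  proof -
    have "gauss_coords UNIV c \<le> (1 / sqrt (2 * pi)) ^ CARD('n sym_index) * exp (- (\<Sum>b\<in>UNIV. (c b)\<^sup>2) / 4)"
      unfolding gauss_coords_eq by (intro mult_left_mono) (auto simp: sum_nonneg)
    moreover have "\<bar>det (\<Sum>p\<in>UNIV. c p *\<^sub>R ?T s p)\<bar> \<le> fact CARD('n) * real CARD('n) ^ CARD('n) * exp (L * (\<Sum>b\<in>UNIV. \<bar>c b\<bar>))"
      by (rule abs_det_comb_le) (use that L0 in auto)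
    ultimately have "?f s c \<le> (1 / sqrt (2 * pi)) ^ CARD('n sym_index) * exp (- (\<Sum>b\<in>UNIV. (c b)\<^sup>2) / 4) *
        (fact CARD('n) * real CARD('n) ^ CARD('n) * exp (L * (\<Sum>b\<in>UNIV. \<bar>c b\<bar>)))"
      by (rule mult_mono) auto
    also have "\<dots> = C * ?w c"
    proof -
      have "?w c = exp (L * (\<Sum>b\<in>UNIV. \<bar>c b\<bar>)) * exp (- (\<Sum>b\<in>UNIV. (c b)\<^sup>2) / 4)" by (simp add: mult_exp_exp)
      then show ?thesis by (simp only: C_def) simp
    qed
    finally show ?thesis .
  qed
  have C0: "0 \<le> C" by (simp add: C_def)
  have int: "(\<integral>\<^sup>+ c. ennreal (C * ?w c) \<partial>leb_coords UNIV) < \<infinity>"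
  proof -
    have "integrable (leb_coords (UNIV :: 'n sym_index set)) (\<lambda>c. C * ?w c)"
      by (rule integrable_mult_right[OF integrable_exp_abs_quarter]) simp
    then show ?thesis using C0 by (subst nn_integral_eq_integral) auto
  qed
  have m: "(\<lambda>c. ennreal (?f s c)) \<in> borel_measurable (leb_coords UNIV)" for s
  proof -
    have "(\<lambda>c. \<Sum>p\<in>UNIV. c p *\<^sub>R ?T s p) \<in> borel_measurable (leb_coords UNIV)" by measurable
    then have "(\<lambda>c. det (\<Sum>p\<in>UNIV. c p *\<^sub>R ?T s p)) \<in> borel_measurable (leb_coords UNIV)"
      by (rule measurable_compose) (intro borel_measurable_continuous_onI continuous_on_det continuous_intros)
    then show ?thesis by measurable
  qed
  show "(\<lambda>n. mean_abs_det TYPE('n) (r n)) \<longlonglongrightarrow> mean_abs_det TYPE('n) r0"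
    unfolding mean_abs_det_coords
  proof (rule nn_integral_dominated_convergence[OF m m _ _ int])
    show "(\<lambda>c. ennreal (C * ?w c)) \<in> borel_measurable (leb_coords UNIV)" by measurable
    show "AE c in leb_coords UNIV. ennreal (?f (r n) c) \<le> ennreal (C * ?w c)" for n
      using bound[OF L] by (intro always_eventually allI ennreal_leI) auto
    show "AE c in leb_coords UNIV. (\<lambda>n. ennreal (?f (r n) c)) \<longlonglongrightarrow> ennreal (?f r0 c)"
      unfolding det_def
      by (intro always_eventually allI tendsto_ennrealI tendsto_intros limT)
  qed
  have "mean_abs_det TYPE('n) r0 \<le> (\<integral>\<^sup>+ c. ennreal (C * ?w c) \<partial>leb_coords UNIV)"
    unfolding mean_abs_det_coords using bound[OF L'] by (intro nn_integral_mono ennreal_leI) auto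
  then show "mean_abs_det TYPE('n) r0 < \<infinity>" using int by (rule le_less_trans)
qed

text \<open>
  Otherwise the determinant would vanish almost everywhere, and by continuity everywhere, whereas the linear
  map onto symmetric matrices attains the identity matrix.
\<close>

lemma mean_abs_det_pos:
  assumes "1 < r"
  shows "0 < mean_abs_det TYPE('n::{finite,linorder}) r"
proof (rule ccontr)
  let ?D = "\<lambda>x :: real^('n sym_index). det (sym_of_coords (cov_root r *v x))"
  have m: "(\<lambda>x. ennreal (std_gauss_vec x) * ennreal \<bar>?D x\<bar>) \<in> borel_measurable lborel"
    using measurable_compose[OF measurable_matrix_mult measurable_det_sym] by measurable
  assume "\<not> ?thesis"
  then have "AE x in lborel. ennreal (std_gauss_vec x) * ennreal \<bar>?D x\<bar> = 0"
    unfolding mean_abs_det_def using nn_integral_0_iff_AE[OF m] by simp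
  then have "AE x in lborel. \<not> ?D x \<noteq> 0"
  proof (rule AE_mp, intro AE_I2 impI)
    fix x assume "ennreal (std_gauss_vec x) * ennreal \<bar>?D x\<bar> = 0"
    moreover have "0 < std_gauss_vec x" by (simp add: std_gauss_vec_def)
    ultimately show "\<not> ?D x \<noteq> 0" by (simp add: ennreal_eq_0_iff)
  qed
  moreover have cont: "continuous_on UNIV ?D"
    by (intro continuous_on_det continuous_intros continuous_on_compose2[OF continuous_sym_of_coords[of UNIV]]) auto
  have op: "open {x. ?D x \<noteq> 0}" using cont by (intro open_Collect_neq) auto
  ultimately have "{x. ?D x \<noteq> 0} \<in> null_sets lborel"
    using AE_iff_null_sets[of "{x. ?D x \<noteq> 0}" lborel] by (simp add: borel_open)
  then have "negligible {x. ?D x \<noteq> 0}"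
    by (simp add: negligible_iff_null_sets null_sets_completionI)
  then have "{x. ?D x \<noteq> 0} = {}" using op open_not_negligible by blast
  moreover have "?D (matrix_inv (cov_root r) *v coords_of_sym (mat 1)) \<noteq> 0"
  proof -
    have "cov_root r *v (matrix_inv (cov_root r) *v coords_of_sym (mat 1)) = coords_of_sym (mat 1 :: real^'n::_^'n::_)"
      using det_cov_root[OF assms, where 'n = 'n] by (simp add: matrix_vector_mul_assoc matrix_inv_invertible invertible_det_nz)
    moreover have "sym_of_coords (coords_of_sym (mat 1)) = (mat 1 :: real^'n::_^'n::_)"
      by (rule sym_of_coords_of_sym) (auto simp: mat_def)
    ultimately show ?thesis by simp
  qed
  ultimately show False by blast
qed

lemma sym_gaussian_mean_abs_det:
  "(LINT X | sym_gaussian (C_infty :: real^('n::{finite,linorder} sym_index)^('n sym_index)). \<bar>det X\<bar>) =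
    enn2real (mean_abs_det TYPE('n) (9 / 5))"
proof -
  let ?g = "centered_gaussian (C_infty :: real^('n sym_index)^('n sym_index))"
  have C: "C_infty = cov_root (9 / 5) ** transpose (cov_root (9 / 5) :: real^('n sym_index)^('n sym_index))"
    by (simp add: C_infty_def cov_root_sq)
  have sets: "sets ?g = sets borel" by (simp add: centered_gaussian_def)
  have mc: "sym_of_coords \<in> borel_measurable (borel :: (real^('n sym_index)) measure)"
    by (rule borel_measurable_continuous_onI[OF continuous_sym_of_coords])
  have sym: "sym_of_coords x \<in> sym_matrices" for x :: "real^('n sym_index)"
    unfolding sym_matrices_def mem_Collect_eq vec_eq_iff transpose_def vec_lambda_beta
  proof (intro allI)
    fix i j
    show "sym_of_coords x $ j $ i = sym_of_coords x $ i $ j"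
      by (cases "i \<le> j") (simp_all add: sym_of_coords_nth)
  qed
  have ms: "sym_of_coords \<in> ?g \<rightarrow>\<^sub>M restrict_space borel sym_matrices"
    by (rule measurable_restrict_space2) (use sym mc sets in \<open>auto cong: measurable_cong_sets\<close>)
  have md: "(\<lambda>X. \<bar>det X\<bar>) \<in> borel_measurable (restrict_space borel (sym_matrices :: (real^'n::_^'n::_) set))"
    by (rule measurable_restrict_space1)
       (intro borel_measurable_continuous_onI continuous_on_rabs continuous_on_det continuous_intros)
  have "(LINT X | sym_gaussian (C_infty :: real^('n sym_index)^('n sym_index)). \<bar>det X\<bar>) =
      (LINT x | ?g. \<bar>det (sym_of_coords x)\<bar>)"
    unfolding sym_gaussian_def by (rule integral_distr[OF ms md])
  also have "\<dots> = enn2real (\<integral>\<^sup>+ x. ennreal \<bar>det (sym_of_coords x)\<bar> \<partial>?g)"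
    by (rule integral_eq_nn_integral) (auto simp: measurable_cong_sets[OF sets refl])
  also have "(\<integral>\<^sup>+ x. ennreal \<bar>det (sym_of_coords x)\<bar> \<partial>?g) = mean_abs_det TYPE('n) (9 / 5)"
    unfolding C mean_abs_det_def
    by (rule nn_integral_centered_gaussian) (auto simp: det_cov_root)
  finally show ?thesis .
qed

section \<open>The asymptotics\<close>

context trig_setting
begin

lemma H_symmetric: "H v \<tau> $ i $ j = H v \<tau> $ j $ i"
  by (simp add: H_def trig_hess_def mult.commute mult.left_commute)

text \<open>
  Applying the inverse of the square root of the covariance to the Hessian turns it into a vector with
  identity covariance, to which \<open>gauss_coords_linear_image\<close> applies.
\<close>

lemma hess_law:
  assumes r: "1 < r" and \<beta>: "0 < \<beta>"
    and cov: "\<And>\<tau> p q. (\<Sum>b\<in>B. coords_of_sym (H b \<tau>) $ p * coords_of_sym (H b \<tau>) $ q) =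
      \<beta> * diag_block_sum (G_matrix r 1) $ p $ q"
  shows "(\<integral>\<^sup>+ c. ennreal (gauss_coords B c * \<bar>det (\<Sum>b\<in>B. c b *\<^sub>R H b \<tau>)\<bar>) \<partial>leb_coords B) =
    ennreal (sqrt \<beta> ^ CARD('n)) * mean_abs_det TYPE('n) r"
proof -
  let ?A = "cov_root r :: real^('n sym_index)^('n sym_index)"
  define y where "y = (\<lambda>b. coords_of_sym (H b \<tau>))"
  define u where "u = (\<lambda>b. (1 / sqrt \<beta>) *\<^sub>R (matrix_inv ?A *v y b))"
  have inv: "?A ** matrix_inv ?A = mat 1" "matrix_inv ?A ** ?A = mat 1"
    using det_cov_root[OF r, where 'n = 'n] by (simp_all add: matrix_inv_invertible invertible_det_nz)
  have Yeq: "(\<Sum>b\<in>B. y b $ p * y b $ q) = \<beta> * (\<Sum>s\<in>UNIV. ?A $ p $ s * ?A $ q $ s)" for p q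
    unfolding y_def cov cov_root_sq[OF r, symmetric] by (simp add: matrix_matrix_mult_def transpose_def)
  \<comment> \<open>The covariance of two linear functionals of the Hessian.\<close>
  have bil: "(\<Sum>b\<in>B. (\<xi> \<bullet> y b) * (\<eta> \<bullet> y b)) = \<beta> * ((transpose ?A *v \<xi>) \<bullet> (transpose ?A *v \<eta>))" for \<xi> \<eta>
  proof -
    have "(\<Sum>b\<in>B. (\<xi> \<bullet> y b) * (\<eta> \<bullet> y b)) = (\<Sum>b\<in>B. \<Sum>p\<in>UNIV. \<Sum>q\<in>UNIV. \<xi> $ p * \<eta> $ q * (y b $ p * y b $ q))"
      unfolding inner_vec_def sum_product inner_real_def by (intro sum.cong refl) (simp only: mult_ac)
    also have "\<dots> = (\<Sum>p\<in>UNIV. \<Sum>q\<in>UNIV. \<xi> $ p * \<eta> $ q * (\<Sum>b\<in>B. y b $ p * y b $ q))"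
      by (subst sum.swap, rule sum.cong[OF refl], subst sum.swap) (simp only: sum_distrib_left)
    also have "\<dots> = (\<Sum>p\<in>UNIV. \<Sum>q\<in>UNIV. \<Sum>s\<in>UNIV. \<beta> * ((\<xi> $ p * ?A $ p $ s) * (\<eta> $ q * ?A $ q $ s)))"
      unfolding Yeq by (simp add: sum_distrib_left mult_ac)
    also have "\<dots> = (\<Sum>s\<in>UNIV. \<Sum>p\<in>UNIV. \<Sum>q\<in>UNIV. \<beta> * ((\<xi> $ p * ?A $ p $ s) * (\<eta> $ q * ?A $ q $ s)))"
      by (subst (2) sum.swap, subst sum.swap) simp
    also have "\<dots> = \<beta> * (\<Sum>s\<in>UNIV. (\<Sum>p\<in>UNIV. \<xi> $ p * ?A $ p $ s) * (\<Sum>q\<in>UNIV. \<eta> $ q * ?A $ q $ s))"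
      by (simp only: flip: sum_distrib_left sum_distrib_right)
    also have "\<dots> = \<beta> * ((transpose ?A *v \<xi>) \<bullet> (transpose ?A *v \<eta>))"
      by (simp add: inner_vec_def matrix_vector_mult_def transpose_def mult.commute)
    finally show ?thesis .
  qed
  have cov_u: "(\<Sum>b\<in>B. u b $ j * u b $ k) = (if j = k then 1 else 0)" for j k
  proof -
    have u_nth: "u b $ j = (1 / sqrt \<beta>) * ((transpose (matrix_inv ?A) *v axis j 1) \<bullet> y b)" for b j
      by (simp add: u_def cart_eq_inner_axis[of "matrix_inv ?A *v y b"] inner_commute dot_lmul_matrix[symmetric] transpose_matrix_vector)
    have tt: "transpose ?A *v (transpose (matrix_inv ?A) *v x) = x" for x
      unfolding matrix_vector_mul_assoc matrix_transpose_mul[symmetric] inv transpose_mat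
      by (rule matrix_vector_mul_lid)
    have "(\<Sum>b\<in>B. u b $ j * u b $ k) = (1 / sqrt \<beta>) * (1 / sqrt \<beta>) *
        (\<Sum>b\<in>B. ((transpose (matrix_inv ?A) *v axis j 1) \<bullet> y b) * ((transpose (matrix_inv ?A) *v axis k 1) \<bullet> y b))"
      unfolding u_nth sum_distrib_left by (simp add: mult_ac)
    also have "\<dots> = axis j 1 \<bullet> (axis k 1 :: real^('n sym_index))"
      unfolding bil tt using \<beta> by simp
    also have "\<dots> = (if j = k then 1 else 0)" by (simp add: inner_axis_axis)
    finally show ?thesis .
  qed
  have rec: "(\<Sum>b\<in>B. c b *\<^sub>R H b \<tau>) = sqrt \<beta> *\<^sub>R sym_of_coords (?A *v (\<Sum>b\<in>B. c b *\<^sub>R u b))" for c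
  proof -
    have "?A *v (\<Sum>b\<in>B. c b *\<^sub>R u b) = (1 / sqrt \<beta>) *\<^sub>R (\<Sum>b\<in>B. c b *\<^sub>R y b)"
      by (simp add: linear_sum[OF matrix_vector_mul_linear] linear_scale[OF matrix_vector_mul_linear] u_def
          matrix_vector_mul_assoc inv scaleR_sum_right)
    moreover have "sym_of_coords (\<Sum>b\<in>B. c b *\<^sub>R y b) = (\<Sum>b\<in>B. c b *\<^sub>R H b \<tau>)"
      by (simp add: linear_sum[OF linear_sym_of_coords] linear_scale[OF linear_sym_of_coords] y_def
          sym_of_coords_of_sym H_symmetric)
    ultimately show ?thesis using \<beta> by (simp add: linear_scale[OF linear_sym_of_coords])
  qed
  have m: "(\<lambda>x :: real^('n sym_index). ennreal \<bar>det (sym_of_coords (?A *v x))\<bar>) \<in> borel_measurable borel"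
    using measurable_compose[OF measurable_matrix_mult measurable_det_sym] by measurable
  let ?X = "\<lambda>c. \<Sum>b\<in>B. c b *\<^sub>R u b"
  have "(\<integral>\<^sup>+ c. ennreal (gauss_coords B c * \<bar>det (\<Sum>b\<in>B. c b *\<^sub>R H b \<tau>)\<bar>) \<partial>leb_coords B) =
      (\<integral>\<^sup>+ c. ennreal (sqrt \<beta> ^ CARD('n)) * (ennreal (gauss_coords B c) * ennreal \<bar>det (sym_of_coords (?A *v ?X c))\<bar>) \<partial>leb_coords B)"
    using \<beta> by (intro nn_integral_cong) (simp add: rec det_scaleR_matrix abs_mult ennreal_mult mult_ac)
  also have "\<dots> = ennreal (sqrt \<beta> ^ CARD('n)) * (\<integral>\<^sup>+ c. ennreal (gauss_coords B c) * ennreal \<bar>det (sym_of_coords (?A *v ?X c))\<bar> \<partial>leb_coords B)"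
  proof (rule nn_integral_cmult)
    have "?X \<in> borel_measurable (leb_coords B)" by measurable
    from measurable_compose[OF this m]
    show "(\<lambda>c. ennreal (gauss_coords B c) * ennreal \<bar>det (sym_of_coords (?A *v ?X c))\<bar>) \<in> borel_measurable (leb_coords B)"
      by measurable
  qed
  also have "(\<integral>\<^sup>+ c. ennreal (gauss_coords B c) * ennreal \<bar>det (sym_of_coords (?A *v ?X c))\<bar> \<partial>leb_coords B) = mean_abs_det TYPE('n) r"
    unfolding mean_abs_det_def by (rule gauss_coords_linear_image[OF finite_B cov_u m])
  finally show ?thesis .
qed

end

text \<open>
  The kurtosis of the uniform distribution on \<open>{- \<nu>..\<nu>}\<close>, which tends to the kurtosis
  \<open>9/5\<close> of the uniform distribution on an interval.
\<close>

definition kurtosis_ratio :: "nat \<Rightarrow> real"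
  where "kurtosis_ratio \<nu> = 9 / 5 - 3 / (5 * (real \<nu> * (real \<nu> + 1)))"

lemma kurtosis_ratio_eq:
  assumes "0 < \<nu>"
  shows "power_sum \<nu> 4 / power_sum \<nu> 0 = kurtosis_ratio \<nu> * (power_sum \<nu> 2 / power_sum \<nu> 0)\<^sup>2" "1 < kurtosis_ratio \<nu>"
proof -
  have nz: "power_sum \<nu> 0 \<noteq> 0" "real \<nu> * (real \<nu> + 1) \<noteq> 0" using assms by (simp_all add: power_sum_0)
  have "1 \<le> real \<nu>" using assms by simp
  then have "1 * (1 + 1) \<le> real \<nu> * (real \<nu> + 1)" by (intro mult_mono) auto
  then have "3 / (5 * (real \<nu> * (real \<nu> + 1))) \<le> 3 / (5 * 2)" by (intro divide_left_mono) auto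
  then show "1 < kurtosis_ratio \<nu>" unfolding kurtosis_ratio_def by linarith
  define x where "x = real \<nu> * (real \<nu> + 1)"
  have p2: "power_sum \<nu> 2 / power_sum \<nu> 0 = x / 3"
    using nz by (simp add: power_sum_2 x_def)
  have p4: "power_sum \<nu> 4 / power_sum \<nu> 0 = x * (3 * x - 1) / 15"
    unfolding power_sum_4 nonzero_mult_div_cancel_left[OF nz(1)] x_def
    by (simp add: power2_eq_square algebra_simps)
  show "power_sum \<nu> 4 / power_sum \<nu> 0 = kurtosis_ratio \<nu> * (power_sum \<nu> 2 / power_sum \<nu> 0)\<^sup>2"
    unfolding p2 p4 kurtosis_ratio_def x_def[symmetric] using nz(2)[folded x_def]
    by (simp add: field_simps power2_eq_square)
qed

text \<open>
  The number of frequencies enters the scales \<open>S\<close> and \<open>\<beta>\<close> of the gradient and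
  of the Hessian in the same way and cancels; what is left of \<open>\<beta>/S\<close> is the variance
  \<open>\<sigma> = \<nu>(\<nu>+1)/3\<close> of a coordinate of the frequency.
\<close>

lemma mean_critical_freq_box:
  assumes \<nu>: "0 < \<nu>"
  shows "mean_critical (freq_box \<nu> :: (int^'n::{finite,linorder}) set) =
    ennreal (sqrt (2 * pi * (real \<nu> * (real \<nu> + 1) / 3)) ^ CARD('n)) * mean_abs_det TYPE('n) (kurtosis_ratio \<nu>)"
proof -
  let ?M = "freq_box \<nu> :: (int^'n::_) set"
  define s0 where "s0 = power_sum \<nu> 0"
  define \<sigma> where "\<sigma> = power_sum \<nu> 2 / s0"
  define S where "S = s0 ^ CARD('n) * \<sigma> / (2 * pi) ^ CARD('n)"
  define \<beta> where "\<beta> = s0 ^ CARD('n) * \<sigma>\<^sup>2 / (2 * pi) ^ CARD('n)"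
  let ?r = "kurtosis_ratio \<nu>"
  have s0: "0 < s0" by (simp add: s0_def power_sum_0 add_nonneg_pos)
  have \<sigma>_eq: "\<sigma> = real \<nu> * (real \<nu> + 1) / 3" using s0 by (simp add: \<sigma>_def power_sum_2 s0_def)
  have \<sigma>: "0 < \<sigma>" using \<nu> by (simp add: \<sigma>_eq)
  have S: "0 < S" and \<beta>: "0 < \<beta>" using s0 \<sigma> by (simp_all add: S_def \<beta>_def)
  have cone: "?M \<subseteq> freq_cone" by (auto simp: freq_box_def)
  have ne: "?M \<noteq> {}"
  proof
    assume "?M = {}"
    then have "(2 * \<nu> + 1) ^ CARD('n) = 1"
      using card_freq_box[of \<nu>, where 'n = 'n] by (simp only: card.empty)
    then show False using one_less_power[of "2 * \<nu> + 1" "CARD('n)"] \<nu> by simp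
  qed
  define B where "B = (SOME B. l2_orthonormal_basis (trig_space ?M) B)"
  interpret trig_setting ?M B
    by unfold_locales
       (rule finite_freq_box cone someI[where P = "l2_orthonormal_basis (trig_space ?M)", OF trig_basis[OF finite_freq_box cone], folded B_def])+
  have iso: "2 / (2 * pi) ^ CARD('n) * (\<Sum>m\<in>?M. freq_vec m $ j * freq_vec m $ k) = (if j = k then S else 0)" for j k
    using sum_pairs_freq_box[where \<nu> = \<nu> and j = j and k = k] by (simp add: S_def \<sigma>_def s0_def)
  have cov: "(\<Sum>b\<in>B. coords_of_sym (H b \<tau>) $ p * coords_of_sym (H b \<tau>) $ q) =
      \<beta> * diag_block_sum (G_matrix ?r 1) $ p $ q" for \<tau> p q
  proof -
    have eq: "idx_row p = idx_row q \<and> idx_col p = idx_col q \<longleftrightarrow> p = q" by (auto intro: idx_eqI)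
    have "(\<Sum>b\<in>B. coords_of_sym (H b \<tau>) $ p * coords_of_sym (H b \<tau>) $ q) = 1 / (2 * pi) ^ CARD('n) *
        (2 * (\<Sum>m\<in>?M. freq_vec m $ idx_row p * freq_vec m $ idx_col p * freq_vec m $ idx_row q * freq_vec m $ idx_col q))"
      unfolding coords_of_sym_def vec_lambda_beta H_cov by simp
    also have "\<dots> = \<beta> * diag_block_sum (G_matrix ?r 1) $ p $ q"
      unfolding sum_quadruples_freq_box[OF idx_le idx_le] diag_block_sum_nth kurtosis_ratio_eq(1)[OF \<nu>] eq
      by (auto simp: \<beta>_def \<sigma>_def s0_def)
    finally show ?thesis .
  qed
  note law = hess_law[OF kurtosis_ratio_eq(2)[OF \<nu>] \<beta> cov]
  have fin: "mean_abs_det TYPE('n) ?r < \<infinity>" by (rule mean_abs_det_tendsto(2)[of "\<lambda>_. ?r"]) simp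
  define e where "e = enn2real (mean_abs_det TYPE('n) ?r)"
  have e: "mean_abs_det TYPE('n) ?r = ennreal e" "0 \<le> e" using fin by (simp_all add: e_def)
  have "mean_critical ?M = ennreal ((2 * pi) ^ CARD('n) * ((1 / sqrt (2 * pi * S)) ^ CARD('n) * (sqrt \<beta> ^ CARD('n) * e)))"
  proof (rule mean_critical_eq[OF finite_freq_box cone ne S iso])
    show "(\<integral>\<^sup>+ c. ennreal (gauss_coords (SOME B. l2_orthonormal_basis (trig_space ?M) B) c *
        \<bar>det (\<Sum>b\<in>(SOME B. l2_orthonormal_basis (trig_space ?M) B). c b *\<^sub>R H b \<tau>)\<bar>)
        \<partial>leb_coords (SOME B. l2_orthonormal_basis (trig_space ?M) B)) = ennreal (sqrt \<beta> ^ CARD('n) * e)" for \<tau>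
      unfolding B_def[symmetric] law e(1) using e(2) \<beta> by (simp add: ennreal_mult)
    show "0 \<le> sqrt \<beta> ^ CARD('n) * e" using e(2) \<beta> by simp
  qed
  also have "(2 * pi) ^ CARD('n) * ((1 / sqrt (2 * pi * S)) ^ CARD('n) * (sqrt \<beta> ^ CARD('n) * e)) =
      (2 * pi * (1 / sqrt (2 * pi * S)) * sqrt \<beta>) ^ CARD('n) * e"
    by (simp only: power_mult_distrib mult_ac)
  also have "2 * pi * (1 / sqrt (2 * pi * S)) * sqrt \<beta> = sqrt (2 * pi * \<sigma>)"
  proof -
    define a where "a = sqrt (2 * pi)"
    have a: "a * a = 2 * pi" "0 < a" by (simp_all add: a_def)
    have "\<beta> = S * \<sigma>" by (simp add: \<beta>_def S_def power2_eq_square)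
    then have sq: "sqrt (2 * pi * S) = a * sqrt S" "sqrt \<beta> = sqrt S * sqrt \<sigma>"
      unfolding a_def by (simp_all only: real_sqrt_mult)
    have "2 * pi * (1 / sqrt (2 * pi * S)) * sqrt \<beta> = a * sqrt \<sigma>"
      using S a(2) unfolding sq unfolding a(1)[symmetric] by (simp add: field_simps)
    then show ?thesis unfolding a_def by (simp only: real_sqrt_mult)
  qed
  also have "ennreal (sqrt (2 * pi * \<sigma>) ^ CARD('n) * e) = ennreal (sqrt (2 * pi * \<sigma>) ^ CARD('n)) * mean_abs_det TYPE('n) ?r"
    using \<sigma> e by (simp add: ennreal_mult)
  finally show ?thesis by (simp only: \<sigma>_eq)
qed

lemma kurtosis_ratio_tendsto: "kurtosis_ratio \<longlonglongrightarrow> 9 / 5"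
  unfolding kurtosis_ratio_def[abs_def] by real_asymp

theorem theorem3p2:
  shows "(\<lambda>\<nu>. enn2real (mean_critical (freq_box \<nu> :: (int^('n::{finite,linorder})) set)) /
      ((pi / 6) powr (real CARD('n) / 2)
        * (LINT X | sym_gaussian (C_infty :: real^('n sym_index)^('n sym_index)). \<bar>det X\<bar>)
        * real (dim (trig_space (freq_box \<nu> :: (int^('n::{finite,linorder})) set)))))
    \<longlonglongrightarrow> 1"
proof -
  let ?n = "CARD('n)"
  define E where "E = (\<lambda>r. enn2real (mean_abs_det TYPE('n) r))"
  have fin: "mean_abs_det TYPE('n) r < \<infinity>" for r by (rule mean_abs_det_tendsto(2)[of "\<lambda>_. r"]) simp
  have E0: "0 < E (9 / 5)"
    unfolding E_def using mean_abs_det_pos[of "9 / 5", where 'n = 'n] fin by (simp add: enn2real_positive_iff)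
  have Elim: "(\<lambda>\<nu>. E (kurtosis_ratio \<nu>)) \<longlonglongrightarrow> E (9 / 5)"
  proof -
    have "mean_abs_det TYPE('n) (9 / 5) = ennreal (E (9 / 5))" using fin by (simp add: E_def)
    then have "(\<lambda>\<nu>. mean_abs_det TYPE('n) (kurtosis_ratio \<nu>)) \<longlonglongrightarrow> ennreal (E (9 / 5))"
      using mean_abs_det_tendsto(1)[OF kurtosis_ratio_tendsto, where 'n = 'n] by simp
    from tendsto_enn2real[OF this] show ?thesis using E0 by (simp add: E_def)
  qed
  \<comment> \<open>The factor \<open>\<rho>\<close> compares \<open>4\<nu>(\<nu>+1)\<close> with \<open>(2\<nu>+1)\<^sup>2\<close>, and \<open>\<kappa>\<close> the number of lattice points with \<open>dim V\<close>.\<close>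
  define \<rho> where "\<rho> = (\<lambda>\<nu> :: nat. real \<nu> * (real \<nu> + 1) * 4 / (2 * real \<nu> + 1)\<^sup>2)"
  have \<rho>: "\<rho> \<longlonglongrightarrow> 1" unfolding \<rho>_def by real_asymp
  define \<kappa> where "\<kappa> = (\<lambda>\<nu> :: nat. (2 * real \<nu> + 1) ^ ?n / ((2 * real \<nu> + 1) ^ ?n - 1))"
  have \<kappa>: "\<kappa> \<longlonglongrightarrow> 1"
  proof -
    have top: "filterlim (\<lambda>\<nu>. (2 * real \<nu> + 1) ^ ?n) at_top sequentially"
      by (intro filterlim_pow_at_top) (simp, real_asymp)
    have "((\<lambda>x :: real. x / (x - 1)) \<longlongrightarrow> 1) at_top" by real_asymp
    from filterlim_compose[OF this top] show ?thesis unfolding \<kappa>_def .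
  qed
  have "(\<lambda>\<nu>. sqrt (\<rho> \<nu>) ^ ?n * (E (kurtosis_ratio \<nu>) / E (9 / 5)) * \<kappa> \<nu>) \<longlonglongrightarrow> sqrt 1 ^ ?n * (E (9 / 5) / E (9 / 5)) * 1"
    using E0 by (intro tendsto_intros \<rho> \<kappa> Elim) auto
  then have lim: "(\<lambda>\<nu>. sqrt (\<rho> \<nu>) ^ ?n * (E (kurtosis_ratio \<nu>) / E (9 / 5)) * \<kappa> \<nu>) \<longlonglongrightarrow> 1"
    using E0 by simp
  have eq: "enn2real (mean_critical (freq_box \<nu> :: (int^'n::_) set)) /
      ((pi / 6) powr (real ?n / 2)
        * (LINT X | sym_gaussian (C_infty :: real^('n sym_index)^('n sym_index)). \<bar>det X\<bar>)
        * real (dim (trig_space (freq_box \<nu> :: (int^'n::_) set)))) =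
      sqrt (\<rho> \<nu>) ^ ?n * (E (kurtosis_ratio \<nu>) / E (9 / 5)) * \<kappa> \<nu>" if \<nu>: "0 < \<nu>" for \<nu>
  proof -
    have cone: "(freq_box \<nu> :: (int^'n::_) set) \<subseteq> freq_cone" by (auto simp: freq_box_def)
    have dim: "real (dim (trig_space (freq_box \<nu> :: (int^'n::_) set))) = (2 * real \<nu> + 1) ^ ?n - 1"
    proof -
      have "real (2 * card (freq_box \<nu> :: (int^'n::_) set) + 1) = real ((2 * \<nu> + 1) ^ ?n)"
        by (simp only: card_freq_box)
      then have "2 * real (card (freq_box \<nu> :: (int^'n::_) set)) + 1 = (2 * real \<nu> + 1) ^ ?n"
        unfolding of_nat_add of_nat_mult of_nat_power of_nat_1 of_nat_numeral .
      then show ?thesis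
        unfolding dim_trig_space[OF finite_freq_box cone] of_nat_mult of_nat_numeral by linarith
    qed
    have num: "enn2real (mean_critical (freq_box \<nu> :: (int^'n::_) set)) =
        sqrt (2 * pi * (real \<nu> * (real \<nu> + 1) / 3)) ^ ?n * E (kurtosis_ratio \<nu>)"
      unfolding mean_critical_freq_box[OF \<nu>] E_def by (simp add: enn2real_mult)
    have "2 * pi * (real \<nu> * (real \<nu> + 1) / 3) = pi / 6 * (\<rho> \<nu> * (2 * real \<nu> + 1)\<^sup>2)"
      by (simp add: \<rho>_def)
    then have "sqrt (2 * pi * (real \<nu> * (real \<nu> + 1) / 3)) = sqrt (pi / 6) * (sqrt (\<rho> \<nu>) * \<bar>2 * real \<nu> + 1\<bar>)"
      by (simp only: real_sqrt_mult real_sqrt_abs)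
    then have "sqrt (2 * pi * (real \<nu> * (real \<nu> + 1) / 3)) = sqrt (pi / 6) * (sqrt (\<rho> \<nu>) * (2 * real \<nu> + 1))"
      by simp
    moreover have "(pi / 6) powr (real ?n / 2) = sqrt (pi / 6) ^ ?n"
      by (simp add: powr_half_sqrt[symmetric] powr_realpow[symmetric] powr_powr)
    moreover have "0 < sqrt (pi / 6) ^ ?n" by simp
    moreover have E_95: "enn2real (mean_abs_det TYPE('n) (9 / 5)) = E (9 / 5)" by (simp add: E_def)
    ultimately show ?thesis
      unfolding num dim sym_gaussian_mean_abs_det E_95 \<kappa>_def
      by (simp add: power_mult_distrib)
  qed
  have "\<forall>\<^sub>F \<nu> in sequentially. sqrt (\<rho> \<nu>) ^ ?n * (E (kurtosis_ratio \<nu>) / E (9 / 5)) * \<kappa> \<nu> =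
      enn2real (mean_critical (freq_box \<nu> :: (int^'n::_) set)) /
      ((pi / 6) powr (real ?n / 2)
        * (LINT X | sym_gaussian (C_infty :: real^('n sym_index)^('n sym_index)). \<bar>det X\<bar>)
        * real (dim (trig_space (freq_box \<nu> :: (int^'n::_) set))))"
    using eventually_gt_at_top[of 0] by eventually_elim (simp only: eq)
  then show ?thesis by (rule Lim_transform_eventually[OF lim])
qed

end
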